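(* Given as input a connected block graph $G$ with $n$ vertices and $m$ edges, Algorithm A (described in the context) constructs a strong rainbow coloring of $G$, and it can be executed in $O(n+m)$ time.
   Context: All graphs are finite, simple, undirected and connected. A cut vertex is a vertex whose removal disconnects the graph. A block of $G$ is a maximal biconnected subgraph (a bridge edge $K_2$ counts as a block). A block graph is a graph in which every block is a clique; every edge lies in a unique block. Given a (not necessarily proper) edge-coloring, a path is rainbow if no two of its edges have the same color. A strong rainbow coloring of $G$ is an edge-coloring such that between every pair of vertices there is a shortest path that is rainbow. For a block $B$, let $C(B)$ be the set of cut vertices of $G$ lying in $B$. Algorithm A, on input a block graph $G$: (1) Let $\mathcal{V}_{<3}$ be the set of blocks $U$ with $|C(U)|<3$, and $\mathcal{V}_{\geq 3}$ the set of remaining blocks. (2) For each $U \in \mathcal{V}_{<3}$, color all edges of $U$ with one fresh color, distinct for distinct $U$. (3) For each $B \in \mathcal{V}_{\geq 3}$ (in any order): choose three distinct cut vertices $b_1,b_2,b_3 \in C(B)$; let $C_i$ be the connected component containing $b_i$ of the graph obtained from $G$ by deleting the edges of $B$ (these three components are distinct); choose in each $C_i$ a block belonging to $\mathcal{V}_{<3}$ and let $c_i$ be the color given to that block in step (2); color all edges of $B$ not incident to $b_1$ with $c_1$; color all edges of $B$ incident to $b_1$, except $b_1b_2$, with $c_2$; color the edge $b_1b_2$ with $c_3$. Linear-time preprocessing of $G$ is allowed in the implementation and counted in the running time (on a standard random access machine). *)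

theory Defs
  imports Main
begin

section \<open>Graphs\<close>

datatype 'a ugraph = Graph (verts: "'a set") (edges: "'a set set")

definition simple_graph :: "'a ugraph \<Rightarrow> bool" where
  "simple_graph G \<longleftrightarrow> finite (verts G) \<and> (\<forall>e\<in>edges G. e \<subseteq> verts G \<and> card e = 2)"

definition path_between :: "'a ugraph \<Rightarrow> 'a \<Rightarrow> 'a list \<Rightarrow> 'a \<Rightarrow> bool" where
  "path_between G x p y \<longleftrightarrow>
     p \<noteq> [] \<and> hd p = x \<and> last p = y \<and> distinct p \<and> set p \<subseteq> verts G \<and>
     successively (\<lambda>u v. {u, v} \<in> edges G) p"

definition shortest_path :: "'a ugraph \<Rightarrow> 'a \<Rightarrow> 'a list \<Rightarrow> 'a \<Rightarrow> bool" where
  "shortest_path G x p y \<longleftrightarrow>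
     path_between G x p y \<and> (\<forall>q. path_between G x q y \<longrightarrow> length p \<le> length q)"

definition reachable :: "'a ugraph \<Rightarrow> 'a \<Rightarrow> 'a \<Rightarrow> bool" where
  "reachable G x y \<longleftrightarrow> (\<exists>p. path_between G x p y)"

definition connected_graph :: "'a ugraph \<Rightarrow> bool" where
  "connected_graph G \<longleftrightarrow> verts G \<noteq> {} \<and> (\<forall>x\<in>verts G. \<forall>y\<in>verts G. reachable G x y)"

definition component_of :: "'a ugraph \<Rightarrow> 'a \<Rightarrow> 'a set" where
  "component_of G x = {y. reachable G x y}"

definition del_vertex :: "'a ugraph \<Rightarrow> 'a \<Rightarrow> 'a ugraph" where
  "del_vertex G v = Graph (verts G - {v}) {e \<in> edges G. v \<notin> e}"

definition del_edges :: "'a ugraph \<Rightarrow> 'a set set \<Rightarrow> 'a ugraph" where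
  "del_edges G F = Graph (verts G) (edges G - F)"

definition cut_vertex :: "'a ugraph \<Rightarrow> 'a \<Rightarrow> bool" where
  "cut_vertex G v \<longleftrightarrow> v \<in> verts G \<and>
     (\<exists>x\<in>verts G - {v}. \<exists>y\<in>verts G - {v}. \<not> reachable (del_vertex G v) x y)"

definition subgraph :: "'a ugraph \<Rightarrow> 'a ugraph \<Rightarrow> bool" where
  "subgraph H G \<longleftrightarrow> simple_graph H \<and> verts H \<subseteq> verts G \<and> edges H \<subseteq> edges G"

text \<open>The one- and two-vertex complete graphs are biconnected, so bridges are blocks, and the
  only block of a one-vertex graph is the graph itself.\<close>

definition biconnected :: "'a ugraph \<Rightarrow> bool" where
  "biconnected G \<longleftrightarrow> connected_graph G \<and> (\<forall>v. \<not> cut_vertex G v)"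

definition block :: "'a ugraph \<Rightarrow> 'a ugraph \<Rightarrow> bool" where
  "block G B \<longleftrightarrow> subgraph B G \<and> biconnected B \<and>
     (\<forall>H. subgraph H G \<and> biconnected H \<and> subgraph B H \<longrightarrow> H = B)"

definition clique :: "'a ugraph \<Rightarrow> bool" where
  "clique B \<longleftrightarrow> (\<forall>x\<in>verts B. \<forall>y\<in>verts B. x \<noteq> y \<longrightarrow> {x, y} \<in> edges B)"

definition block_graph :: "'a ugraph \<Rightarrow> bool" where
  "block_graph G \<longleftrightarrow> simple_graph G \<and> connected_graph G \<and> (\<forall>B. block G B \<longrightarrow> clique B)"

section \<open>Rainbow colorings\<close>

type_synonym 'a coloring = "'a set \<rightharpoonup> nat"

definition path_edges :: "'a list \<Rightarrow> 'a set list" where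
  "path_edges p = map2 (\<lambda>u v. {u, v}) p (tl p)"

definition rainbow :: "'a coloring \<Rightarrow> 'a list \<Rightarrow> bool" where
  "rainbow col p \<longleftrightarrow> distinct (map col (path_edges p))"

definition strong_rainbow_coloring :: "'a ugraph \<Rightarrow> 'a coloring \<Rightarrow> bool" where
  "strong_rainbow_coloring G col \<longleftrightarrow> dom col = edges G \<and>
     (\<forall>x\<in>verts G. \<forall>y\<in>verts G. \<exists>p. shortest_path G x p y \<and> rainbow col p)"

section \<open>Algorithm A\<close>

definition cut_vertices_in :: "'a ugraph \<Rightarrow> 'a ugraph \<Rightarrow> 'a set" where
  "cut_vertices_in G B = {v \<in> verts B. cut_vertex G v}"

definition small_blocks :: "'a ugraph \<Rightarrow> 'a ugraph set" where
  "small_blocks G = {U. block G U \<and> card (cut_vertices_in G U) < 3}"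

definition large_blocks :: "'a ugraph \<Rightarrow> 'a ugraph set" where
  "large_blocks G = {B. block G B \<and> card (cut_vertices_in G B) \<ge> 3}"

text \<open>The color given to a block \<open>U\<close> in step (2) is \<open>\<kappa> U\<close>.\<close>

definition algA_step2 :: "'a ugraph \<Rightarrow> ('a ugraph \<Rightarrow> nat) \<Rightarrow> 'a coloring \<Rightarrow> bool" where
  "algA_step2 G \<kappa> col \<longleftrightarrow> inj_on \<kappa> (small_blocks G) \<and>
     dom col = (\<Union>U\<in>small_blocks G. edges U) \<and>
     (\<forall>U\<in>small_blocks G. \<forall>e\<in>edges U. col e = Some (\<kappa> U))"

text \<open>The small blocks available for a cut vertex \<open>b\<close> of \<open>B\<close> in step (3). A small block differs
  from the large block \<open>B\<close>, so none of its edges is deleted and comparing vertex sets suffices.\<close>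

definition candidates :: "'a ugraph \<Rightarrow> 'a ugraph \<Rightarrow> 'a \<Rightarrow> 'a ugraph set" where
  "candidates G B b =
     {U \<in> small_blocks G. verts U \<subseteq> component_of (del_edges G (edges B)) b}"

definition color_block ::
    "'a ugraph \<Rightarrow> 'a \<Rightarrow> 'a \<Rightarrow> nat \<Rightarrow> nat \<Rightarrow> nat \<Rightarrow> 'a coloring \<Rightarrow> 'a coloring" where
  "color_block B b1 b2 c1 c2 c3 col = (\<lambda>e.
     if e \<notin> edges B then col e
     else if b1 \<notin> e then Some c1
     else if e \<noteq> {b1, b2} then Some c2
     else Some c3)"

text \<open>One iteration of step (3); a state consists of the large blocks still to be processed and
  the current coloring.\<close>

inductive algA_step3 :: "'a ugraph \<Rightarrow> ('a ugraph \<Rightarrow> nat) \<Rightarrow>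
    'a ugraph set \<times> 'a coloring \<Rightarrow> 'a ugraph set \<times> 'a coloring \<Rightarrow> bool"
  for G \<kappa> where
  "\<lbrakk> B \<in> R;
     b1 \<in> cut_vertices_in G B; b2 \<in> cut_vertices_in G B; b3 \<in> cut_vertices_in G B;
     distinct [b1, b2, b3];
     U1 \<in> candidates G B b1; U2 \<in> candidates G B b2; U3 \<in> candidates G B b3 \<rbrakk>
   \<Longrightarrow> algA_step3 G \<kappa> (R, col) (R - {B}, color_block B b1 b2 (\<kappa> U1) (\<kappa> U2) (\<kappa> U3) col)"

definition algA_output :: "'a ugraph \<Rightarrow> 'a coloring \<Rightarrow> bool" where
  "algA_output G col \<longleftrightarrow>
     (\<exists>\<kappa> col0. algA_step2 G \<kappa> col0 \<and>
        (algA_step3 G \<kappa>)\<^sup>*\<^sup>* (large_blocks G, col0) ({}, col))"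

text \<open>No choice made in step (3) can leave the algorithm without a block to pick a color from.\<close>

definition algA_never_stuck :: "'a ugraph \<Rightarrow> bool" where
  "algA_never_stuck G \<longleftrightarrow>
     (\<forall>B\<in>large_blocks G. \<forall>b\<in>cut_vertices_in G B. candidates G B b \<noteq> {})"

section \<open>Random access machines\<close>

text \<open>The machine of Cook and Reckhow with uniform cost, over natural numbers (subtraction is
  truncated). There is no multiplication, so a step at most doubles the largest register.
  The program halts when the program counter leaves the program; reading past the end of the
  input yields 0.\<close>

datatype instr =
    Const nat nat            \<comment> \<open>\<open>X\<^sub>i := k\<close>\<close>
  | Add nat nat nat          \<comment> \<open>\<open>X\<^sub>i := X\<^sub>j + X\<^sub>k\<close>\<close>
  | Sub nat nat nat          \<comment> \<open>\<open>X\<^sub>i := X\<^sub>j - X\<^sub>k\<close>\<close>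
  | Load nat nat             \<comment> \<open>\<open>X\<^sub>i := X\<close> at address \<open>X\<^sub>j\<close>\<close>
  | Store nat nat            \<comment> \<open>\<open>X\<close> at address \<open>X\<^sub>i := X\<^sub>j\<close>\<close>
  | JumpPos nat nat          \<comment> \<open>go to instruction \<open>l\<close> if \<open>X\<^sub>j > 0\<close>\<close>
  | Read nat
  | Print nat

datatype config =
  Config (pc: nat) (mem: "nat \<Rightarrow> nat") (inp: "nat list") (out: "nat list")

fun exec_instr :: "instr \<Rightarrow> config \<Rightarrow> config" where
  "exec_instr (Const i k) (Config p X xs ys) = Config (p + 1) (X(i := k)) xs ys"
| "exec_instr (Add i j k) (Config p X xs ys) = Config (p + 1) (X(i := X j + X k)) xs ys"
| "exec_instr (Sub i j k) (Config p X xs ys) = Config (p + 1) (X(i := X j - X k)) xs ys"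
| "exec_instr (Load i j) (Config p X xs ys) = Config (p + 1) (X(i := X (X j))) xs ys"
| "exec_instr (Store i j) (Config p X xs ys) = Config (p + 1) (X(X i := X j)) xs ys"
| "exec_instr (JumpPos l j) (Config p X xs ys) =
     Config (if X j > 0 then l else p + 1) X xs ys"
| "exec_instr (Read i) (Config p X xs ys) =
     Config (p + 1) (X(i := (case xs of [] \<Rightarrow> 0 | x # _ \<Rightarrow> x))) (tl xs) ys"
| "exec_instr (Print i) (Config p X xs ys) = Config (p + 1) X xs (ys @ [X i])"

definition ram_step :: "instr list \<Rightarrow> config \<Rightarrow> config" where
  "ram_step P c = (if pc c < length P then exec_instr (P ! pc c) c else c)"

definition ram_computes_within :: "instr list \<Rightarrow> nat list \<Rightarrow> nat \<Rightarrow> nat list \<Rightarrow> bool" where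
  "ram_computes_within P xs t ys \<longleftrightarrow>
     (let c = (ram_step P ^^ t) (Config 0 (\<lambda>_. 0) xs [])
      in pc c \<ge> length P \<and> out c = ys)"

text \<open>A graph with vertices \<open>0, \<dots>, n - 1\<close> is presented to the machine by \<open>n\<close>, \<open>m\<close> and an
  arbitrary enumeration of its \<open>m\<close> edges; the output lists the colors in the order of
  this enumeration.\<close>

definition edge_list_of :: "(nat \<times> nat) list \<Rightarrow> nat set list" where
  "edge_list_of es = map (\<lambda>(u, v). {u, v}) es"

definition enumerates_graph :: "(nat \<times> nat) list \<Rightarrow> nat ugraph \<Rightarrow> bool" where
  "enumerates_graph es G \<longleftrightarrow> (\<exists>n. verts G = {..<n}) \<and>
     distinct (edge_list_of es) \<and> set (edge_list_of es) = edges G"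

definition encode_graph :: "nat ugraph \<Rightarrow> (nat \<times> nat) list \<Rightarrow> nat list" where
  "encode_graph G es =
     card (verts G) # card (edges G) # concat (map (\<lambda>(u, v). [u, v]) es)"

definition decode_coloring :: "(nat \<times> nat) list \<Rightarrow> nat list \<Rightarrow> nat coloring" where
  "decode_coloring es cs = map_of (zip (edge_list_of es) cs)"

end

theory Submission imports Defs begin

text \<open>A block \<open>B\<close> of a block graph is a maximal clique, and distinct vertices of \<open>B\<close> lie in distinct components once the
  edges of \<open>B\<close> are deleted. An edge \<open>e\<close> of \<open>B\<close> has the color of a small block that is \<open>B\<close> itself or lies in
  the component of a vertex of \<open>B\<close> outside \<open>e\<close>. A shortest path uses at most one edge of every block.
  If two of its edges, \<open>e\<close> in \<open>B\<close> and \<open>e'\<close> in \<open>B'\<close>, had the color of the same small block, then this block would,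
  seen from \<open>B'\<close>, lie on the same side as \<open>B\<close>, that is, in the component of an endpoint of \<open>e'\<close>.

  For the linear running time, note that a vertex order in which every vertex except the first has an earlier neighbor
  determines the blocks: if the parent of a vertex is its earliest neighbor, then the endpoints of every edge are
  parent and child or have the same parent, and each block consists of a vertex and a class of
  pairwise adjacent children. Two breadth-first searches are made, the second one from the last vertex of the first. This
  vertex lies in a block with at most one cut vertex, so the new root is not a cut vertex and its block is small.
  For a large block one can then always take the common parent as \<open>b\<^sub>1\<close> and the root's block as the
  source of \<open>c\<^sub>1\<close>, while \<open>b\<^sub>2\<close> and \<open>b\<^sub>3\<close> are children that have children, and small blocks
  below them are found bottom-up. All phases are loops with a known number of iterations and a loop-free body, which
  makes both the compilation to the machine and the count of its steps simple.\<close>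

section \<open>Reachability\<close>

text \<open>Adjacencies are mostly found by closing a cycle: two neighbors of a vertex that stay
  connected without it are adjacent. Maximality of cliques, the local test for cut vertices and the
  shape of the search tree all rest on this.

  The freedom of step (3) is removed at once. Distinct blocks share no edges, so the iterations
  cannot disturb one another, and the outputs are exactly the colorings that are correct block by
  block (\<open>block_wise\<close>). The machine's coloring is compared with this description and
  never with a run.

  The obstacle to linear time is that a separate search for a small block on each chosen side of
  each large block would be too slow. With the parent as first cut vertex, its side always contains
  the root, so a single color serves all large blocks, and the other two sides contain the subtrees
  of children, where one bottom-up pass suffices. This works only if the block at the root is itself
  small, whence the second search. The parent also makes the cases of step (3) visible from
  \<open>par\<close>: the edges avoiding it are those between siblings.\<close>

definition adj :: "'a ugraph \<Rightarrow> 'a \<Rightarrow> 'a \<Rightarrow> bool" where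
  "adj G u v \<longleftrightarrow> {u, v} \<in> edges G"

lemma adj_commute: "adj G u v \<longleftrightarrow> adj G v u"
  by (simp add: adj_def insert_commute)

lemma path_between_adj: "path_between G x p y \<longleftrightarrow>
    p \<noteq> [] \<and> hd p = x \<and> last p = y \<and> distinct p \<and> set p \<subseteq> verts G \<and> successively (adj G) p"
  unfolding path_between_def adj_def by simp

lemma simple_graph_adjD:
  assumes "simple_graph G" "adj G u v"
  shows "u \<noteq> v" "u \<in> verts G" "v \<in> verts G"
  using assms unfolding simple_graph_def adj_def by (fastforce simp: card_insert_if)+

lemma simple_graph_edgeE:
  assumes "simple_graph G" "e \<in> edges G"
  obtains u v where "e = {u, v}" "u \<noteq> v" "u \<in> verts G" "v \<in> verts G"
  using assms unfolding simple_graph_def by (metis card_2_iff insert_subset)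

lemma simple_graph_finite_edges: "simple_graph G \<Longrightarrow> finite (edges G)"
  unfolding simple_graph_def by (meson Pow_iff finite_Pow_iff finite_subset subsetI)

lemma successively_adj_rtranclp:
  assumes "successively (adj G) p" "p \<noteq> []"
  shows "(adj G)\<^sup>*\<^sup>* (hd p) (last p)"
  using assms
proof (induction p rule: induct_list012)
  case (3 x y zs)
  then show ?case by (auto intro: converse_rtranclp_into_rtranclp)
qed auto

text \<open>Paths do not repeat vertices, so if \<open>z\<close> already occurs, the prefix ending
  in \<open>z\<close> is taken instead.\<close>

lemma path_between_snoc:
  assumes "path_between G x p y" "adj G y z" "z \<in> verts G"
  shows "reachable G x z"
proof (cases "z \<in> set p")
  case True
  then obtain a b where p: "p = a @ z # b" by (meson split_list)
  have "path_between G x (a @ [z]) z"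
    using assms(1) unfolding p path_between_adj
    by (auto simp: successively_append_iff hd_append split: if_splits)
  then show ?thesis unfolding reachable_def by blast
next
  case False
  have "path_between G x (p @ [z]) z"
    using assms False unfolding path_between_adj by (auto simp: successively_append_iff)
  then show ?thesis unfolding reachable_def by blast
qed

text \<open>Trades repetition-free paths for a closure that is transitive and symmetric without
  further work. The vertex condition is there because the closure is reflexive everywhere.\<close>

lemma reachable_iff:
  assumes "simple_graph G"
  shows "reachable G x y \<longleftrightarrow> x \<in> verts G \<and> (adj G)\<^sup>*\<^sup>* x y"
proof
  assume "reachable G x y"
  then obtain p where p: "path_between G x p y" unfolding reachable_def by blast
  then show "x \<in> verts G \<and> (adj G)\<^sup>*\<^sup>* x y"
    unfolding path_between_adj using successively_adj_rtranclp[of G p] hd_in_set[of p] by auto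
next
  assume "x \<in> verts G \<and> (adj G)\<^sup>*\<^sup>* x y"
  then have "(adj G)\<^sup>*\<^sup>* x y" and x: "x \<in> verts G" by auto
  then show "reachable G x y"
  proof (induction rule: rtranclp_induct)
    case base
    have "path_between G x [x] x" using x by (simp add: path_between_adj)
    then show ?case unfolding reachable_def by blast
  next
    case (step y z)
    then show ?case using path_between_snoc simple_graph_adjD(3)[OF assms] x
      unfolding reachable_def by metis
  qed
qed

lemma adj_rtranclp_sym: "(adj G)\<^sup>*\<^sup>* x y \<Longrightarrow> (adj G)\<^sup>*\<^sup>* y x"
  by (metis sympD sympI symp_rtranclp adj_commute)

lemma adj_del_vertex: "adj (del_vertex G v) a b \<longleftrightarrow> adj G a b \<and> a \<noteq> v \<and> b \<noteq> v"
  by (auto simp: adj_def del_vertex_def)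

lemma adj_del_edges: "adj (del_edges G F) a b \<longleftrightarrow> adj G a b \<and> {a, b} \<notin> F"
  by (simp add: adj_def del_edges_def)

lemma verts_del_vertex [simp]: "verts (del_vertex G v) = verts G - {v}"
  and verts_del_edges [simp]: "verts (del_edges G F) = verts G"
  by (simp_all add: del_vertex_def del_edges_def)

lemma simple_graph_del_vertex: "simple_graph G \<Longrightarrow> simple_graph (del_vertex G v)"
  unfolding simple_graph_def del_vertex_def by auto

lemma simple_graph_del_edges: "simple_graph G \<Longrightarrow> simple_graph (del_edges G F)"
  unfolding simple_graph_def del_edges_def by auto

section \<open>Biconnected subgraphs and blocks of block graphs\<close>

definition induced :: "'a ugraph \<Rightarrow> 'a set \<Rightarrow> 'a ugraph" where
  "induced G S = Graph S {e \<in> edges G. e \<subseteq> S}"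

lemma verts_induced [simp]: "verts (induced G S) = S"
  and edges_induced: "edges (induced G S) = {e \<in> edges G. e \<subseteq> S}"
  by (simp_all add: induced_def)

lemma adj_induced [simp]: "adj (induced G S) u v \<longleftrightarrow> adj G u v \<and> u \<in> S \<and> v \<in> S"
  by (auto simp: induced_def adj_def)

lemma subgraph_induced: "simple_graph G \<Longrightarrow> S \<subseteq> verts G \<Longrightarrow> subgraph (induced G S) G"
  unfolding subgraph_def simple_graph_def induced_def by (auto intro: finite_subset)

lemma del_vertex_induced: "del_vertex (induced G S) v = induced G (S - {v})"
  unfolding del_vertex_def induced_def by auto

text \<open>Both connectedness and the absence of cut vertices are tested by joining all vertices to
  one hub, which may depend on the deleted vertex. The existential form also covers the case that
  nothing is left.\<close>

lemma biconnected_inducedI: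
  assumes G: "simple_graph G" and S: "S \<subseteq> verts G" "S \<noteq> {}"
    and hub: "\<exists>h. \<forall>x\<in>S. (adj (induced G S))\<^sup>*\<^sup>* x h"
      "\<And>v. v \<in> S \<Longrightarrow> \<exists>h. \<forall>x\<in>S - {v}. (adj (induced G (S - {v})))\<^sup>*\<^sup>* x h"
  shows "biconnected (induced G S)"
proof -
  have *: "reachable (induced G T) x y"
    if "T \<subseteq> verts G" "\<exists>h. \<forall>x\<in>T. (adj (induced G T))\<^sup>*\<^sup>* x h" "x \<in> T" "y \<in> T" for T x y
  proof -
    from that(2) obtain h where h: "\<forall>x\<in>T. (adj (induced G T))\<^sup>*\<^sup>* x h" ..
    have "(adj (induced G T))\<^sup>*\<^sup>* h y" using h that adj_rtranclp_sym by metis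
    moreover have "(adj (induced G T))\<^sup>*\<^sup>* x h" using h that by blast
    moreover have "simple_graph (induced G T)"
      using subgraph_induced[OF G that(1)] subgraph_def by blast
    ultimately show ?thesis
      using that(3) by (subst reachable_iff) (auto intro: rtranclp_trans)
  qed
  have "connected_graph (induced G S)"
    unfolding connected_graph_def using S *[OF S(1) hub(1)] by simp
  moreover have "\<not> cut_vertex (induced G S) v" for v
  proof (cases "v \<in> S")
    case True
    have "S - {v} \<subseteq> verts G" using S by blast
    from *[OF this hub(2)[OF True]] show ?thesis
      unfolding cut_vertex_def del_vertex_induced verts_induced by blast
  qed (simp add: cut_vertex_def)
  ultimately show ?thesis unfolding biconnected_def by blast
qed

lemma biconnected_clique:
  assumes G: "simple_graph G" and S: "S \<subseteq> verts G" "S \<noteq> {}"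
    and cl: "\<forall>x\<in>S. \<forall>y\<in>S. x \<noteq> y \<longrightarrow> adj G x y"
  shows "biconnected (induced G S)"
proof (rule biconnected_inducedI[OF G S])
  have *: "\<exists>h. \<forall>x\<in>T. (adj (induced G T))\<^sup>*\<^sup>* x h" if "T \<subseteq> S" for T
  proof (cases "T = {}")
    case False
    then obtain h where "h \<in> T" by blast
    have "(adj (induced G T))\<^sup>*\<^sup>* x h" if "x \<in> T" for x
      using cl \<open>h \<in> T\<close> that \<open>T \<subseteq> S\<close> by (cases "x = h") (blast, fastforce intro!: r_into_rtranclp)
    then show ?thesis by blast
  qed simp
  show "\<exists>h. \<forall>x\<in>S. (adj (induced G S))\<^sup>*\<^sup>* x h" using * by blast
  show "\<exists>h. \<forall>x\<in>S - {v}. (adj (induced G (S - {v})))\<^sup>*\<^sup>* x h" for v using * by blast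
qed

lemma successively_induced_hd:
  assumes "successively (adj G) p" "set p \<subseteq> T" "x \<in> set p"
  shows "(adj (induced G T))\<^sup>*\<^sup>* x (hd p)"
proof -
  obtain a b where p: "p = a @ x # b" using assms(3) by (meson split_list)
  have "successively (adj (induced G T)) (a @ [x])"
    using assms(1,2) unfolding p
    by (auto simp: successively_append_iff intro: successively_mono)
  from successively_adj_rtranclp[OF this] have "(adj (induced G T))\<^sup>*\<^sup>* (hd (a @ [x])) x" by simp
  moreover have "hd (a @ [x]) = hd p" using p by (cases a) auto
  ultimately show ?thesis by (metis adj_rtranclp_sym)
qed

lemma successively_induced_last:
  assumes "successively (adj G) p" "set p \<subseteq> T" "x \<in> set p"
  shows "(adj (induced G T))\<^sup>*\<^sup>* x (last p)"
proof -
  have "successively (adj G) (rev p)" using assms(1)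
    by (subst successively_rev) (simp add: adj_commute)
  from successively_induced_hd[OF this, of T x] assms show ?thesis by (simp add: hd_rev)
qed

text \<open>\<open>v\<close> closes \<open>p\<close> to a cycle. Any piece of \<open>p\<close> that
  keeps one end of \<open>p\<close> reaches \<open>v\<close>. Deleting \<open>w\<close> from
  \<open>p\<close> leaves two such pieces, so \<open>v\<close> is the hub; if \<open>v\<close>
  itself is deleted, the start of \<open>p\<close> is the hub.\<close>

lemma biconnected_cycle:
  assumes G: "simple_graph G" and p: "path_between G x p y" "v \<notin> set p" "adj G v x" "adj G v y"
  shows "biconnected (induced G (insert v (set p)))"
proof (rule biconnected_inducedI[OF G])
  let ?S = "insert v (set p)"
  have pne: "p \<noteq> []" and hl: "hd p = x" "last p = y" and dp: "distinct p"
    and sp: "set p \<subseteq> verts G" and su: "successively (adj G) p"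
    using p unfolding path_between_adj by auto
  show "?S \<subseteq> verts G" using sp simple_graph_adjD[OF G p(3)] by auto
  show "?S \<noteq> {}" by simp
  have hub: "(adj (induced G T))\<^sup>*\<^sup>* z v"
    if "z \<in> set q" "set q \<subseteq> T" "v \<in> T" "successively (adj G) q" "hd q = x \<or> last q = y" for z q T
  proof -
    have "q \<noteq> []" using that by auto
    from that(5) show ?thesis
    proof
      assume "hd q = x"
      then have "adj (induced G T) (hd q) v"
        using that p(3) hd_in_set[OF \<open>q \<noteq> []\<close>] by (auto simp: adj_commute)
      then show ?thesis
        using successively_induced_hd[OF that(4,2,1)] by (rule rtranclp.rtrancl_into_rtrancl[rotated])
    next
      assume "last q = y"
      then have "adj (induced G T) (last q) v"
        using that p(4) last_in_set[OF \<open>q \<noteq> []\<close>] by (auto simp: adj_commute)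
      then show ?thesis
        using successively_induced_last[OF that(4,2,1)] by (rule rtranclp.rtrancl_into_rtrancl[rotated])
    qed
  qed
  have "(adj (induced G ?S))\<^sup>*\<^sup>* z v" if "z \<in> ?S" for z
    using hub[of z p ?S] that su hl by auto
  then show "\<exists>h. \<forall>z\<in>?S. (adj (induced G ?S))\<^sup>*\<^sup>* z h" by blast
  fix w assume "w \<in> ?S"
  show "\<exists>h. \<forall>z\<in>?S - {w}. (adj (induced G (?S - {w})))\<^sup>*\<^sup>* z h"
  proof (cases "w = v")
    case True
    then have "?S - {w} = set p" using p(2) by auto
    then show ?thesis using successively_induced_hd[OF su subset_refl] by auto
  next
    case False
    then have "w \<in> set p" using \<open>w \<in> ?S\<close> by simp
    then obtain a b where ab: "p = a @ w # b" by (meson split_list)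
    have "(adj (induced G (?S - {w})))\<^sup>*\<^sup>* z v" if "z \<in> ?S - {w}" for z
    proof -
      have "z = v \<or> z \<in> set a \<or> z \<in> set b" using that ab by auto
      then consider "z = v" | "z \<in> set a" | "z \<in> set b" by blast
      then show ?thesis
      proof cases
        case 2
        then have "hd a = x" using ab hl by (cases a) auto
        then show ?thesis using hub[of z a "?S - {w}"] 2 dp su ab p(2)
          by (auto simp: successively_append_iff)
      next
        case 3
        then have "last b = y" using ab hl by (auto split: if_splits)
        moreover have "successively (adj G) b" using su ab
          by (cases b) (auto simp: successively_append_iff)
        ultimately show ?thesis using hub[of z b "?S - {w}"] 3 dp ab p(2) by auto
      qed simp
    qed
    then show ?thesis by blast
  qed
qed

lemma subgraph_trans: "subgraph A B \<Longrightarrow> subgraph B C \<Longrightarrow> subgraph A C"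
  unfolding subgraph_def by blast

text \<open>Among the biconnected subgraphs containing \<open>H\<close>, one with the largest number
  of vertices plus edges is maximal for inclusion, since equal cardinalities force equality.\<close>

lemma biconnected_in_block:
  assumes G: "simple_graph G" and H: "subgraph H G" "biconnected H"
  obtains B where "block G B" "subgraph H B"
proof -
  let ?P = "\<lambda>K. subgraph K G \<and> biconnected K \<and> subgraph H K"
  let ?f = "\<lambda>K. card (verts K) + card (edges K)"
  have fin: "finite (verts G)" "finite (edges G)"
    using G simple_graph_finite_edges by (auto simp: simple_graph_def)
  have "?P H" using H by (simp add: subgraph_def)
  moreover have "?f K < card (verts G) + card (edges G) + 1" if "?P K" for K
    using that fin unfolding subgraph_def by (simp add: add_mono card_mono le_imp_less_Suc)
  ultimately obtain B where B: "?P B" and max: "\<And>K. ?P K \<Longrightarrow> ?f K \<le> ?f B"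
    by (metis (no_types, lifting) ex_has_greatest_nat[of ?P H ?f "card (verts G) + card (edges G) + 1"])
  have "K = B" if K: "subgraph K G" "biconnected K" "subgraph B K" for K
  proof -
    have le: "?f K \<le> ?f B" using max K B subgraph_trans by blast
    have fK: "finite (verts K)" "finite (edges K)"
      using K(1) fin unfolding subgraph_def by (auto intro: finite_subset)
    have "card (verts B) \<le> card (verts K)" "card (edges B) \<le> card (edges K)"
      using K(3) fK unfolding subgraph_def by (auto intro: card_mono)
    then have "card (verts B) = card (verts K)" "card (edges B) = card (edges K)" using le by auto
    then have "verts B = verts K" "edges B = edges K"
      using K(3) fK unfolding subgraph_def by (meson card_subset_eq)+
    then show ?thesis by (cases K; cases B) auto
  qed
  then have "block G B" using B unfolding block_def by blast
  then show ?thesis using that B by blast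
qed

lemma block_graph_simple: "block_graph G \<Longrightarrow> simple_graph G"
  by (simp add: block_graph_def)

text \<open>The block around \<open>H\<close> is a clique. Hence an adjacency can be proved by
  exhibiting any biconnected subgraph through both vertices.\<close>

lemma biconnected_adj:
  assumes "block_graph G" "subgraph H G" "biconnected H" "x \<in> verts H" "y \<in> verts H" "x \<noteq> y"
  shows "adj G x y"
proof -
  obtain B where B: "block G B" "subgraph H B"
    using biconnected_in_block[OF block_graph_simple[OF assms(1)] assms(2,3)] .
  then have "clique B" "edges B \<subseteq> edges G" "x \<in> verts B" "y \<in> verts B"
    using assms(1,4,5) by (auto simp: block_graph_def block_def subgraph_def)
  then show ?thesis using assms(6) unfolding clique_def adj_def by blast
qed

text \<open>A cycle is biconnected, so it lies in a single block.\<close>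

lemma cycle_adj:
  assumes G: "block_graph G" and "adj G v u" "adj G v w" "u \<noteq> w"
    and "reachable (del_vertex G v) u w"
  shows "adj G u w"
proof -
  note sG = block_graph_simple[OF G]
  obtain p where p: "path_between (del_vertex G v) u p w" using assms unfolding reachable_def by blast
  have vp: "v \<notin> set p" and pG: "path_between G u p w"
    using p unfolding path_between_adj by (auto simp: adj_del_vertex intro: successively_mono)
  have "insert v (set p) \<subseteq> verts G"
    using pG simple_graph_adjD[OF sG assms(2)] unfolding path_between_adj by auto
  moreover have "u \<in> set p" "w \<in> set p" using pG unfolding path_between_adj by auto
  ultimately show ?thesis
    using biconnected_adj[OF G subgraph_induced[OF sG] biconnected_cycle[OF sG pG vp assms(2,3)]]
      assms(4) by auto
qed

text \<open>The path \<open>x\<close>, \<open>a\<close>, \<open>y\<close> avoids \<open>b\<close>,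
  which is adjacent to both of its ends, so the four-cycle has the chord \<open>xy\<close>. Thus the
  common neighbors of the ends of an edge are pairwise adjacent.\<close>

lemma diamond_adj:
  assumes G: "block_graph G" and ab: "adj G a b"
    and "adj G x a" "adj G x b" "adj G y a" "adj G y b" "x \<noteq> y"
  shows "adj G x y"
proof -
  note sG = block_graph_simple[OF G]
  note D = simple_graph_adjD[OF sG]
  have "path_between (del_vertex G b) x [x, a, y] y"
    using assms(3-7) ab D[OF assms(3)] D[OF assms(4)] D[OF assms(5)] D[OF assms(6)] D[OF ab]
    by (auto simp: path_between_adj adj_del_vertex adj_commute)
  then have "reachable (del_vertex G b) x y" unfolding reachable_def by blast
  then show ?thesis
    using cycle_adj[OF G _ _ assms(7), of b] assms(4,6) by (simp add: adj_commute)
qed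

lemma block_adj:
  assumes "block_graph G" "block G B" "x \<in> verts B" "y \<in> verts B" "x \<noteq> y"
  shows "adj G x y"
proof -
  have "clique B" "edges B \<subseteq> edges G"
    using assms(1,2) by (auto simp: block_graph_def block_def subgraph_def)
  then show ?thesis using assms(3-5) unfolding clique_def adj_def by blast
qed

lemma block_eq_induced:
  assumes "block_graph G" "block G B"
  shows "B = induced G (verts B)"
proof -
  have "edges B = {e \<in> edges G. e \<subseteq> verts B}"
  proof (intro equalityI subsetI)
    fix e assume "e \<in> {e \<in> edges G. e \<subseteq> verts B}"
    then obtain u v where "e = {u, v}" "u \<noteq> v" "u \<in> verts B" "v \<in> verts B"
      using simple_graph_edgeE[OF block_graph_simple[OF assms(1)], of e]
      by (metis (no_types, lifting) insert_subset mem_Collect_eq)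
    then show "e \<in> edges B" using assms unfolding block_graph_def clique_def by blast
  qed (use assms in \<open>auto simp: block_def subgraph_def simple_graph_def\<close>)
  then show ?thesis by (cases B) (simp add: induced_def)
qed

lemma block_verts: "block G B \<Longrightarrow> verts B \<subseteq> verts G" "block G B \<Longrightarrow> verts B \<noteq> {}"
  "block G B \<Longrightarrow> edges B \<subseteq> edges G"
  by (auto simp: block_def subgraph_def biconnected_def connected_graph_def)

lemma block_edge_iff:
  assumes "block_graph G" "block G B"
  shows "adj B x y \<longleftrightarrow> x \<in> verts B \<and> y \<in> verts B \<and> x \<noteq> y"
  using block_eq_induced[OF assms] block_adj[OF assms] 
    simple_graph_adjD(1)[OF block_graph_simple[OF assms(1)], of x y] adj_induced[of G "verts B" x y]
  by metis

text \<open>Adding \<open>s\<close> to the clique gives a larger clique, which is biconnected, so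
  the maximality of \<open>B\<close> applies.\<close>

lemma block_maximal:
  assumes "block_graph G" "block G B" "\<forall>x\<in>verts B. x = s \<or> adj G s x"
  shows "s \<in> verts B"
proof -
  note sG = block_graph_simple[OF assms(1)]
  let ?S = "insert s (verts B)"
  obtain x where x: "x \<in> verts B" using block_verts(2)[OF assms(2)] by blast
  then have "s \<in> verts G"
    using assms(3) simple_graph_adjD(2)[OF sG, of s x] block_verts(1)[OF assms(2)] x by auto
  then have S: "?S \<subseteq> verts G" using block_verts(1)[OF assms(2)] by auto
  have "\<forall>x\<in>?S. \<forall>y\<in>?S. x \<noteq> y \<longrightarrow> adj G x y"
    using assms(3) block_adj[OF assms(1,2)] by (auto simp: adj_commute)
  then have "biconnected (induced G ?S)" using biconnected_clique[OF sG S] by blast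
  moreover have "subgraph B (induced G ?S)"
    using assms(2) unfolding block_def subgraph_def edges_induced verts_induced simple_graph_def
    by blast
  ultimately have "induced G ?S = B"
    using assms(2) subgraph_induced[OF sG S] unfolding block_def by blast
  then show ?thesis by (metis insertI1 verts_induced)
qed

text \<open>Recognizes maximal cliques as blocks; used for the blocks read off from the search
  order.\<close>

lemma block_inducedI:
  assumes G: "block_graph G" and S: "S \<subseteq> verts G" "S \<noteq> {}"
    and cl: "\<And>x y. x \<in> S \<Longrightarrow> y \<in> S \<Longrightarrow> x \<noteq> y \<Longrightarrow> adj G x y"
    and max: "\<And>s. s \<in> verts G \<Longrightarrow> \<forall>x\<in>S. x = s \<or> adj G s x \<Longrightarrow> s \<in> S"
  shows "block G (induced G S)"
proof -
  note sG = block_graph_simple[OF G]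
  have bi: "biconnected (induced G S)" using biconnected_clique[OF sG S] cl by blast
  obtain B where B: "block G B" "subgraph (induced G S) B"
    using biconnected_in_block[OF sG subgraph_induced[OF sG S(1)] bi] by blast
  have "S \<subseteq> verts B" using B(2) by (simp add: subgraph_def)
  moreover have "verts B \<subseteq> S"
  proof
    fix s assume "s \<in> verts B"
    then show "s \<in> S" using max block_adj[OF G B(1)] \<open>S \<subseteq> verts B\<close> block_verts(1)[OF B(1)] by blast
  qed
  ultimately have "B = induced G S" using block_eq_induced[OF G B(1)] by auto
  then show ?thesis using B by simp
qed

lemma edge_in_block:
  assumes "block_graph G" "e \<in> edges G"
  shows "\<exists>B. block G B \<and> e \<in> edges B"
proof -
  note sG = block_graph_simple[OF assms(1)]
  obtain u v where e: "e = {u, v}" "u \<noteq> v" "u \<in> verts G" "v \<in> verts G"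
    using simple_graph_edgeE[OF sG assms(2)] by blast
  then have "biconnected (induced G {u, v})"
    using assms(2) by (intro biconnected_clique[OF sG]) (auto simp: adj_def insert_commute)
  then obtain B where B: "block G B" "subgraph (induced G {u, v}) B"
    using biconnected_in_block[OF sG subgraph_induced[OF sG]] e by (metis empty_subsetI insert_subset)
  have "e \<in> edges (induced G {u, v})" using assms(2) e by (simp add: edges_induced)
  then show ?thesis using B by (auto simp: subgraph_def)
qed

text \<open>Any further vertex of one block and any further vertex of the other are common neighbors
  of \<open>u\<close> and \<open>v\<close>, hence equal or adjacent by \<open>diamond_adj\<close>.
  Maximality then makes each block contain the other.\<close>

lemma block_unique_adj:
  assumes G: "block_graph G" and B: "block G B" "block G B'"
    and e: "adj B u v" "adj B' u v"
  shows "B = B'"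
proof -
  have *: "verts D \<subseteq> verts C"
    if C: "block G C" and D: "block G D" and e: "adj C u v" "adj D u v" for C D
  proof
    fix z assume z: "z \<in> verts D"
    note E = block_edge_iff[OF G C, of u v] block_edge_iff[OF G D, of u v] e
    show "z \<in> verts C"
    proof (cases "z = u \<or> z = v")
      case False
      have "x = z \<or> adj G z x" if "x \<in> verts C" for x
      proof (cases "x = u \<or> x = v \<or> x = z")
        case True
        then show ?thesis using False E z block_adj[OF G D] by blast
      next
        case xx: False
        show ?thesis
          using diamond_adj[OF G, of u v z x] False xx E z that block_adj[OF G D] block_adj[OF G C]
          by blast
      qed
      then show ?thesis using block_maximal[OF G C] by blast
    qed (use E in auto)
  qed
  have "verts B = verts B'" using *[OF B e] *[OF B(2,1) e(2,1)] by blast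
  then show ?thesis using block_eq_induced[OF G] B by metis
qed

lemma block_unique:
  assumes G: "block_graph G" and B: "block G B" "block G B'"
    and e: "e \<in> edges B" "e \<in> edges B'"
  shows "B = B'"
proof -
  obtain u v where "e = {u, v}"
    using simple_graph_edgeE[OF block_graph_simple[OF G]] e block_verts(3)[OF B(1)] by blast
  then show ?thesis using block_unique_adj[OF G B] e by (simp add: adj_def)
qed

text \<open>The contrapositive of \<open>cycle_adj\<close>. Together with the converse
  \<open>cut_vertexE\<close>, being a cut vertex becomes a local property: having two distinct
  non-adjacent neighbors.\<close>

lemma cut_vertexI:
  assumes G: "block_graph G" and "adj G v a" "adj G v b" "a \<noteq> b" "\<not> adj G a b"
  shows "cut_vertex G v"
  using cycle_adj[OF G assms(2-4)] assms simple_graph_adjD[OF block_graph_simple[OF G]]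
  unfolding cut_vertex_def by blast

lemma cut_vertexE:
  assumes G: "block_graph G" and "cut_vertex G v"
  obtains a b where "adj G v a" "adj G v b" "a \<noteq> b" "\<not> adj G a b"
proof -
  note sG = block_graph_simple[OF G]
  obtain x y where xy: "x \<in> verts G - {v}" "y \<in> verts G - {v}"
    and nr: "\<not> reachable (del_vertex G v) x y"
    using assms(2) unfolding cut_vertex_def by blast
  let ?R = "adj (del_vertex G v)"
  have "False" if N: "\<And>a b. adj G v a \<Longrightarrow> adj G v b \<Longrightarrow> a \<noteq> b \<Longrightarrow> adj G a b"
  proof -
    have "reachable G x y" using G xy unfolding block_graph_def connected_graph_def by blast
    then have "(adj G)\<^sup>*\<^sup>* x y" using reachable_iff[OF sG] by blast
    \<comment> \<open>A walk through \<open>v\<close> can be rerouted because the neighbors of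
      \<open>v\<close> are pairwise adjacent. While the walk stands on \<open>v\<close> itself, the
      invariant records that every possible continuation is already reachable without
      \<open>v\<close>.\<close>
    then have "(y \<noteq> v \<longrightarrow> ?R\<^sup>*\<^sup>* x y) \<and> (y = v \<longrightarrow> (\<forall>a. adj G v a \<longrightarrow> ?R\<^sup>*\<^sup>* x a))"
    proof (induction rule: rtranclp_induct)
      case base
      then show ?case using xy by simp
    next
      case (step y z)
      note neq = simple_graph_adjD(1)[OF sG step(2)]
      show ?case
      proof (cases "z = v")
        case False
        then show ?thesis
          using step neq
          by (cases "y = v") (auto simp: adj_del_vertex intro: rtranclp.rtrancl_into_rtrancl)
      next
        case True
        have "?R\<^sup>*\<^sup>* x a" if a: "adj G v a" for a
        proof (cases "a = y")
          case False
          have "adj G v y" using True step(2) by (simp add: adj_commute)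
          then have "adj G y a" using N[OF _ a] False by blast
          then have "?R y a"
            using neq True simple_graph_adjD(1)[OF sG a] by (simp add: adj_del_vertex)
          moreover have "?R\<^sup>*\<^sup>* x y" using step(3) neq True by blast
          ultimately show ?thesis by (rule rtranclp.rtrancl_into_rtrancl[rotated])
        qed (use step(3) neq True in blast)
        then show ?thesis using True by simp
      qed
    qed
    then have "reachable (del_vertex G v) x y"
      using xy reachable_iff[OF simple_graph_del_vertex[OF sG]] by auto
    then show False using nr by blast
  qed
  then show ?thesis using that by blast
qed

section \<open>The components left by the deletion of a block\<close>

lemma component_iff:
  assumes "simple_graph G"
  shows "x \<in> component_of (del_edges G F) w \<longleftrightarrow>
    w \<in> verts G \<and> (adj (del_edges G F))\<^sup>*\<^sup>* w x"
  unfolding component_of_def mem_Collect_eq reachable_iff[OF simple_graph_del_edges[OF assms]]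
  by simp

text \<open>A path from \<open>w\<close> to \<open>w'\<close> without edges of \<open>B\<close>
  starts with some edge \<open>ws\<close>. Since \<open>s\<close> reaches \<open>w'\<close> without
  \<open>w\<close>, it is adjacent to \<open>w'\<close>, and by \<open>diamond_adj\<close> to all of
  \<open>B\<close>. Then \<open>s\<close> is in \<open>B\<close> and \<open>ws\<close> would be an
  edge of \<open>B\<close> after all.\<close>

lemma components_disjoint:
  assumes G: "block_graph G" and B: "block G B" and w: "w \<in> verts B" "w' \<in> verts B"
    and x: "x \<in> component_of (del_edges G (edges B)) w" "x \<in> component_of (del_edges G (edges B)) w'"
  shows "w = w'"
proof (rule ccontr)
  assume ne: "w \<noteq> w'"
  note sG = block_graph_simple[OF G]
  let ?H = "del_edges G (edges B)"
  have "(adj ?H)\<^sup>*\<^sup>* w x" "(adj ?H)\<^sup>*\<^sup>* w' x" using x component_iff[OF sG] by blast+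
  then have "(adj ?H)\<^sup>*\<^sup>* w w'" using adj_rtranclp_sym rtranclp_trans by metis
  then have "reachable ?H w w'"
    using reachable_iff[OF simple_graph_del_edges[OF sG]] w(1) block_verts(1)[OF B]
    by auto
  then obtain p where p: "path_between ?H w p w'" unfolding reachable_def by blast
  obtain s q where pq: "p = w # s # q" 
    using p ne unfolding path_between_adj by (cases p rule: remdups_adj.cases) auto
  have ws: "adj G w s" "\<not> adj B w s" using p pq by (auto simp: path_between_adj adj_del_edges adj_def[of B])
  have "path_between (del_vertex G w) s (s # q) w'"
    using p unfolding pq path_between_adj
    by (auto simp: adj_del_vertex adj_del_edges intro: successively_mono)
  then have r: "reachable (del_vertex G w) s w'" unfolding reachable_def by blast
  have ww: "adj G w w'" using block_adj[OF G B w ne] .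
  have "s \<noteq> w'" using ws block_edge_iff[OF G B] w ne by blast
  from cycle_adj[OF G ws(1) ww this r] have sw: "adj G s w'" .
  have "z = s \<or> adj G s z" if z: "z \<in> verts B" for z
  proof (cases "z = w \<or> z = w' \<or> z = s")
    case True
    then show ?thesis using ws sw by (auto simp: adj_commute)
  next
    case False
    then show ?thesis
      using diamond_adj[OF G ww, of s z] ws(1) sw block_adj[OF G B z] w
      by (auto simp: adj_commute)
  qed
  then have "s \<in> verts B" using block_maximal[OF G B] by blast
  then show False using ws block_edge_iff[OF G B] w simple_graph_adjD[OF sG ws(1)] by blast
qed

abbreviation component :: "'a ugraph \<Rightarrow> 'a ugraph \<Rightarrow> 'a \<Rightarrow> 'a set" where
  "component G B w \<equiv> component_of (del_edges G (edges B)) w"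

lemma comp_iff:
  assumes "block_graph G" "block G B" "w \<in> verts B"
  shows "x \<in> component G B w \<longleftrightarrow> (adj (del_edges G (edges B)))\<^sup>*\<^sup>* w x"
  using component_iff[OF block_graph_simple[OF assms(1)]] block_verts(1)[OF assms(2)] assms(3) by blast

text \<open>Distinct blocks share no edge, so deleting the edges of \<open>B'\<close> leaves the
  clique \<open>B\<close> intact.\<close>

lemma block_subset_comp:
  assumes G: "block_graph G" and B: "block G B" "block G B'" "B \<noteq> B'"
    and "u \<in> verts B'" "y \<in> verts B" "y \<in> component G B' u"
  shows "verts B \<subseteq> component G B' u"
proof
  fix x assume x: "x \<in> verts B"
  have y: "(adj (del_edges G (edges B')))\<^sup>*\<^sup>* u y" using comp_iff[OF G B(2)] assms by blast
  show "x \<in> component G B' u"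
  proof (cases "x = y")
    case False
    then have "adj G y x" "adj B y x" using block_adj[OF G B(1)] block_edge_iff[OF G B(1)] assms(6) x by auto
    then have "adj (del_edges G (edges B')) y x"
      using block_unique_adj[OF G B(1,2)] B(3) by (auto simp: adj_del_edges adj_def[of B'])
    then show ?thesis using comp_iff[OF G B(2)] assms(5) y rtranclp.rtrancl_into_rtrancl by metis
  qed (use assms in simp)
qed

text \<open>Seen from \<open>B'\<close>, all of \<open>B\<close> lies behind \<open>u\<close>. A
  walk that stays behind another vertex \<open>w\<close> never meets \<open>B\<close>, so it
  survives the deletion of the edges of \<open>B\<close> instead.\<close>

lemma comp_subset_comp:
  assumes G: "block_graph G" and B: "block G B" "block G B'" "B \<noteq> B'"
    and u: "u \<in> verts B'" "y \<in> verts B" "y \<in> component G B' u" and w: "w \<in> verts B'" "w \<noteq> u"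
    and x: "x \<in> component G B' w"
  shows "(adj (del_edges G (edges B)))\<^sup>*\<^sup>* w x"
proof -
  have disj: "z \<notin> component G B' w" if "z \<in> verts B" for z
    using components_disjoint[OF G B(2) w(1) u(1)] block_subset_comp[OF G B u] w that by blast
  have "(adj (del_edges G (edges B')))\<^sup>*\<^sup>* w x" using x comp_iff[OF G B(2) w(1)] by blast
  then show ?thesis
  proof (induction rule: rtranclp_induct)
    case (step y z)
    have "y \<notin> verts B" using disj[of y] step(1) comp_iff[OF G B(2) w(1)] by blast
    then have "adj (del_edges G (edges B)) y z"
      using step(2) block_edge_iff[OF G B(1), of y z] by (auto simp: adj_del_edges adj_def[of B])
    then show ?case using step(3) by (rule rtranclp.rtrancl_into_rtrancl[rotated])
  qed simp
qed

text \<open>A cut vertex \<open>b\<close> lies in a second block \<open>B2\<close>, which is behind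
  \<open>b\<close>. If \<open>B2\<close> is not small, it has a cut vertex \<open>c\<close> other
  than \<open>b\<close>, and the side of \<open>c\<close> seen from \<open>B2\<close> is strictly
  smaller because it lacks \<open>b\<close>.\<close>

lemma small_block_in_comp:
  assumes G: "block_graph G"
  shows "block G B \<Longrightarrow> b \<in> verts B \<Longrightarrow> cut_vertex G b \<Longrightarrow>
    \<exists>U\<in>small_blocks G. verts U \<subseteq> component G B b"
proof (induction "card (component G B b)" arbitrary: B b rule: less_induct)
  case less
  note sG = block_graph_simple[OF G] and B = less(2) and b = less(3)
  obtain a c where "adj G b a" "adj G b c" "a \<noteq> c" "\<not> adj G a c"
    using cut_vertexE[OF G less(4)] .
  then obtain s where s: "adj G b s" "s \<notin> verts B" using block_adj[OF G B] by blast
  then obtain B2 where B2: "block G B2" "adj B2 b s"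
    using edge_in_block[OF G, of "{b, s}"] by (auto simp: adj_def)
  have b2: "b \<in> verts B2" and "B2 \<noteq> B" using B2 block_edge_iff[OF G B2(1)] s by blast+
  have bb: "b \<in> component G B b" "b \<in> component G B2 b" using comp_iff[OF G B b] comp_iff[OF G B2(1) b2] by auto
  have sub: "verts B2 \<subseteq> component G B b" by (rule block_subset_comp[OF G B2(1) B \<open>B2 \<noteq> B\<close> b b2 bb(1)])
  show ?case
  proof (cases "B2 \<in> small_blocks G")
    case False
    then have "3 \<le> card (cut_vertices_in G B2)" using B2(1) by (simp add: small_blocks_def)
    then have "\<not> cut_vertices_in G B2 \<subseteq> {b}" using card_mono[of "{b}" "cut_vertices_in G B2"] by auto
    then obtain c where c: "c \<in> verts B2" "cut_vertex G c" "c \<noteq> b" by (auto simp: cut_vertices_in_def)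
    have cb: "(adj (del_edges G (edges B)))\<^sup>*\<^sup>* b c" using sub c(1) comp_iff[OF G B b] by blast
    have "component G B2 c \<subseteq> component G B b"
    proof
      fix x assume "x \<in> component G B2 c"
      from comp_subset_comp[OF G B B2(1) \<open>B2 \<noteq> B\<close>[symmetric] b2 b bb(2) c(1,3) this]
      show "x \<in> component G B b" using cb comp_iff[OF G B b] by (meson rtranclp_trans)
    qed
    moreover have "b \<notin> component G B2 c" using components_disjoint[OF G B2(1) b2 c(1) bb(2)] c(3) by blast
    moreover have "finite (component G B b)"
    proof (rule finite_subset)
      show "component G B b \<subseteq> verts G"
        unfolding component_of_def reachable_def by (auto simp: path_between_adj)
      show "finite (verts G)" using sG by (simp add: simple_graph_def)
    qed
    ultimately have "card (component G B2 c) < card (component G B b)" using bb(1) by (intro psubset_card_mono) auto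
    from less(1)[OF this B2(1) c(1,2)] \<open>component G B2 c \<subseteq> component G B b\<close> show ?thesis by blast
  qed (use sub in blast)
qed

lemma algA_never_stuck: "block_graph G \<Longrightarrow> algA_never_stuck G"
  using small_block_in_comp
  unfolding algA_never_stuck_def candidates_def cut_vertices_in_def large_blocks_def by fastforce

section \<open>The outputs of Algorithm A\<close>

text \<open>Only the values on the edges of \<open>B\<close> matter, so the coloring before the iteration is replaced
  by the empty one.\<close>

definition step3_colorings :: "'a ugraph \<Rightarrow> ('a ugraph \<Rightarrow> nat) \<Rightarrow> 'a ugraph \<Rightarrow> 'a coloring set" where
  "step3_colorings G \<kappa> B = {color_block B b1 b2 (\<kappa> U1) (\<kappa> U2) (\<kappa> U3) Map.empty | b1 b2 b3 U1 U2 U3.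
     b1 \<in> cut_vertices_in G B \<and> b2 \<in> cut_vertices_in G B \<and> b3 \<in> cut_vertices_in G B \<and>
     distinct [b1, b2, b3] \<and>
     U1 \<in> candidates G B b1 \<and> U2 \<in> candidates G B b2 \<and> U3 \<in> candidates G B b3}"

text \<open>Describes the state of step (3) when the blocks in \<open>R\<close> are still uncolored,
  without reference to the order of processing; the case of empty \<open>R\<close> describes the
  outputs.\<close>

definition block_wise :: "'a ugraph \<Rightarrow> ('a ugraph \<Rightarrow> nat) \<Rightarrow> 'a ugraph set \<Rightarrow> 'a coloring \<Rightarrow> bool" where
  "block_wise G \<kappa> R col \<longleftrightarrow> inj_on \<kappa> (small_blocks G) \<and>
     (\<forall>U\<in>small_blocks G. \<forall>e\<in>edges U. col e = Some (\<kappa> U)) \<and>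
     (\<forall>B\<in>large_blocks G - R. \<exists>g\<in>step3_colorings G \<kappa> B. \<forall>e\<in>edges B. col e = g e) \<and>
     dom col = (\<Union>B\<in>small_blocks G \<union> (large_blocks G - R). edges B)"

lemma block_cases: "block G B \<longleftrightarrow> B \<in> small_blocks G \<or> B \<in> large_blocks G"
  and small_not_large: "B \<in> small_blocks G \<Longrightarrow> B \<notin> large_blocks G"
  by (auto simp: small_blocks_def large_blocks_def)

lemma edges_eq_Union_blocks:
  assumes "block_graph G"
  shows "edges G = (\<Union>B\<in>small_blocks G \<union> large_blocks G. edges B)"
proof -
  have "small_blocks G \<union> large_blocks G = {B. block G B}" using block_cases[of G] by auto
  then show ?thesis using edge_in_block[OF assms] block_verts(3)[of G] by auto
qed

text \<open>By \<open>block_unique\<close>, recoloring \<open>B\<close> leaves every edge of every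
  other block untouched.\<close>

lemma algA_step3_block_wise:
  assumes G: "block_graph G"
    and "algA_step3 G \<kappa> (R, col) (R', col')" "R \<subseteq> large_blocks G" "block_wise G \<kappa> R col"
  shows "R' \<subseteq> large_blocks G \<and> block_wise G \<kappa> R' col'"
  using assms(2)
proof cases
  case (1 B b1 b2 b3 U1 U2 U3)
  let ?g = "color_block B b1 b2 (\<kappa> U1) (\<kappa> U2) (\<kappa> U3) Map.empty"
  have B: "B \<in> large_blocks G" "block G B" using 1 assms(3) block_cases by auto
  have g: "?g \<in> step3_colorings G \<kappa> B" using 1 unfolding step3_colorings_def by blast
  have on: "col' e = ?g e" if "e \<in> edges B" for e using that 1 by (simp add: color_block_def)
  have off: "col' e = col e" if "e \<in> edges C" "block G C" "C \<noteq> B" for e C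
    using that 1 block_unique[OF G that(2) B(2) that(1)] by (auto simp: color_block_def)
  note bw = assms(4)[unfolded block_wise_def]
  have "dom col' = dom col \<union> edges B" using 1 by (auto simp: color_block_def split: if_splits)
  moreover have "large_blocks G - R' = insert B (large_blocks G - R)" using B 1 by auto
  moreover have "\<forall>U\<in>small_blocks G. \<forall>e\<in>edges U. col' e = Some (\<kappa> U)"
    using off bw B small_not_large block_cases by metis
  moreover have "\<exists>g\<in>step3_colorings G \<kappa> C. \<forall>e\<in>edges C. col' e = g e"
    if "C \<in> large_blocks G - R'" for C
  proof (cases "C = B")
    case False
    then have "C \<in> large_blocks G - R" using that 1 by auto
    then obtain g where "g\<in>step3_colorings G \<kappa> C" "\<forall>e\<in>edges C. col e = g e" using bw by blast
    then show ?thesis using off[OF _ _ False] that block_cases by (metis DiffD1)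
  qed (use g on in auto)
  ultimately show ?thesis using bw 1 assms(3) unfolding block_wise_def by auto
qed

lemma algA_output_block_wise:
  assumes G: "block_graph G" and "algA_output G col"
  obtains \<kappa> where "block_wise G \<kappa> {} col"
proof -
  obtain \<kappa> col0 where 0: "algA_step2 G \<kappa> col0"
    and run: "(algA_step3 G \<kappa>)\<^sup>*\<^sup>* (large_blocks G, col0) ({}, col)"
    using assms(2) unfolding algA_output_def by blast
  have "fst st \<subseteq> large_blocks G \<and> block_wise G \<kappa> (fst st) (snd st)"
    if "(algA_step3 G \<kappa>)\<^sup>*\<^sup>* (large_blocks G, col0) st" for st
    using that
  proof (induction rule: rtranclp_induct)
    case base
    show ?case using 0 by (simp add: algA_step2_def block_wise_def)
  next
    case (step y z)
    then show ?case using algA_step3_block_wise[OF G, of \<kappa> "fst y" "snd y" "fst z" "snd z"] by simp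
  qed
  from this[OF run] that show ?thesis by simp
qed

text \<open>Steers a run towards a prescribed result \<open>col'\<close>: the current coloring need
  only be correct already outside the blocks of \<open>R\<close>, and each iteration makes one more
  block correct.\<close>

lemma algA_step3_run:
  assumes "finite R"
    and "\<And>e. (\<forall>B\<in>R. e \<notin> edges B) \<Longrightarrow> col' e = col e"
    and "\<And>B. B \<in> R \<Longrightarrow> \<exists>g\<in>step3_colorings G \<kappa> B. \<forall>e\<in>edges B. col' e = g e"
  shows "(algA_step3 G \<kappa>)\<^sup>*\<^sup>* (R, col) ({}, col')"
  using assms
proof (induction R arbitrary: col rule: finite_induct)
  case empty
  then have "col' = col" by auto
  then show ?case by simp
next
  case (insert B R)
  obtain b1 b2 b3 U1 U2 U3 where
    v: "b1 \<in> cut_vertices_in G B" "b2 \<in> cut_vertices_in G B" "b3 \<in> cut_vertices_in G B"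
     "distinct [b1, b2, b3]" "U1 \<in> candidates G B b1" "U2 \<in> candidates G B b2" "U3 \<in> candidates G B b3"
    and g: "\<forall>e\<in>edges B. col' e = color_block B b1 b2 (\<kappa> U1) (\<kappa> U2) (\<kappa> U3) Map.empty e"
    using insert.prems(2)[of B] unfolding step3_colorings_def by blast
  let ?col = "color_block B b1 b2 (\<kappa> U1) (\<kappa> U2) (\<kappa> U3) col"
  have "algA_step3 G \<kappa> (insert B R, col) (insert B R - {B}, ?col)"
    by (rule algA_step3.intros[OF _ v]) simp
  moreover have "insert B R - {B} = R" using insert.hyps by blast
  moreover have "(algA_step3 G \<kappa>)\<^sup>*\<^sup>* (R, ?col) ({}, col')"
  proof (rule insert.IH)
    fix e assume e: "\<forall>B\<in>R. e \<notin> edges B"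
    show "col' e = ?col e"
    proof (cases "e \<in> edges B")
      case True
      then show ?thesis using g by (simp add: color_block_def)
    next
      case False
      then show ?thesis using insert.prems(1)[of e] e by (simp add: color_block_def)
    qed
  qed (use insert.prems(2) in blast)
  ultimately show ?case by (metis converse_rtranclp_into_rtranclp)
qed

lemma finite_blocks:
  assumes "block_graph G"
  shows "finite {B. block G B}"
proof (rule finite_subset)
  show "{B. block G B} \<subseteq> induced G ` Pow (verts G)"
    using block_eq_induced[OF assms] block_verts(1) by fastforce
  show "finite (induced G ` Pow (verts G))"
    using block_graph_simple[OF assms] by (simp add: simple_graph_def)
qed

text \<open>The coloring after step (2) is recovered by restricting \<open>col\<close> to the edges
  of small blocks. This is how the machine's coloring is shown to be an output.\<close>

lemma block_wise_algA_output:
  assumes G: "block_graph G" and bw: "block_wise G \<kappa> {} col"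
  shows "algA_output G col"
proof -
  let ?S = "\<Union>U\<in>small_blocks G. edges U"
  have dom: "dom col = edges G" using bw edges_eq_Union_blocks[OF G] by (simp add: block_wise_def)
  have "?S \<subseteq> dom col" using dom edges_eq_Union_blocks[OF G] by blast
  then have "algA_step2 G \<kappa> (col |` ?S)" using bw unfolding algA_step2_def block_wise_def
    by (auto simp: restrict_map_def split: if_splits)
  moreover have "(algA_step3 G \<kappa>)\<^sup>*\<^sup>* (large_blocks G, col |` ?S) ({}, col)"
  proof (rule algA_step3_run)
    show "finite (large_blocks G)"
      using finite_blocks[OF G] by (rule rev_finite_subset) (auto simp: large_blocks_def)
    fix e assume e: "\<forall>B\<in>large_blocks G. e \<notin> edges B"
    show "col e = (col |` ?S) e"
    proof (cases "e \<in> edges G")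
      case True
      then have "e \<in> ?S" using edges_eq_Union_blocks[OF G] e by blast
      then show ?thesis by simp
    next
      case False
      then have "col e = None" using dom by blast
      then show ?thesis by (simp add: restrict_map_def)
    qed
  qed (use bw in \<open>simp add: block_wise_def\<close>)
  ultimately show ?thesis unfolding algA_output_def by blast
qed

lemma card_ge_3_obtain:
  assumes "3 \<le> card S"
  obtains a b c where "a \<in> S" "b \<in> S" "c \<in> S" "distinct [a, b, c]"
proof -
  obtain T where T: "T \<subseteq> S" "card T = 3" by (rule obtain_subset_with_card_n[OF assms])
  then show ?thesis using that unfolding card_3_iff by auto
qed

lemma step3_colorings_nonempty:
  assumes "block_graph G" "B \<in> large_blocks G"
  shows "step3_colorings G \<kappa> B \<noteq> {}"
proof -
  obtain b1 b2 b3 where b: "b1 \<in> cut_vertices_in G B" "b2 \<in> cut_vertices_in G B"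
    "b3 \<in> cut_vertices_in G B" "distinct [b1, b2, b3]"
    using card_ge_3_obtain assms(2) unfolding large_blocks_def by blast
  then obtain U1 U2 U3 where
    "U1 \<in> candidates G B b1" "U2 \<in> candidates G B b2" "U3 \<in> candidates G B b3"
    using algA_never_stuck[OF assms(1)] assms(2) unfolding algA_never_stuck_def by blast
  with b show ?thesis unfolding step3_colorings_def by blast
qed

lemma algA_output_exists:
  assumes G: "block_graph G"
  shows "\<exists>col. algA_output G col"
proof -
  have "finite (small_blocks G)"
    using finite_blocks[OF G] by (rule rev_finite_subset) (auto simp: small_blocks_def)
  then obtain \<kappa> :: "'a ugraph \<Rightarrow> nat" where \<kappa>: "inj_on \<kappa> (small_blocks G)"
    using finite_imp_inj_to_nat_seg by metis
  \<comment> \<open>Each edge lies in a unique block, so arbitrary choices of step (3) colorings,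
    one for each large block, can be glued.\<close>
  define col :: "'a coloring" where "col = (\<lambda>e. if e \<in> edges G then
      (let B = (THE B. block G B \<and> e \<in> edges B) in
        if B \<in> small_blocks G then Some (\<kappa> B) else (SOME g. g \<in> step3_colorings G \<kappa> B) e) else None)"
  have *: "(THE B. block G B \<and> e \<in> edges B) = B \<and> e \<in> edges G" if "block G B" "e \<in> edges B" for e B
    using that block_unique[OF G] block_verts(3)[OF that(1)] by blast
  have small: "col e = Some (\<kappa> U)" if "U \<in> small_blocks G" "e \<in> edges U" for U e
    using *[of U e] that by (simp add: col_def block_cases)
  have large: "col e = (SOME g. g \<in> step3_colorings G \<kappa> B) e"
    if "B \<in> large_blocks G" "e \<in> edges B" for B e
    using *[of B e] that small_not_large[of B G] by (auto simp: col_def block_cases)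
  have ch: "(SOME g. g \<in> step3_colorings G \<kappa> B) \<in> step3_colorings G \<kappa> B" if "B \<in> large_blocks G" for B
    using step3_colorings_nonempty[OF G that] by (simp add: some_in_eq)
  have "dom col = edges G"
  proof
    show "edges G \<subseteq> dom col"
    proof
      fix e assume "e \<in> edges G"
      then obtain B where B: "block G B" "e \<in> edges B" using edge_in_block[OF G] by blast
      show "e \<in> dom col"
      proof (cases "B \<in> small_blocks G")
        case False
        then have BL: "B \<in> large_blocks G" using B block_cases by blast
        obtain b1 b2 c1 c2 c3 where
          "(SOME g. g \<in> step3_colorings G \<kappa> B) = color_block B b1 b2 c1 c2 c3 Map.empty"
          using ch[OF BL] unfolding step3_colorings_def by blast
        then show ?thesis using large[OF BL B(2)] B(2) by (auto simp: color_block_def)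
      qed (use small B in blast)
    qed
  qed (auto simp: col_def split: if_splits)
  then have "block_wise G \<kappa> {} col"
    using \<kappa> small large ch edges_eq_Union_blocks[OF G] unfolding block_wise_def by auto
  then show ?thesis using block_wise_algA_output[OF G] by blast
qed

section \<open>Shortest paths are rainbow\<close>

text \<open>The color rule of step (3) is made for this: color \<open>c1\<close> goes to edges
  avoiding \<open>b1\<close>, \<open>c2\<close> to edges at \<open>b1\<close> avoiding
  \<open>b2\<close>, and the one remaining edge \<open>b1b2\<close> avoids \<open>b3\<close>. The
  side that supplies the color is thus never behind an endpoint.\<close>

lemma block_wise_source:
  assumes bw: "block_wise G \<kappa> {} col" and G: "block_graph G" and B: "block G B" and e: "e \<in> edges B"
  obtains U where "U \<in> small_blocks G" "col e = Some (\<kappa> U)"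
    "U = B \<or> (\<exists>b\<in>verts B. b \<notin> e \<and> verts U \<subseteq> component G B b)"
proof (cases "B \<in> small_blocks G")
  case True
  then show ?thesis using that e bw unfolding block_wise_def by blast
next
  case False
  then have "B \<in> large_blocks G" using B block_cases by blast
  then obtain g where g: "g \<in> step3_colorings G \<kappa> B" "col e = g e"
    using bw e unfolding block_wise_def by (metis Diff_empty)
  obtain b1 b2 b3 U1 U2 U3 where
    v: "b1 \<in> cut_vertices_in G B" "b2 \<in> cut_vertices_in G B" "b3 \<in> cut_vertices_in G B"
     "distinct [b1, b2, b3]" "U1 \<in> candidates G B b1" "U2 \<in> candidates G B b2" "U3 \<in> candidates G B b3"
    and c: "col e = color_block B b1 b2 (\<kappa> U1) (\<kappa> U2) (\<kappa> U3) Map.empty e"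
    using g unfolding step3_colorings_def by blast
  obtain x y where xy: "e = {x, y}"
    using simple_graph_edgeE[OF block_graph_simple[OF G]] e block_verts(3)[OF B] by blast
  have V: "b1 \<in> verts B" "b2 \<in> verts B" "b3 \<in> verts B" using v by (auto simp: cut_vertices_in_def)
  consider "b1 \<notin> e" | "b1 \<in> e" "e \<noteq> {b1, b2}" | "e = {b1, b2}" by blast
  then show ?thesis
  proof cases
    case 1
    then have "col e = Some (\<kappa> U1)" using c e by (simp add: color_block_def)
    with that[of U1] show ?thesis using 1 v V by (auto simp: candidates_def)
  next
    case 2
    then have "col e = Some (\<kappa> U2)" using c e by (simp add: color_block_def)
    moreover have "b2 \<notin> e" using 2 v(4) xy by auto
    ultimately show ?thesis using that[of U2] v V by (auto simp: candidates_def)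
  next
    case 3
    then have "col e = Some (\<kappa> U3)" using c e by (simp add: color_block_def)
    moreover have "b3 \<notin> e" using 3 v(4) by auto
    ultimately show ?thesis using that[of U3] v V by (auto simp: candidates_def)
  qed
qed

lemma shortest_path_no_shortcut:
  assumes "shortest_path G x p y" "i < j" "Suc j < length p"
  shows "\<not> adj G (p ! i) (p ! Suc j)"
proof
  assume a: "adj G (p ! i) (p ! Suc j)"
  have pb: "p \<noteq> []" "hd p = x" "last p = y" "distinct p" "set p \<subseteq> verts G" "successively (adj G) p"
    using assms(1) by (auto simp: shortest_path_def path_between_adj)
  let ?q = "take (Suc i) p @ drop (Suc j) p"
  have "successively (adj G) (take (Suc i) p)" "successively (adj G) (drop (Suc j) p)"
    using pb(6) append_take_drop_id[of "Suc i" p] append_take_drop_id[of "Suc j" p]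
      successively_append_iff by metis+
  moreover have "last (take (Suc i) p) = p ! i" "hd (drop (Suc j) p) = p ! Suc j"
    using assms by (auto simp: take_Suc_conv_app_nth hd_drop_conv_nth)
  ultimately have "successively (adj G) ?q" using a by (auto simp: successively_append_iff)
  moreover have "distinct ?q"
    using pb(4) assms set_take_disj_set_drop_if_distinct[of p "Suc i" "Suc j"] by auto
  moreover have "hd ?q = x" "last ?q = y" "?q \<noteq> []" using pb assms by (auto simp: hd_append)
  moreover have "set ?q \<subseteq> verts G" using pb(5) set_take_subset[of "Suc i" p] set_drop_subset[of "Suc j" p]
    by auto
  ultimately have "path_between G x ?q y" by (simp add: path_between_adj)
  then have "length p \<le> length ?q" using assms(1) unfolding shortest_path_def by blast
  then show False using assms by simp
qed

text \<open>Here \<open>u\<close> and \<open>v\<close> are the ends of \<open>e\<close> and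
  \<open>e'\<close> that face each other: seen from \<open>B\<close>, the block \<open>B'\<close>
  lies behind \<open>u\<close>, and seen from \<open>B'\<close>, the block \<open>B\<close> lies
  behind \<open>v\<close>. A source \<open>U\<close> admissible for \<open>e\<close> lies in
  \<open>B\<close> or behind a vertex of \<open>B\<close> other than \<open>u\<close>, so from
  \<open>B'\<close> it is seen behind \<open>v\<close>, which is excluded for
  \<open>e'\<close>.\<close>

lemma distinct_sources:
  assumes G: "block_graph G" and B: "block G B" "block G B'" "B \<noteq> B'"
    and u: "u \<in> verts B" "u \<in> e" and v: "v \<in> verts B'" "v \<in> e'"
    and uv: "v \<in> component G B u" "u \<in> component G B' v"
    and U: "block G U"
    and s: "U = B \<or> (\<exists>b\<in>verts B. b \<notin> e \<and> verts U \<subseteq> component G B b)"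
    and s': "U = B' \<or> (\<exists>b\<in>verts B'. b \<notin> e' \<and> verts U \<subseteq> component G B' b)"
  shows False
proof -
  consider "U = B" "U = B'" | b where "U = B'" "b \<in> verts B" "b \<notin> e" "verts U \<subseteq> component G B b"
    | b where "U = B" "b \<in> verts B'" "b \<notin> e'" "verts U \<subseteq> component G B' b"
    | b b' where "b \<in> verts B" "b \<notin> e" "verts U \<subseteq> component G B b"
       "b' \<in> verts B'" "b' \<notin> e'" "verts U \<subseteq> component G B' b'" using s s' by blast
  then show False
  proof cases
    case 2
    then show False using components_disjoint[OF G B(1) _ u(1) _ uv(1)] v(1) u(2) by blast
  next
    case 3
    then show False using components_disjoint[OF G B(2) _ v(1) _ uv(2)] u(1) v(2) by blast
  next
    case 4
    obtain x where x: "x \<in> verts U" using block_verts(2)[OF U] by blast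
    have "b \<noteq> u" using 4 u by blast
    \<comment> \<open>All of \<open>B'\<close> is behind \<open>u\<close>, so the walk from
      \<open>b\<close> to \<open>x\<close> behind \<open>b\<close> uses no edge of
      \<open>B'\<close>.\<close>
    have "(adj (del_edges G (edges B')))\<^sup>*\<^sup>* b x"
      using comp_subset_comp[OF G B(2,1) B(3)[symmetric] u(1) v(1) uv(1) 4(1) \<open>b \<noteq> u\<close>] 4(3) x by blast
    moreover have "(adj (del_edges G (edges B')))\<^sup>*\<^sup>* v b"
      using block_subset_comp[OF G B v(1) u(1) uv(2)] 4(1) comp_iff[OF G B(2) v(1)] by blast
    ultimately have "x \<in> component G B' v" using comp_iff[OF G B(2) v(1)] by (meson rtranclp_trans)
    then have "b' = v" using components_disjoint[OF G B(2) 4(4) v(1)] 4(6) x by blast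
    then show False using 4 v by blast
  qed (use B in blast)
qed

lemma path_edges_nth:
  "Suc i < length p \<Longrightarrow> path_edges p ! i = {p ! i, p ! Suc i}"
  "length (path_edges p) = length p - 1"
  by (auto simp: path_edges_def nth_tl)

text \<open>Proved for every shortest path, while a strong rainbow coloring asks for one such path
  between each pair of vertices.\<close>

lemma shortest_path_rainbow:
  assumes G: "block_graph G" and bw: "block_wise G \<kappa> {} col" and p: "shortest_path G x p y"
  shows "rainbow col p"
proof -
  have pb: "distinct p" "successively (adj G) p"
    using p by (auto simp: shortest_path_def path_between_adj)
  have step: "adj G (p ! i) (p ! Suc i)" if "Suc i < length p" for i
    using pb(2) that by (simp add: successively_conv_nth)
  have ne: "col {p ! i, p ! Suc i} \<noteq> col {p ! j, p ! Suc j}" if ij: "i < j" "Suc j < length p" for i j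
  proof
    assume eq: "col {p ! i, p ! Suc i} = col {p ! j, p ! Suc j}"
    obtain B where B: "block G B" "adj B (p ! i) (p ! Suc i)"
      using edge_in_block[OF G] step[of i] ij unfolding adj_def by (metis Suc_lessD Suc_less_eq less_trans)
    obtain B' where B': "block G B'" "adj B' (p ! j) (p ! Suc j)"
      using edge_in_block[OF G] step[of j] ij unfolding adj_def by metis
    \<comment> \<open>Two edges of the path in one clique would give a chord from the start of the
      first to the end of the second.\<close>
    have no: "\<not> (adj C (p ! k) (p ! Suc k) \<and> adj C (p ! l) (p ! Suc l))"
      if "block G C" "k < l" "Suc l < length p" for C k l
    proof
      assume "adj C (p ! k) (p ! Suc k) \<and> adj C (p ! l) (p ! Suc l)"
      then have "p ! k \<in> verts C" "p ! Suc l \<in> verts C" using block_edge_iff[OF G that(1)] by auto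
      moreover have "p ! k \<noteq> p ! Suc l" using pb(1) that by (simp add: nth_eq_iff_index_eq)
      ultimately show False using block_adj[OF G that(1)] shortest_path_no_shortcut[OF p that(2,3)] by blast
    qed
    have BB: "B \<noteq> B'" using no[OF B(1) ij] B B' by blast
    have V: "p ! Suc i \<in> verts B" "p ! j \<in> verts B'"
      using B B' block_edge_iff[OF G B(1)] block_edge_iff[OF G B'(1)] by auto
    \<comment> \<open>After its edge in \<open>B\<close> the path uses no further edge of
      \<open>B\<close>, so it stays behind \<open>p ! Suc i\<close>. Symmetrically,
      \<open>bk\<close> follows the path up to its edge in \<open>B'\<close>.\<close>
    have fw: "(adj (del_edges G (edges B)))\<^sup>*\<^sup>* (p ! Suc i) (p ! k)" if "Suc i \<le> k" "k < length p" for k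
      using that
    proof (induction k rule: dec_induct)
      case (step n)
      have "\<not> adj B (p ! n) (p ! Suc n)" using no[OF B(1), of i n] B(2) step by auto
      then have "adj (del_edges G (edges B)) (p ! n) (p ! Suc n)"
        using \<open>\<And>i. Suc i < length p \<Longrightarrow> adj G (p ! i) (p ! Suc i)\<close> step(4)
        by (simp add: adj_del_edges adj_def[of B])
      moreover have "(adj (del_edges G (edges B)))\<^sup>*\<^sup>* (p ! Suc i) (p ! n)" using step by simp
      ultimately show ?case by (rule rtranclp.rtrancl_into_rtrancl[rotated])
    qed simp
    have bk: "(adj (del_edges G (edges B')))\<^sup>*\<^sup>* (p ! k) (p ! j)" if "k \<le> j" for k
      using that
    proof (induction k rule: inc_induct)
      case (step n)
      have "\<not> adj B' (p ! n) (p ! Suc n)" using no[OF B'(1), of n j] B'(2) step ij by auto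
      then have "adj (del_edges G (edges B')) (p ! n) (p ! Suc n)"
        using \<open>\<And>i. Suc i < length p \<Longrightarrow> adj G (p ! i) (p ! Suc i)\<close> step(2) ij
        by (simp add: adj_del_edges adj_def[of B'])
      then show ?case using step(3) by (rule converse_rtranclp_into_rtranclp)
    qed simp
    have uv: "p ! j \<in> component G B (p ! Suc i)" "p ! Suc i \<in> component G B' (p ! j)"
      using fw[of j] adj_rtranclp_sym[OF bk[of "Suc i"]] ij
        comp_iff[OF G B(1) V(1)] comp_iff[OF G B'(1) V(2)] by auto
    obtain U where U: "U \<in> small_blocks G" "col {p ! i, p ! Suc i} = Some (\<kappa> U)"
      "U = B \<or> (\<exists>b\<in>verts B. b \<notin> {p ! i, p ! Suc i} \<and> verts U \<subseteq> component G B b)"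
      using block_wise_source[OF bw G B(1)] B(2) unfolding adj_def by metis
    obtain U' where U': "U' \<in> small_blocks G" "col {p ! j, p ! Suc j} = Some (\<kappa> U')"
      "U' = B' \<or> (\<exists>b\<in>verts B'. b \<notin> {p ! j, p ! Suc j} \<and> verts U' \<subseteq> component G B' b)"
      using block_wise_source[OF bw G B'(1)] B'(2) unfolding adj_def by metis
    have "U = U'" using eq U U' bw unfolding block_wise_def inj_on_def by auto
    then show False
      using distinct_sources[OF G B(1) B'(1) BB V(1) _ V(2) _ uv _ U(3)] U'(3) U(1) block_cases by blast
  qed
  show ?thesis unfolding rainbow_def distinct_conv_nth
  proof (intro allI impI)
    fix i j assume ij: "i < length (map col (path_edges p))" "j < length (map col (path_edges p))" "i \<noteq> j"
    then have "Suc i < length p" "Suc j < length p" by (auto simp: path_edges_nth)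
    then show "map col (path_edges p) ! i \<noteq> map col (path_edges p) ! j"
      using ne[of i j] ne[of j i] ij(3) ij by (auto simp: path_edges_nth neq_iff)
  qed
qed

lemma algA_output_strong_rainbow:
  assumes G: "block_graph G" and "algA_output G col"
  shows "strong_rainbow_coloring G col"
proof -
  obtain \<kappa> where bw: "block_wise G \<kappa> {} col" using algA_output_block_wise[OF assms] .
  have "\<exists>p. shortest_path G x p y \<and> rainbow col p" if xy: "x \<in> verts G" "y \<in> verts G" for x y
  proof -
    obtain q where "path_between G x q y"
      using G xy unfolding block_graph_def connected_graph_def reachable_def by blast
    then obtain p where "shortest_path G x p y"
      using ex_has_least_nat[of "\<lambda>p. path_between G x p y" q length] unfolding shortest_path_def by blast
    then show ?thesis using shortest_path_rainbow[OF G bw] by blast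
  qed
  then show ?thesis
    using bw edges_eq_Union_blocks[OF G] unfolding strong_rainbow_coloring_def block_wise_def by simp
qed

section \<open>Block graphs with a search order\<close>

text \<open>\<open>par_first\<close> says that the parent is the earliest neighbor. Nothing about
  distances or layers is assumed.\<close>

locale search_order =
  fixes G :: "'a ugraph" and root :: 'a and par :: "'a \<Rightarrow> 'a" and pos :: "'a \<Rightarrow> nat"
  assumes block_graph: "block_graph G"
    and root_in: "root \<in> verts G"
    and par_adj: "v \<in> verts G \<Longrightarrow> v \<noteq> root \<Longrightarrow> adj G (par v) v"
    and par_less: "v \<in> verts G \<Longrightarrow> v \<noteq> root \<Longrightarrow> pos (par v) < pos v"
    and par_first: "v \<in> verts G \<Longrightarrow> v \<noteq> root \<Longrightarrow> adj G u v \<Longrightarrow> u \<noteq> par v \<Longrightarrow> pos (par v) < pos u"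
    and pos_inj: "inj_on pos (verts G)"
begin

definition nonroot :: "'a set" where "nonroot = verts G - {root}"

lemmas simple = block_graph_simple[OF block_graph]

lemma adjD: "adj G u v \<Longrightarrow> u \<noteq> v" "adj G u v \<Longrightarrow> u \<in> verts G" "adj G u v \<Longrightarrow> v \<in> verts G"
  using simple_graph_adjD[OF simple] by blast+

lemma nonrootD: "v \<in> nonroot \<Longrightarrow> v \<in> verts G" "v \<in> nonroot \<Longrightarrow> v \<noteq> root"
  by (auto simp: nonroot_def)

lemma par: "v \<in> nonroot \<Longrightarrow> adj G (par v) v" "v \<in> nonroot \<Longrightarrow> pos (par v) < pos v"
  "v \<in> nonroot \<Longrightarrow> adj G u v \<Longrightarrow> u \<noteq> par v \<Longrightarrow> pos (par v) < pos u"
  "v \<in> nonroot \<Longrightarrow> par v \<in> verts G"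
  using par_adj[of v] par_less[of v] par_first[of v u] adjD(2)[of "par v" v] by (auto simp: nonroot_def)

lemma root_least:
  assumes "v \<in> nonroot"
  shows "pos root < pos v"
  using assms
proof (induction "pos v" arbitrary: v rule: less_induct)
  case less
  show ?case
  proof (cases "par v = root")
    case False
    then have "par v \<in> nonroot" using par(4)[OF less(2)] by (simp add: nonroot_def)
    then show ?thesis using less(1)[OF par(2)[OF less(2)]] par(2)[OF less(2)] by simp
  qed (use par(2)[OF less(2)] in simp)
qed

text \<open>The chain of parents from \<open>v\<close> only visits positions up to that of
  \<open>v\<close>, so it never meets the later vertex \<open>x\<close>. These chains supply the
  cycles for \<open>adj_less\<close>.\<close>

lemma reach_root_avoiding:
  assumes "v \<in> verts G" "pos v < pos x"
  shows "(adj (del_vertex G x))\<^sup>*\<^sup>* v root"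
  using assms
proof (induction "pos v" arbitrary: v rule: less_induct)
  case less
  show ?case
  proof (cases "v = root")
    case False
    then have v: "v \<in> nonroot" using less by (simp add: nonroot_def)
    have "adj (del_vertex G x) v (par v)"
      using par(1,2)[OF v] less(3) by (auto simp: adj_del_vertex adj_commute)
    moreover have "(adj (del_vertex G x))\<^sup>*\<^sup>* (par v) root"
      using less(1)[OF par(2)[OF v] par(4)[OF v]] par(2)[OF v] less(3) by simp
    ultimately show ?thesis by (rule converse_rtranclp_into_rtranclp)
  qed simp
qed

lemma reachable_del_vertex_iff:
  "reachable (del_vertex G x) u w \<longleftrightarrow> u \<in> verts G \<and> u \<noteq> x \<and> (adj (del_vertex G x))\<^sup>*\<^sup>* u w"
  using reachable_iff[OF simple_graph_del_vertex[OF simple]] by auto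

text \<open>Suppose \<open>u\<close> is not the parent of \<open>v\<close>. Then
  \<open>par v\<close> precedes \<open>u\<close>, and both reach the root without \<open>v\<close>,
  so they are adjacent by the cycle through \<open>v\<close>. If \<open>par u\<close> were not
  \<open>par v\<close>, it would precede it, and the cycle through \<open>u\<close> would make
  \<open>par u\<close> a neighbor of \<open>v\<close> earlier than \<open>par v\<close>.\<close>

lemma adj_less:
  assumes "adj G u v" "pos u < pos v"
  shows "v \<in> nonroot \<and> (u = par v \<or> u \<in> nonroot \<and> par u = par v)"
proof -
  note uv = adjD[OF assms(1)]
  have v: "v \<in> nonroot"
  proof (rule ccontr)
    assume "v \<notin> nonroot"
    then have "v = root" using uv by (simp add: nonroot_def)
    then have "u \<in> nonroot" using uv by (simp add: nonroot_def)
    then show False using root_least[of u] assms(2) \<open>v = root\<close> by simp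
  qed
  moreover have "u \<in> nonroot \<and> par u = par v" if ne: "u \<noteq> par v"
  proof -
    have lt: "pos (par v) < pos u" using par(3)[OF v assms(1) ne] .
    have "u \<noteq> root" using lt root_least[of "par v"] par(4)[OF v] by (cases "par v = root") (auto simp: nonroot_def)
    then have u: "u \<in> nonroot" using uv by (simp add: nonroot_def)
    have "(adj (del_vertex G v))\<^sup>*\<^sup>* (par v) u"
      using reach_root_avoiding[OF par(4)[OF v] par(2)[OF v]]
        adj_rtranclp_sym[OF reach_root_avoiding[OF uv(2) assms(2)]] by (rule rtranclp_trans)
    then have "reachable (del_vertex G v) (par v) u"
      using par(2,4)[OF v] by (auto simp: reachable_del_vertex_iff)
    then have pu: "adj G (par v) u"
      using cycle_adj[OF block_graph, of v "par v" u] par(1)[OF v] assms(1) ne by (auto simp: adj_commute)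
    have "par u = par v"
    proof (rule ccontr)
      assume ne': "par u \<noteq> par v"
      then have lt': "pos (par u) < pos (par v)" using par(3)[OF u pu] by metis
      have "(adj (del_vertex G u))\<^sup>*\<^sup>* (par u) (par v)"
        using reach_root_avoiding[OF par(4)[OF u] par(2)[OF u]]
          adj_rtranclp_sym[OF reach_root_avoiding[OF par(4)[OF v] lt]] by (rule rtranclp_trans)
      moreover have "adj (del_vertex G u) (par v) v"
        using par(1)[OF v] ne uv by (auto simp: adj_del_vertex)
      ultimately have "(adj (del_vertex G u))\<^sup>*\<^sup>* (par u) v" by (rule rtranclp.rtrancl_into_rtrancl)
      then have "reachable (del_vertex G u) (par u) v"
        using par(2,4)[OF u] by (auto simp: reachable_del_vertex_iff)
      moreover have "par u \<noteq> v" using lt' par(2)[OF v] by auto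
      ultimately have "adj G (par u) v"
        using cycle_adj[OF block_graph, of u "par u" v] par(1)[OF u] assms(1) by (auto simp: adj_commute)
      then show False using par(3)[OF v _ ne'] lt' by simp
    qed
    then show ?thesis using u by simp
  qed
  ultimately show ?thesis by blast
qed

lemma adj_cases:
  assumes "adj G u v"
  obtains "v \<in> nonroot" "u = par v" | "u \<in> nonroot" "v = par u"
    | "u \<in> nonroot" "v \<in> nonroot" "par u = par v"
proof -
  have "pos u \<noteq> pos v" using adjD[OF assms] pos_inj unfolding inj_on_def by blast
  then consider "pos u < pos v" | "pos v < pos u" by linarith
  then show ?thesis
    using adj_less[OF assms] adj_less[of v u] assms that adj_commute[of G u v] by cases auto
qed

section \<open>Blocks as sibling classes together with their parent\<close>

definition siblings :: "'a \<Rightarrow> 'a set" where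
  "siblings v = {c \<in> nonroot. par c = par v \<and> (c = v \<or> adj G c v)}"

text \<open>The vertex set of the block that contains the edge between \<open>v\<close> and its
  parent.\<close>

definition branch :: "'a \<Rightarrow> 'a set" where
  "branch v = insert (par v) (siblings v)"

text \<open>Both are common neighbors of the edge from \<open>par v\<close> to \<open>v\<close>, so
  \<open>diamond_adj\<close> applies.\<close>

lemma siblings_adj:
  assumes "v \<in> nonroot" "a \<in> siblings v" "b \<in> siblings v" "a \<noteq> b"
  shows "adj G a b"
proof (cases "a = v \<or> b = v")
  case False
  have "adj G a (par v)" "adj G b (par v)"
    using par(1)[of a] par(1)[of b] assms by (auto simp: siblings_def adj_commute)
  then show ?thesis
    using diamond_adj[OF block_graph par(1)[OF assms(1)], of a b] False assms by (auto simp: siblings_def)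
qed (use assms in \<open>auto simp: siblings_def adj_commute\<close>)

lemma siblings_eq:
  assumes "v \<in> nonroot" "a \<in> siblings v"
  shows "siblings a = siblings v"
proof (intro equalityI subsetI)
  have a: "a \<in> nonroot" "par a = par v" "v \<in> siblings a"
    using assms by (auto simp: siblings_def adj_commute)
  fix x
  show "x \<in> siblings v" if x: "x \<in> siblings a"
    using siblings_adj[OF a(1) x a(3)] x a by (auto simp: siblings_def)
  show "x \<in> siblings a" if x: "x \<in> siblings v"
    using siblings_adj[OF assms(1) x assms(2)] x a by (auto simp: siblings_def)
qed

lemma self_sibling: "v \<in> nonroot \<Longrightarrow> v \<in> siblings v"
  by (simp add: siblings_def)

lemma siblingsD: "c \<in> siblings v \<Longrightarrow> c \<in> nonroot" "c \<in> siblings v \<Longrightarrow> par c = par v"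
  by (auto simp: siblings_def)

lemma pos_branch:
  assumes "v \<in> nonroot" "x \<in> siblings v"
  shows "pos (par v) < pos x"
  using par(2)[OF siblingsD(1)[OF assms(2)]] siblingsD(2)[OF assms(2)] by simp

lemma par_notin_siblings: "v \<in> nonroot \<Longrightarrow> par v \<notin> siblings v"
  using pos_branch by blast

lemma branch_subset: "v \<in> nonroot \<Longrightarrow> branch v \<subseteq> verts G"
  using par(4) by (auto simp: branch_def siblings_def nonroot_def)

lemma branch_adj:
  assumes "v \<in> nonroot" "x \<in> branch v" "y \<in> branch v" "x \<noteq> y"
  shows "adj G x y"
proof -
  have "adj G (par v) c" if "c \<in> siblings v" for c
    using par(1)[of c] siblingsD[OF that] by simp
  then show ?thesis
    using assms siblings_adj[OF assms(1)] unfolding branch_def by (auto simp: adj_commute)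
qed

text \<open>A child of \<open>v\<close> cannot be adjacent to \<open>par v\<close>, since its
  earliest neighbor is \<open>v\<close>. Of the possible positions of \<open>s\<close> relative to
  \<open>v\<close>, only a sibling remains.\<close>

lemma branch_maximal:
  assumes v: "v \<in> nonroot" and s: "adj G s (par v)" "adj G s v"
  shows "s \<in> siblings v"
  using s(2)
proof (cases rule: adj_cases)
  case 1
  then show ?thesis using s(1) adjD by blast
next
  case 2
  have "par v \<noteq> par s" using 2 par(2)[OF v] by auto
  then have "pos (par s) < pos (par v)" using par(3)[OF 2(1), of "par v"] s(1) adj_commute by metis
  then show ?thesis using 2 par(2)[OF v] by simp
next
  case 3
  then show ?thesis using s(2) by (simp add: siblings_def)
qed

lemma block_branch:
  assumes v: "v \<in> nonroot"
  shows "block G (induced G (branch v))"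
proof (rule block_inducedI[OF block_graph branch_subset[OF v]])
  show "branch v \<noteq> {}" by (simp add: branch_def)
  fix s assume s: "s \<in> verts G" "\<forall>x\<in>branch v. x = s \<or> adj G s x"
  have "v \<in> branch v" "par v \<in> branch v" using self_sibling[OF v] by (auto simp: branch_def)
  then show "s \<in> branch v" using s branch_maximal[OF v] by (auto simp: branch_def)
qed (use branch_adj[OF v] in blast)

lemma adj_branch:
  assumes "adj G u v"
  obtains w where "w \<in> nonroot" "u \<in> branch w" "v \<in> branch w"
  using assms
proof (cases rule: adj_cases)
  case 1
  then show ?thesis using that[of v] self_sibling by (simp add: branch_def)
next
  case 2
  then show ?thesis using that[of u] self_sibling by (simp add: branch_def)
next
  case 3
  then show ?thesis using that[of v] self_sibling[of v] assms by (auto simp: branch_def siblings_def)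
qed

lemma ex_root_child:
  assumes "nonroot \<noteq> {}"
  obtains c where "c \<in> nonroot" "par c = root"
proof -
  obtain c where c: "c \<in> nonroot" "\<And>d. d \<in> nonroot \<Longrightarrow> pos c \<le> pos d"
    using assms ex_has_least_nat[of "\<lambda>x. x \<in> nonroot" _ pos] by blast
  have "par c = root"
  proof (rule ccontr)
    assume "par c \<noteq> root"
    then have "par c \<in> nonroot" using par(4)[OF c(1)] by (simp add: nonroot_def)
    then show False using c(2)[of "par c"] par(2)[OF c(1)] by simp
  qed
  then show ?thesis using that c by blast
qed

text \<open>With a non-root vertex present, every vertex has a neighbor, so a block contains an
  edge. That edge lies in some branch, which is the only block through it.\<close>

lemma block_is_branch:
  assumes ne: "nonroot \<noteq> {}" and B: "block G B"
  obtains v where "v \<in> nonroot" "B = induced G (branch v)"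
proof -
  obtain x where x: "x \<in> verts B" using block_verts(2)[OF B] by blast
  have "\<exists>s. adj G s x"
  proof (cases "x = root")
    case True
    then show ?thesis using ex_root_child[OF ne] par(1) adj_commute by metis
  next
    case False
    then have "x \<in> nonroot" using x block_verts(1)[OF B] by (auto simp: nonroot_def)
    then show ?thesis using par(1) by blast
  qed
  then obtain s where s: "adj G s x" by blast
  have "\<exists>y\<in>verts B. y \<noteq> x"
  proof (rule ccontr)
    assume "\<not> ?thesis"
    then have "s \<in> verts B" using block_maximal[OF block_graph B, of s] s by metis
    then show False using \<open>\<not> (\<exists>y\<in>verts B. y \<noteq> x)\<close> adjD(1)[OF s] by blast
  qed
  then obtain y where y: "y \<in> verts B" "y \<noteq> x" by blast
  then have B': "adj B x y" using x block_edge_iff[OF block_graph B] by blast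
  have xy: "adj G x y" using block_adj[OF block_graph B x y(1)] y(2) by blast
  obtain w where w: "w \<in> nonroot" "x \<in> branch w" "y \<in> branch w" using adj_branch[OF xy] .
  have "B = induced G (branch w)"
    using block_unique_adj[OF block_graph B block_branch[OF w(1)] B'] w xy by simp
  then show ?thesis using that w by blast
qed

text \<open>Makes a color attached to a sibling class well defined as a color of the block.\<close>

lemma branch_eq_imp_sibling:
  assumes v: "v \<in> nonroot" and w: "w \<in> nonroot" and eq: "branch v = branch w"
  shows "w \<in> siblings v"
proof -
  have "w \<in> branch v" "v \<in> branch w" using self_sibling[OF v] self_sibling[OF w] eq by (auto simp: branch_def)
  moreover have "w \<noteq> par v"
  proof
    assume "w = par v"
    then have "v \<noteq> par w" "par v \<noteq> par w" using par(2)[OF v] par(2)[OF w] by auto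
    then show False using \<open>v \<in> branch w\<close> siblingsD by (auto simp: branch_def)
  qed
  ultimately show ?thesis by (auto simp: branch_def)
qed

definition inner :: "'a \<Rightarrow> bool" where
  "inner v \<longleftrightarrow> (\<exists>c\<in>nonroot. par c = v)"

text \<open>The parent and a child of \<open>v\<close> are not adjacent, as the child's earliest
  neighbor is \<open>v\<close>. A childless \<open>v\<close> has all its neighbors in the clique
  \<open>branch v\<close>.\<close>

lemma cut_vertex_iff:
  assumes v: "v \<in> nonroot"
  shows "cut_vertex G v \<longleftrightarrow> inner v"
proof
  assume "inner v"
  then obtain c where c: "c \<in> nonroot" "par c = v" by (auto simp: inner_def)
  have "adj G v (par v)" "adj G v c" using par(1)[OF v] par(1)[OF c(1)] c(2) by (auto simp: adj_commute)
  moreover have "par v \<noteq> c" using par(2)[OF v] par(2)[OF c(1)] c(2) by auto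
  moreover have "\<not> adj G (par v) c"
  proof
    assume "adj G (par v) c"
    moreover have "par v \<noteq> par c" using c(2) par(2)[OF v] by auto
    ultimately have "pos (par c) < pos (par v)" using par(3)[OF c(1)] by blast
    then show False using c par(2)[OF v] by simp
  qed
  ultimately show "cut_vertex G v" using cut_vertexI[OF block_graph] by blast
next
  assume "cut_vertex G v"
  then obtain a b where ab: "adj G v a" "adj G v b" "a \<noteq> b" "\<not> adj G a b"
    using cut_vertexE[OF block_graph] by blast
  show "inner v"
  proof (rule ccontr)
    assume ni: "\<not> inner v"
    have "x \<in> branch v" if x: "adj G v x" for x
      using x
    proof (cases rule: adj_cases)
      case 3
      then show ?thesis using x by (auto simp: branch_def siblings_def adj_commute)
    qed (use ni in \<open>auto simp: inner_def branch_def\<close>)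
    then show False using branch_adj[OF v] ab by blast
  qed
qed

section \<open>Sides of a block in terms of the search tree\<close>

definition below :: "'a \<Rightarrow> 'a \<Rightarrow> bool" where
  "below = (\<lambda>x y. x \<in> nonroot \<and> y = par x)\<^sup>*\<^sup>*"

lemma below_refl: "below x x"
  and below_trans: "below x y \<Longrightarrow> below y z \<Longrightarrow> below x z"
  and below_par: "x \<in> nonroot \<Longrightarrow> below x (par x)"
  unfolding below_def by auto

lemma below_pos: "below x y \<Longrightarrow> pos y \<le> pos x"
  unfolding below_def
proof (induction rule: rtranclp_induct)
  case (step y z)
  then show ?case using par(2)[of y] by simp
qed simp

lemma below_root: "x \<in> verts G \<Longrightarrow> below x root"
proof (induction "pos x" arbitrary: x rule: less_induct)
  case less
  show ?case
  proof (cases "x = root")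
    case False
    then have "x \<in> nonroot" using less by (simp add: nonroot_def)
    then show ?thesis using less(1)[of "par x"] par(2,4) below_par below_trans by blast
  qed (simp add: below_refl)
qed

text \<open>Both ends could lie in \<open>branch v\<close> only with \<open>x = par v\<close> and
  \<open>par x\<close> a sibling of \<open>v\<close>, but then \<open>par x\<close> would come after
  \<open>x\<close>.\<close>

lemma branch_par_step:
  assumes v: "v \<in> nonroot" and x: "x \<in> nonroot" and ne: "par x \<noteq> par v"
  shows "adj (del_edges G (edges (induced G (branch v)))) x (par x)"
proof -
  have "x \<notin> branch v \<or> par x \<notin> branch v"
  proof (rule ccontr)
    assume "\<not> ?thesis"
    then have "x \<in> branch v" "par x \<in> siblings v" using ne by (auto simp: branch_def)
    then have "x = par v" using ne siblingsD by (auto simp: branch_def)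
    then show False using pos_branch[OF v \<open>par x \<in> siblings v\<close>] par(2)[OF x] by simp
  qed
  then show ?thesis using par(1)[OF x] by (auto simp: adj_del_edges edges_induced adj_commute)
qed

text \<open>Climbing from \<open>x\<close> to \<open>b\<close> passes only parents that come no
  earlier than \<open>b\<close>, hence never \<open>par v\<close>, so no edge of the block is
  used.\<close>

lemma below_comp:
  assumes v: "v \<in> nonroot" and b: "b \<in> siblings v" and x: "below x b"
  shows "x \<in> component G (induced G (branch v)) b"
proof -
  let ?H = "del_edges G (edges (induced G (branch v)))"
  have "(adj ?H)\<^sup>*\<^sup>* x b" using x unfolding below_def
  proof (induction rule: converse_rtranclp_induct)
    case (step y z)
    have "pos b \<le> pos z" using below_pos step(2) unfolding below_def by blast
    then have "par y \<noteq> par v" using pos_branch[OF v b] step(1) by auto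
    then have "adj ?H y z" using branch_par_step[OF v] step(1) by blast
    then show ?case using step(3) by (rule converse_rtranclp_into_rtranclp)
  qed simp
  then show ?thesis
    using comp_iff[OF block_graph block_branch[OF v], of b x] b adj_rtranclp_sym[of ?H x b]
    by (simp add: branch_def)
qed

lemma branch_below:
  assumes "w \<in> nonroot" "below (par w) b" "x \<in> branch w"
  shows "below x b"
  using assms siblingsD[of x w] below_par[of x] below_trans[of x "par x" b] by (auto simp: branch_def)

text \<open>Climbing from \<open>par v\<close> to the root, and then descending to a child of the
  root, uses only tree edges whose upper end is not \<open>par v\<close>. So the root's block is
  available on the side of the parent of every block not at the root.\<close>

lemma root_comp:
  assumes v: "v \<in> nonroot" and ne: "par v \<noteq> root" and c: "c \<in> nonroot" "par c = root"
    and x: "x \<in> branch c"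
  shows "x \<in> component G (induced G (branch v)) (par v)"
proof -
  let ?H = "del_edges G (edges (induced G (branch v)))"
  have "(adj ?H)\<^sup>*\<^sup>* (par v) y" if "below (par v) y" for y
    using that unfolding below_def
  proof (induction rule: rtranclp_induct)
    case (step y z)
    have "pos y \<le> pos (par v)" using below_pos step(1) unfolding below_def by blast
    then have "par y \<noteq> par v" using step(2) par(2)[of y] by auto
    then have "adj ?H y z" using branch_par_step[OF v] step(2) by blast
    then show ?case using step(3) by (rule rtranclp.rtrancl_into_rtrancl[rotated])
  qed simp
  then have "(adj ?H)\<^sup>*\<^sup>* (par v) root" using below_root par(4)[OF v] by blast
  moreover have "(adj ?H)\<^sup>*\<^sup>* root x"
  proof (cases "x = root")
    case False
    then have "x \<in> nonroot" "par x = root" using x c siblingsD by (auto simp: branch_def)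
    then have "adj ?H root x" using branch_par_step[OF v, of x] ne by (simp add: adj_commute)
    then show ?thesis by blast
  qed simp
  ultimately have "(adj ?H)\<^sup>*\<^sup>* (par v) x" by (rule rtranclp_trans)
  then show ?thesis using comp_iff[OF block_graph block_branch[OF v], of "par v" x] by (simp add: branch_def)
qed

end

definition nbhd :: "'a ugraph \<Rightarrow> 'a \<Rightarrow> 'a set" where
  "nbhd G x = {y. y = x \<or> adj G x y}"

text \<open>All neighbors of \<open>z\<close> lie in one block, which has at most one cut vertex.\<close>

definition leaf_vertex :: "'a ugraph \<Rightarrow> 'a \<Rightarrow> bool" where
  "leaf_vertex G z \<longleftrightarrow> (\<exists>p. \<forall>x\<in>nbhd G z - {p}. nbhd G x = nbhd G z)"

text \<open>Childless siblings all have the closed neighborhood \<open>branch z\<close>; the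
  exceptional vertex is \<open>par z\<close>.\<close>

lemma (in search_order) childless_leaf_vertex:
  assumes z: "z \<in> nonroot" and cl: "\<And>c. c \<in> siblings z \<Longrightarrow> \<not> inner c"
  shows "leaf_vertex G z"
proof -
  have N: "nbhd G x = branch z" if x: "x \<in> siblings z" for x
  proof (intro equalityI subsetI)
    note x' = siblingsD[OF x] siblings_eq[OF z x]
    fix y
    show "y \<in> nbhd G x" if "y \<in> branch z"
      using branch_adj[OF z _ that, of x] x by (auto simp: nbhd_def branch_def)
    assume "y \<in> nbhd G x"
    then consider "y = x" | "adj G x y" by (auto simp: nbhd_def)
    then show "y \<in> branch z"
    proof cases
      case 2
      then show ?thesis
      proof (cases rule: adj_cases)
        case 3
        then have "y \<in> siblings x" using 2 by (auto simp: siblings_def adj_commute)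
        then show ?thesis using x' by (simp add: branch_def)
      qed (use cl[OF x] x' in \<open>auto simp: inner_def branch_def\<close>)
    qed (use x in \<open>simp add: branch_def\<close>)
  qed
  have "nbhd G x = nbhd G z" if "x \<in> nbhd G z - {par z}" for x
    using that N[OF self_sibling[OF z]] N[of x] by (auto simp: branch_def)
  then show ?thesis unfolding leaf_vertex_def by blast
qed

section \<open>Coloring from a leaf vertex\<close>

locale leaf_search_order = search_order +
  assumes leaf: "leaf_vertex G root"
begin

text \<open>Of two non-adjacent neighbors, at least one is not exceptional. It has the closed
  neighborhood of the root and so contains the other one.\<close>

lemma root_not_cut: "\<not> cut_vertex G root"
proof
  assume "cut_vertex G root"
  then obtain a b where ab: "adj G root a" "adj G root b" "a \<noteq> b" "\<not> adj G a b"
    using cut_vertexE[OF block_graph] by blast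
  obtain p where p: "\<forall>x\<in>nbhd G root - {p}. nbhd G x = nbhd G root"
    using leaf unfolding leaf_vertex_def by blast
  have N: "a \<in> nbhd G root" "b \<in> nbhd G root" using ab by (simp_all add: nbhd_def)
  then have "nbhd G a = nbhd G root \<or> nbhd G b = nbhd G root" using p ab(3) by blast
  then have "a \<in> nbhd G b \<or> b \<in> nbhd G a" using N by blast
  then show False using ab(3,4) adj_commute[of G a b] by (auto simp: nbhd_def)
qed

text \<open>The cut vertices of the block \<open>branch v\<close> other than its top vertex
  \<open>par v\<close>.\<close>

definition inner_siblings :: "'a \<Rightarrow> 'a set" where
  "inner_siblings v = {c \<in> siblings v. inner c}"

lemma finite_siblings: "finite (siblings v)"
  using simple by (rule_tac finite_subset[of _ "verts G"]) (auto simp: siblings_def nonroot_def simple_graph_def)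

lemma finite_inner_siblings: "finite (inner_siblings v)"
  using finite_siblings by (simp add: inner_siblings_def)

text \<open>A child \<open>d\<close> of a non-exceptional sibling would be adjacent to the root,
  which comes before the parent of \<open>d\<close>. Hence only the exceptional vertex can have
  children.\<close>

lemma root_child_inner:
  assumes "c \<in> nonroot" "par c = root"
  shows "card (inner_siblings c) < 2"
proof -
  obtain p where p: "\<forall>x\<in>nbhd G root - {p}. nbhd G x = nbhd G root"
    using leaf unfolding leaf_vertex_def by blast
  have "x = p" if "x \<in> inner_siblings c" for x
  proof (rule ccontr)
    assume "x \<noteq> p"
    have x: "x \<in> nonroot" "par x = root" "inner x"
      using that assms siblingsD[of x c] by (auto simp: inner_siblings_def)
    then obtain d where d: "d \<in> nonroot" "par d = x" by (auto simp: inner_def)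
    have "x \<in> nbhd G root" using par(1)[OF x(1)] x(2) by (simp add: nbhd_def)
    then have "nbhd G x = nbhd G root" using p \<open>x \<noteq> p\<close> by blast
    moreover have "d \<in> nbhd G x" using par(1)[OF d(1)] d(2) by (simp add: nbhd_def)
    ultimately have "d \<in> nbhd G root" by blast
    then have "adj G root d" using nonrootD[OF d(1)] by (auto simp: nbhd_def)
    then have "pos x < pos root" using par(3)[OF d(1), of root] d(2) nonrootD[OF x(1)] by auto
    then show False using root_least[OF x(1)] by simp
  qed
  then have "inner_siblings c \<subseteq> {p}" by blast
  then show ?thesis using card_mono[of "{p}" "inner_siblings c"] by simp
qed

lemma cut_vertices_in_branch:
  assumes v: "v \<in> nonroot"
  shows "cut_vertices_in G (induced G (branch v)) =
    (if par v = root then inner_siblings v else insert (par v) (inner_siblings v))"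
proof -
  have "cut_vertex G (par v)" if "par v \<noteq> root"
  proof -
    have "par v \<in> nonroot" using par(4)[OF v] that by (simp add: nonroot_def)
    then show ?thesis using cut_vertex_iff v by (auto simp: inner_def)
  qed
  moreover have "cut_vertex G x \<longleftrightarrow> inner x" if "x \<in> siblings v" for x
    using cut_vertex_iff siblingsD(1)[OF that] by blast
  ultimately show ?thesis
    using root_not_cut unfolding cut_vertices_in_def inner_siblings_def branch_def by auto
qed

text \<open>The bound drops from 3 to 2 because the parent is a cut vertex as well. If the parent is
  the root, it is not, but then both sides hold by \<open>root_child_inner\<close>.\<close>

lemma small_branch_iff:
  assumes v: "v \<in> nonroot"
  shows "induced G (branch v) \<in> small_blocks G \<longleftrightarrow> card (inner_siblings v) < 2"
proof -
  have "par v \<notin> inner_siblings v" using par_notin_siblings[OF v] by (simp add: inner_siblings_def)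
  then have "card (cut_vertices_in G (induced G (branch v))) =
      (if par v = root then card (inner_siblings v) else Suc (card (inner_siblings v)))"
    using finite_inner_siblings[of v] by (simp add: cut_vertices_in_branch[OF v])
  then show ?thesis using block_branch[OF v] root_child_inner[OF v] by (auto simp: small_blocks_def)
qed

end

text \<open>What the computed tables must satisfy, separated from how they are computed.
  \<open>rep\<close> picks one member of each sibling class, and its number serves as the color of
  the block; \<open>dn v\<close> is the color of a small block below \<open>v\<close>;
  \<open>c0\<close> gives access to the block at the root.\<close>

locale coloring_tables = leaf_search_order G root par pos
  for G :: "nat ugraph" and root :: nat and par :: "nat \<Rightarrow> nat" and pos :: "nat \<Rightarrow> nat" +
  fixes rep b2 b3 dn :: "nat \<Rightarrow> nat" and c0 :: nat
  assumes rep_sibling: "v \<in> nonroot \<Longrightarrow> rep v \<in> siblings v"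
    and rep_eq: "v \<in> nonroot \<Longrightarrow> w \<in> siblings v \<Longrightarrow> rep w = rep v"
    and inner_pair: "v \<in> nonroot \<Longrightarrow> \<not> card (inner_siblings v) < 2 \<Longrightarrow>
      b2 (rep v) \<in> inner_siblings v \<and> b3 (rep v) \<in> inner_siblings v \<and> b2 (rep v) \<noteq> b3 (rep v)"
    and dn: "v \<in> nonroot \<Longrightarrow> inner v \<Longrightarrow>
      \<exists>w\<in>nonroot. below (par w) v \<and> card (inner_siblings w) < 2 \<and> dn v = rep w"
    and root_child: "c0 \<in> nonroot" "par c0 = root"
begin

text \<open>In a large block the parent plays the role of \<open>b1\<close>: the edge to
  \<open>b2\<close> takes the color found below \<open>b3\<close>, and the other edges at the parent
  take the color found below \<open>b2\<close>.\<close>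

definition parent_color :: "nat \<Rightarrow> nat" where
  "parent_color v = (if card (inner_siblings v) < 2 then rep v
     else if v = b2 (rep v) then dn (b3 (rep v)) else dn (b2 (rep v)))"

definition sibling_color :: "nat \<Rightarrow> nat" where
  "sibling_color v = (if card (inner_siblings v) < 2 then rep v else rep c0)"

definition block_color :: "nat ugraph \<Rightarrow> nat" where
  "block_color B = rep (SOME v. v \<in> nonroot \<and> B = induced G (branch v))"

lemma inner_siblings_eq: "v \<in> nonroot \<Longrightarrow> w \<in> siblings v \<Longrightarrow> inner_siblings w = inner_siblings v"
  by (simp add: inner_siblings_def siblings_eq)

lemma block_color_branch:
  assumes v: "v \<in> nonroot"
  shows "block_color (induced G (branch v)) = rep v"
proof -
  let ?w = "SOME w. w \<in> nonroot \<and> induced G (branch v) = induced G (branch w)"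
  have "?w \<in> nonroot \<and> induced G (branch v) = induced G (branch ?w)" using v by (rule_tac someI) auto
  then have "?w \<in> nonroot" "branch v = branch ?w" by (auto dest: arg_cong[of _ _ verts])
  then show ?thesis using rep_eq[OF v branch_eq_imp_sibling[OF v]] by (simp add: block_color_def)
qed

lemma tables_algA_output:
  assumes parent: "\<And>v. v \<in> nonroot \<Longrightarrow> col {par v, v} = Some (parent_color v)"
    and sibling: "\<And>v w. v \<in> nonroot \<Longrightarrow> w \<in> siblings v \<Longrightarrow> w \<noteq> v \<Longrightarrow> col {w, v} = Some (sibling_color v)"
    and dom: "dom col = edges G"
  shows "algA_output G col"
proof (rule block_wise_algA_output[OF block_graph, of block_color])
  have ne: "nonroot \<noteq> {}" using root_child by blast
  note is_branch = block_is_branch[OF ne]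
  \<comment> \<open>Each representative belongs to its class, so equal colors give equal classes and
    equal blocks.\<close>
  have inj: "B = B'" if B: "B \<in> small_blocks G" "B' \<in> small_blocks G" "block_color B = block_color B'" for B B'
  proof -
    obtain v where v: "v \<in> nonroot" "B = induced G (branch v)"
      using is_branch[of B] B(1) by (auto simp: small_blocks_def)
    obtain w where w: "w \<in> nonroot" "B' = induced G (branch w)"
      using is_branch[of B'] B(2) by (auto simp: small_blocks_def)
    have "rep v = rep w" using B(3) block_color_branch v w by simp
    then have "siblings v = siblings w" "par v = par w"
      using rep_sibling[OF v(1)] rep_sibling[OF w(1)] siblings_eq[OF v(1)] siblings_eq[OF w(1)] siblingsD
      by metis+
    then show ?thesis using v w by (simp add: branch_def)
  qed
  have edge: "(\<exists>x\<in>siblings v. e = {par v, x} \<and> col e = Some (parent_color x)) \<or>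
      (\<exists>x\<in>siblings v. \<exists>y\<in>siblings v. e = {x, y} \<and> col e = Some (sibling_color v))"
    if v: "v \<in> nonroot" and e: "e \<in> edges (induced G (branch v))" for v e
  proof -
    have eG: "e \<in> edges G" "e \<subseteq> branch v" using e by (auto simp: edges_induced)
    obtain x y where "e = {x, y}" "x \<noteq> y" using simple_graph_edgeE[OF simple eG(1)] .
    with eG have xy: "e = {x, y}" "x \<noteq> y" "x \<in> branch v" "y \<in> branch v" by auto
    have p: "(\<exists>x\<in>siblings v. e = {par v, x} \<and> col e = Some (parent_color x))"
      if "z \<in> siblings v" "e = {par v, z}" for z
      using parent[of z] siblingsD[OF that(1)] that by auto
    show ?thesis
    proof (cases "x = par v \<or> y = par v")
      case True
      then obtain z where "z \<in> siblings v" "e = {par v, z}"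
        using xy unfolding branch_def by (metis insertE insert_commute)
      then show ?thesis using p by blast
    next
      case False
      then have s: "x \<in> siblings v" "y \<in> siblings v" using xy by (auto simp: branch_def)
      then have "sibling_color y = sibling_color v"
        using rep_eq[OF v] inner_siblings_eq[OF v] by (simp add: sibling_color_def)
      then have "col e = Some (sibling_color v)"
        using sibling[of y x] s xy siblings_eq[OF v] siblingsD(1) by auto
      then show ?thesis using s xy by blast
    qed
  qed
  have small: "col e = Some (block_color B)" if B: "B \<in> small_blocks G" "e \<in> edges B" for B e
  proof -
    obtain v where v: "v \<in> nonroot" "B = induced G (branch v)"
      using is_branch[of B] B(1) by (auto simp: small_blocks_def)
    then have "card (inner_siblings v) < 2" using small_branch_iff B by simp
    moreover have "card (inner_siblings x) < 2" "rep x = rep v" if "x \<in> siblings v" for x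
      using inner_siblings_eq[OF v(1) that] rep_eq[OF v(1) that] calculation by auto
    ultimately show ?thesis
      using edge[OF v(1), of e] B(2) v block_color_branch[OF v(1)]
      by (auto simp: parent_color_def sibling_color_def)
  qed
  have large: "\<exists>g\<in>step3_colorings G block_color B. \<forall>e\<in>edges B. col e = g e"
    if B: "B \<in> large_blocks G" for B
  proof -
    obtain v where v: "v \<in> nonroot" "B = induced G (branch v)"
      using is_branch[of B] B by (auto simp: large_blocks_def)
    have big: "\<not> card (inner_siblings v) < 2"
      using small_branch_iff[OF v(1)] B v small_not_large by blast
    \<comment> \<open>A block at the root is small, so the parent of a large block is not the root.
      It is then a cut vertex and may serve as \<open>b1\<close>.\<close>
    then have pr: "par v \<noteq> root" using root_child_inner[OF v(1)] by blast
    define x2 x3 where "x2 = b2 (rep v)" and "x3 = b3 (rep v)"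
    have x: "x2 \<in> inner_siblings v" "x3 \<in> inner_siblings v" "x2 \<noteq> x3"
      using inner_pair[OF v(1) big] by (auto simp: x2_def x3_def)
    have cand: "\<exists>U\<in>candidates G B x. block_color U = dn x" if "x \<in> inner_siblings v" for x
    proof -
      have xs: "x \<in> siblings v" "inner x" using that by (auto simp: inner_siblings_def)
      obtain w where w: "w \<in> nonroot" "below (par w) x" "card (inner_siblings w) < 2" "dn x = rep w"
        using dn[OF siblingsD(1)[OF xs(1)] xs(2)] by blast
      have "branch w \<subseteq> component G B x"
        using below_comp[OF v(1) xs(1) branch_below[OF w(1,2)]] v(2) by blast
      then have "induced G (branch w) \<in> candidates G B x"
        using small_branch_iff[OF w(1)] w(3) by (simp add: candidates_def)
      then show ?thesis using block_color_branch[OF w(1)] w(4) by metis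
    qed
    obtain U2 where U2: "U2 \<in> candidates G B x2" "block_color U2 = dn x2" using cand x by blast
    obtain U3 where U3: "U3 \<in> candidates G B x3" "block_color U3 = dn x3" using cand x by blast
    let ?U1 = "induced G (branch c0)"
    have "branch c0 \<subseteq> component G B (par v)" using root_comp[OF v(1) pr root_child] v(2) by blast
    then have U1: "?U1 \<in> candidates G B (par v)" "block_color ?U1 = rep c0"
      using small_branch_iff[OF root_child(1)] root_child_inner[OF root_child] block_color_branch root_child
      by (auto simp: candidates_def)
    let ?g = "color_block B (par v) x2 (rep c0) (dn x2) (dn x3) Map.empty"
    have pv: "par v \<notin> siblings v" using par_notin_siblings[OF v(1)] .
    have cuts: "par v \<in> cut_vertices_in G B" "x2 \<in> cut_vertices_in G B" "x3 \<in> cut_vertices_in G B"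
      using cut_vertices_in_branch[OF v(1)] pr x v(2) by auto
    have "distinct [par v, x2, x3]" using x pv by (auto simp: inner_siblings_def)
    then have "?g \<in> step3_colorings G block_color B"
      using cuts U1 U2 U3 unfolding step3_colorings_def mem_Collect_eq by metis
    moreover have "col e = ?g e" if e: "e \<in> edges B" for e
      using edge[OF v(1) e[unfolded v(2)]]
    proof (elim disjE bexE conjE)
      fix y assume y: "y \<in> siblings v" "e = {par v, y}" "col e = Some (parent_color y)"
      have "rep y = rep v" "inner_siblings y = inner_siblings v"
        using rep_eq[OF v(1) y(1)] inner_siblings_eq[OF v(1) y(1)] by auto
      then have "parent_color y = (if y = x2 then dn x3 else dn x2)"
        using big unfolding parent_color_def x2_def x3_def by presburger
      moreover have "e = {par v, x2} \<longleftrightarrow> y = x2" using y by (auto simp: doubleton_eq_iff)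
      ultimately show ?thesis using y e by (auto simp: color_block_def)
    next
      fix y z assume y: "y \<in> siblings v" "z \<in> siblings v" "e = {y, z}" "col e = Some (sibling_color v)"
      then have "par v \<notin> e" using pv by auto
      then show ?thesis using y e big by (simp add: color_block_def sibling_color_def)
    qed
    ultimately show ?thesis by blast
  qed
  show "block_wise G block_color {} col"
    using inj small large dom edges_eq_Union_blocks[OF block_graph]
    unfolding block_wise_def inj_on_def by simp
qed

end

section \<open>Counted-loop programs and their compilation to the random access machine\<close>

datatype aexp = Num nat | Var nat | Arr nat aexp | Plus aexp aexp | Minus aexp aexp

datatype stm = Assign nat aexp | Update nat aexp aexp | Input nat | Output aexp
  | Seq stm stm | If aexp stm stm | Skip

datatype loop = For nat aexp stm

record store =
  reg :: "nat \<Rightarrow> nat"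
  arr :: "nat \<Rightarrow> nat \<Rightarrow> nat"
  tape :: "nat list"
  printed :: "nat list"

fun val :: "aexp \<Rightarrow> store \<Rightarrow> nat" where
  "val (Num k) s = k"
| "val (Var i) s = reg s i"
| "val (Arr k a) s = arr s k (val a s)"
| "val (Plus a b) s = val a s + val b s"
| "val (Minus a b) s = val a s - val b s"

definition set_reg :: "nat \<Rightarrow> nat \<Rightarrow> store \<Rightarrow> store" where
  "set_reg i v s = s\<lparr>reg := (reg s)(i := v)\<rparr>"

definition set_arr :: "nat \<Rightarrow> nat \<Rightarrow> nat \<Rightarrow> store \<Rightarrow> store" where
  "set_arr k v w s = s\<lparr>arr := (arr s)(k := (arr s k)(v := w))\<rparr>"

definition read_tape :: "nat \<Rightarrow> store \<Rightarrow> store" where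
  "read_tape i s =
     s\<lparr>reg := (reg s)(i := (case tape s of [] \<Rightarrow> 0 | x # _ \<Rightarrow> x)), tape := tl (tape s)\<rparr>"

definition emit :: "nat \<Rightarrow> store \<Rightarrow> store" where
  "emit v s = s\<lparr>printed := printed s @ [v]\<rparr>"

lemma store_access [simp]:
  "reg (set_reg i v s) = (reg s)(i := v)" "arr (set_reg i v s) = arr s"
  "tape (set_reg i v s) = tape s" "printed (set_reg i v s) = printed s"
  "reg (set_arr k u w s) = reg s" "arr (set_arr k u w s) = (arr s)(k := (arr s k)(u := w))"
  "tape (set_arr k u w s) = tape s" "printed (set_arr k u w s) = printed s"
  "reg (read_tape i s) = (reg s)(i := (case tape s of [] \<Rightarrow> 0 | x # _ \<Rightarrow> x))"
  "arr (read_tape i s) = arr s" "tape (read_tape i s) = tl (tape s)"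
  "printed (read_tape i s) = printed s"
  "reg (emit v s) = reg s" "arr (emit v s) = arr s" "tape (emit v s) = tape s"
  "printed (emit v s) = printed s @ [v]"
  by (simp_all add: set_reg_def set_arr_def read_tape_def emit_def)

fun exec :: "stm \<Rightarrow> store \<Rightarrow> store" where
  "exec (Assign i a) s = set_reg i (val a s) s"
| "exec (Update k a b) s = set_arr k (val a s) (val b s) s"
| "exec (Input i) s = read_tape i s"
| "exec (Output a) s = emit (val a s) s"
| "exec (Seq c d) s = exec d (exec c s)"
| "exec (If a c d) s = (if val a s > 0 then exec c s else exec d s)"
| "exec Skip s = s"

text \<open>The loop variable counts down to \<open>0\<close>.\<close>

fun exec_loop :: "loop \<Rightarrow> store \<Rightarrow> store" where
  "exec_loop (For i a c) s =
     fold (\<lambda>k s. exec c (set_reg i k s)) (rev [0..<val a s]) (set_reg i (val a s) s)"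

text \<open>\<open>I k\<close> holds when the iterations with counter values from
  \<open>val a s - 1\<close> down to \<open>k\<close> have been done.\<close>

lemma exec_loop_invariant:
  assumes "I (val a s) (set_reg i (val a s) s)"
    and "\<And>k s'. k < val a s \<Longrightarrow> I (Suc k) s' \<Longrightarrow> I k (exec c (set_reg i k s'))"
  shows "I 0 (exec_loop (For i a c) s)"
proof -
  have "I 0 (fold (\<lambda>k s. exec c (set_reg i k s)) (rev [0..<n]) s')"
    if "n \<le> val a s" "I n s'" for n s'
    using that
  proof (induction n arbitrary: s')
    case (Suc n)
    then show ?case using assms(2)[of n s'] by simp
  qed simp
  from this[OF order_refl assms(1)] show ?thesis by simp
qed

text \<open>The successor pays for evaluating the bound and for the final test, which occur even in
  an empty loop.\<close>

fun iterations :: "loop list \<Rightarrow> store \<Rightarrow> nat" where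
  "iterations [] s = 0"
| "iterations (For i a c # ls) s = Suc (val a s) + iterations ls (exec_loop (For i a c) s)"

text \<open>Variables live at the addresses below \<open>32\<close>, temporaries at the addresses below \<open>64\<close>, and
  entry \<open>v\<close> of array \<open>k\<close> at address \<open>64 * (v + 1) + k\<close>, which needs six doublings.\<close>

definition index_code :: "nat \<Rightarrow> nat \<Rightarrow> instr list" where
  "index_code d k = [Const (Suc d) 1, Add d d (Suc d)] @ replicate 6 (Add d d d) @
     [Const (Suc d) k, Add d d (Suc d)]"

text \<open>The value is left at address \<open>d\<close>, and higher temporaries are scratch space.
  The machine has no move instruction, so a variable is added to zero.\<close>

fun compile_exp :: "nat \<Rightarrow> aexp \<Rightarrow> instr list" where
  "compile_exp d (Num k) = [Const d k]"
| "compile_exp d (Var i) = [Const d 0, Add d d i]"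
| "compile_exp d (Arr k a) = compile_exp d a @ index_code d k @ [Load d d]"
| "compile_exp d (Plus a b) = compile_exp d a @ compile_exp (Suc d) b @ [Add d d (Suc d)]"
| "compile_exp d (Minus a b) = compile_exp d a @ compile_exp (Suc d) b @ [Sub d d (Suc d)]"

text \<open>Jump targets are absolute, hence the start address \<open>p\<close>. The else branch
  comes first because \<open>JumpPos\<close> jumps on a positive value; an unconditional jump tests
  a freshly loaded 1.\<close>

fun compile_stm :: "nat \<Rightarrow> stm \<Rightarrow> instr list" where
  "compile_stm p (Assign i a) = compile_exp 32 a @ [Const i 0, Add i i 32]"
| "compile_stm p (Update k a b) =
     compile_exp 32 a @ index_code 32 k @ compile_exp 33 b @ [Store 32 33]"
| "compile_stm p (Input i) = [Read i]"
| "compile_stm p (Output a) = compile_exp 32 a @ [Print 32]"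
| "compile_stm p (Seq c d) =
     (let x = compile_stm p c in x @ compile_stm (p + length x) d)"
| "compile_stm p (If a c d) =
     (let x = compile_exp 32 a;
          y = compile_stm (p + length x + 1) d;
          z = compile_stm (p + length x + length y + 3) c
      in x @ [JumpPos (p + length x + length y + 3) 32] @ y @
         [Const 32 1, JumpPos (p + length x + length y + length z + 3) 32] @ z)"
| "compile_stm p Skip = []"

text \<open>The test stands at the end and is entered by a jump, so an empty loop needs no special
  treatment. The two instructions before the body decrement the counter.\<close>

fun compile_loop :: "nat \<Rightarrow> loop \<Rightarrow> instr list" where
  "compile_loop p (For i a c) =
     (let x = compile_exp 32 a @ [Const i 0, Add i i 32];
          q = p + length x;
          y = compile_stm (q + 4) c
      in x @ [Const 32 1, JumpPos (q + 4 + length y) 32] @ [Const 32 1, Sub i i 32] @ y @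
         [JumpPos (q + 2) i])"

fun compile :: "nat \<Rightarrow> loop list \<Rightarrow> instr list" where
  "compile p [] = []"
| "compile p (l # ls) = (let x = compile_loop p l in x @ compile (p + length x) ls)"

fun wf_exp :: "nat \<Rightarrow> aexp \<Rightarrow> bool" where
  "wf_exp d (Num k) \<longleftrightarrow> d < 64"
| "wf_exp d (Var i) \<longleftrightarrow> d < 64 \<and> i < 32"
| "wf_exp d (Arr k a) \<longleftrightarrow> Suc d < 64 \<and> k < 64 \<and> wf_exp d a"
| "wf_exp d (Plus a b) \<longleftrightarrow> wf_exp d a \<and> wf_exp (Suc d) b"
| "wf_exp d (Minus a b) \<longleftrightarrow> wf_exp d a \<and> wf_exp (Suc d) b"

text \<open>The loop variable \<open>l\<close> may not be assigned in the body.\<close>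

fun wf_stm :: "nat \<Rightarrow> stm \<Rightarrow> bool" where
  "wf_stm l (Assign i a) \<longleftrightarrow> i < 32 \<and> i \<noteq> l \<and> wf_exp 32 a"
| "wf_stm l (Update k a b) \<longleftrightarrow> k < 64 \<and> wf_exp 32 a \<and> wf_exp 33 b"
| "wf_stm l (Input i) \<longleftrightarrow> i < 32 \<and> i \<noteq> l"
| "wf_stm l (Output a) \<longleftrightarrow> wf_exp 32 a"
| "wf_stm l (Seq c d) \<longleftrightarrow> wf_stm l c \<and> wf_stm l d"
| "wf_stm l (If a c d) \<longleftrightarrow> wf_exp 32 a \<and> wf_stm l c \<and> wf_stm l d"
| "wf_stm l Skip \<longleftrightarrow> True"

fun wf_loop :: "loop \<Rightarrow> bool" where
  "wf_loop (For i a c) \<longleftrightarrow> i < 32 \<and> wf_exp 32 a \<and> wf_stm i c"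

text \<open>Addresses 32 to 63 are left unspecified, so temporaries may be overwritten
  freely.\<close>

definition represents :: "(nat \<Rightarrow> nat) \<Rightarrow> store \<Rightarrow> bool" where
  "represents X s \<longleftrightarrow> (\<forall>i<32. X i = reg s i) \<and> (\<forall>k<64. \<forall>v. X (64 * (v + 1) + k) = arr s k v)"

lemma represents_frame:
  assumes "represents X s" "\<And>a. a < 32 \<or> 64 \<le> a \<Longrightarrow> X' a = X a"
  shows "represents X' s"
  unfolding represents_def
proof (intro conjI allI impI)
  fix j :: nat assume "j < 32"
  then show "X' j = reg s j" using assms(1) assms(2)[of j] by (simp add: represents_def)
next
  fix k u :: nat assume "k < 64"
  then show "X' (64 * (u + 1) + k) = arr s k u"
    using assms(1) assms(2)[of "64 * (u + 1) + k"] by (simp add: represents_def)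
qed

lemma represents_set_reg:
  assumes "represents X s" "i < 32" "X' i = v" "\<And>a. a \<noteq> i \<Longrightarrow> a < 32 \<or> 64 \<le> a \<Longrightarrow> X' a = X a"
  shows "represents X' (set_reg i v s)"
  unfolding represents_def
proof (intro conjI allI impI)
  fix j :: nat assume "j < 32"
  then show "X' j = reg (set_reg i v s) j"
    using assms(1,3) assms(4)[of j] by (auto simp: represents_def)
next
  fix k u :: nat assume "k < 64"
  then show "X' (64 * (u + 1) + k) = arr (set_reg i v s) k u"
    using assms(1,2) assms(4)[of "64 * (u + 1) + k"] by (simp add: represents_def)
qed

lemma address_inject:
  fixes k k' :: nat
  assumes "k < 64" "k' < 64" "64 * (v + 1) + k = 64 * (v' + 1) + k'"
  shows "k = k' \<and> v = v'"
proof -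
  have "(64 * (v + 1) + k) mod 64 = k mod 64" "(64 * (v' + 1) + k') mod 64 = k' mod 64"
    by (rule mod_mult_self4)+
  then have "k = k'" using assms by (simp only: mod_less)
  then show ?thesis using assms by simp
qed

lemma represents_update:
  assumes r: "represents X s" and k: "k < 64"
    and X': "X' (64 * (v + 1) + k) = w"
      "\<And>a. a \<noteq> 64 * (v + 1) + k \<Longrightarrow> a < 32 \<or> 64 \<le> a \<Longrightarrow> X' a = X a"
  shows "represents X' (set_arr k v w s)"
  unfolding represents_def
proof (intro conjI allI impI)
  fix i :: nat assume "i < 32"
  then show "X' i = reg (set_arr k v w s) i"
    using r X'(2)[of i] by (simp add: represents_def)
next
  fix k' u :: nat assume k': "k' < 64"
  have old: "X (64 * (u + 1) + k') = arr s k' u" using r k' by (simp add: represents_def)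
  show "X' (64 * (u + 1) + k') = arr (set_arr k v w s) k' u"
  proof (cases "k' = k \<and> u = v")
    case True
    then show ?thesis using X'(1) by simp
  next
    case False
    then have "64 * (u + 1) + k' \<noteq> 64 * (v + 1) + k" using address_inject[OF k' k] by blast
    then show ?thesis using X'(2)[of "64 * (u + 1) + k'"] old False by auto
  qed
qed

section \<open>Executing compiled code, with bounds on the number of steps\<close>

fun straight :: "instr \<Rightarrow> bool" where
  "straight (JumpPos l j) = False"
| "straight _ = True"

lemma exec_straight_pc: "straight x \<Longrightarrow> pc (exec_instr x c) = Suc (pc c)"
  by (cases x; cases c) auto

definition code_at :: "instr list \<Rightarrow> nat \<Rightarrow> instr list \<Rightarrow> bool" where
  "code_at P p xs \<longleftrightarrow> (\<forall>i<length xs. p + i < length P \<and> P ! (p + i) = xs ! i)"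

lemma code_at_append:
  "code_at P p (xs @ ys) \<longleftrightarrow> code_at P p xs \<and> code_at P (p + length xs) ys"
proof
  assume c: "code_at P p (xs @ ys)"
  have "p + length xs + i < length P \<and> P ! (p + length xs + i) = ys ! i" if "i < length ys" for i
    using c[unfolded code_at_def, rule_format, of "length xs + i"] that by (simp add: add.assoc)
  then show "code_at P p xs \<and> code_at P (p + length xs) ys"
    using c unfolding code_at_def by (auto simp: nth_append)
next
  assume c: "code_at P p xs \<and> code_at P (p + length xs) ys"
  show "code_at P p (xs @ ys)" unfolding code_at_def
  proof (intro allI impI)
    fix i assume i: "i < length (xs @ ys)"
    show "p + i < length P \<and> P ! (p + i) = (xs @ ys) ! i"
    proof (cases "i < length xs")
      case False
      then obtain j where "i = length xs + j" by (metis le_iff_add not_less)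
      then show ?thesis using c i unfolding code_at_def by (auto simp: add.assoc)
    qed (use c in \<open>simp add: code_at_def nth_append\<close>)
  qed
qed

lemma code_at_Nil: "code_at P p []"
  by (simp add: code_at_def)

lemma code_at_Cons: "code_at P p (x # xs) \<longleftrightarrow> p < length P \<and> P ! p = x \<and> code_at P (Suc p) xs"
  using code_at_append[of P p "[x]" xs] by (auto simp: code_at_def)

text \<open>An upper bound instead of an exact count lets the two branches of a conditional be
  covered by the length of the code.\<close>

definition leads :: "instr list \<Rightarrow> nat \<Rightarrow> config \<Rightarrow> config \<Rightarrow> bool" where
  "leads P n c c' \<longleftrightarrow> (\<exists>t\<le>n. (ram_step P ^^ t) c = c')"

lemma leads_refl: "leads P 0 c c"
  by (simp add: leads_def)

lemma leads_trans:
  assumes "leads P n c c'" "leads P m c' c''"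
  shows "leads P (n + m) c c''"
proof -
  obtain t u where "t \<le> n" "(ram_step P ^^ t) c = c'" "u \<le> m" "(ram_step P ^^ u) c' = c''"
    using assms by (auto simp: leads_def)
  then have "u + t \<le> n + m" "(ram_step P ^^ (u + t)) c = c''" by (auto simp: funpow_add)
  then show ?thesis unfolding leads_def by blast
qed

lemma leads_mono: "leads P n c c' \<Longrightarrow> n \<le> m \<Longrightarrow> leads P m c c'"
  unfolding leads_def using le_trans by blast

lemma leads_step:
  assumes "p < length P" "P ! p = x" "exec_instr x (Config p X xs ys) = c"
  shows "leads P 1 (Config p X xs ys) c"
  unfolding leads_def using assms by (intro exI[of _ 1]) (simp add: ram_step_def)

lemma leads_straight:
  assumes "code_at P (pc c) xs" "\<forall>x\<in>set xs. straight x"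
  shows "leads P (length xs) c (fold exec_instr xs c)"
  using assms
proof (induction xs arbitrary: c)
  case Nil
  then show ?case by (simp add: leads_refl)
next
  case (Cons x xs)
  have "leads P 1 c (exec_instr x c)"
    using Cons.prems by (cases c, simp only:, intro leads_step) (auto simp: code_at_Cons)
  moreover have "leads P (length xs) (exec_instr x c) (fold exec_instr xs (exec_instr x c))"
    using Cons by (simp add: code_at_Cons exec_straight_pc)
  ultimately show ?case using leads_trans by fastforce
qed

lemma straight_code:
  "\<forall>x\<in>set (index_code d k). straight x" "\<forall>x\<in>set (compile_exp d a). straight x"
  by (simp add: index_code_def) (induction d a rule: compile_exp.induct, auto simp: index_code_def)

lemma exec_index_code:
  "\<exists>X'. fold exec_instr (index_code d k) (Config p X xs ys) =
      Config (p + length (index_code d k)) X' xs ys \<and>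
     X' d = 64 * (X d + 1) + k \<and> (\<forall>a. a \<noteq> d \<and> a \<noteq> Suc d \<longrightarrow> X' a = X a)"
  by (simp add: index_code_def numeral_eq_Suc)

text \<open>The frame clause below \<open>d\<close> is what preserves the left operand while the
  right one is evaluated at \<open>Suc d\<close>.\<close>

lemma exec_compile_exp:
  assumes "32 \<le> d" "wf_exp d a" "represents X s"
  shows "\<exists>X'. fold exec_instr (compile_exp d a) (Config p X xs ys) =
      Config (p + length (compile_exp d a)) X' xs ys \<and>
     X' d = val a s \<and> (\<forall>b. b < d \<or> 64 \<le> b \<longrightarrow> X' b = X b)"
  using assms
proof (induction d a arbitrary: p X rule: compile_exp.induct)
  case (2 d i)
  then show ?case by (simp add: represents_def)
next
  case (3 d k a)
  obtain X1 where X1: "fold exec_instr (compile_exp d a) (Config p X xs ys) =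
      Config (p + length (compile_exp d a)) X1 xs ys"
     "X1 d = val a s" "\<forall>b. b < d \<or> 64 \<le> b \<longrightarrow> X1 b = X b" using "3.IH"[OF 3(2) _ 3(4), of p] 3(3) by auto
  obtain X2 where X2: "fold exec_instr (index_code d k) (Config (p + length (compile_exp d a)) X1 xs ys) =
      Config (p + length (compile_exp d a) + length (index_code d k)) X2 xs ys"
    "X2 d = 64 * (X1 d + 1) + k" "\<forall>a. a \<noteq> d \<and> a \<noteq> Suc d \<longrightarrow> X2 a = X1 a"
    using exec_index_code by blast
  have "represents X2 s" using 3(4) by (rule represents_frame) (use 3(2,3) X1(3) X2(3) in auto)
  then have "X2 (X2 d) = arr s k (val a s)" using 3(3) X1(2) X2(2) by (simp add: represents_def)
  then show ?case using X1 X2 3(2,3) by auto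
next
  case (4 d a b)
  obtain X1 where X1: "fold exec_instr (compile_exp d a) (Config p X xs ys) =
      Config (p + length (compile_exp d a)) X1 xs ys"
     "X1 d = val a s" "\<forall>b. b < d \<or> 64 \<le> b \<longrightarrow> X1 b = X b" using "4.IH"(1)[OF 4(3) _ 4(5), of p] 4(4) by auto
  have r1: "represents X1 s" using 4(5) by (rule represents_frame) (use 4(3) X1(3) in auto)
  obtain X2 where X2: "fold exec_instr (compile_exp (Suc d) b) (Config (p + length (compile_exp d a)) X1 xs ys) =
      Config (p + length (compile_exp d a) + length (compile_exp (Suc d) b)) X2 xs ys"
    "X2 (Suc d) = val b s" "\<forall>a. a < Suc d \<or> 64 \<le> a \<longrightarrow> X2 a = X1 a"
    using "4.IH"(2)[OF _ _ r1, of "p + length (compile_exp d a)"] 4(3,4) by auto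
  have "d < 64" using 4(4) by (induction a) auto
  then show ?case using X1 X2 by auto
next
  case (5 d a b)
  obtain X1 where X1: "fold exec_instr (compile_exp d a) (Config p X xs ys) =
      Config (p + length (compile_exp d a)) X1 xs ys"
     "X1 d = val a s" "\<forall>b. b < d \<or> 64 \<le> b \<longrightarrow> X1 b = X b" using "5.IH"(1)[OF 5(3) _ 5(5), of p] 5(4) by auto
  have r1: "represents X1 s" using 5(5) by (rule represents_frame) (use 5(3) X1(3) in auto)
  obtain X2 where X2: "fold exec_instr (compile_exp (Suc d) b) (Config (p + length (compile_exp d a)) X1 xs ys) =
      Config (p + length (compile_exp d a) + length (compile_exp (Suc d) b)) X2 xs ys"
    "X2 (Suc d) = val b s" "\<forall>a. a < Suc d \<or> 64 \<le> a \<longrightarrow> X2 a = X1 a"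
    using "5.IH"(2)[OF _ _ r1, of "p + length (compile_exp d a)"] 5(3,4) by auto
  have "d < 64" using 5(4) by (induction a) auto
  then show ?case using X1 X2 by auto
qed simp

lemma leads_compile_exp:
  assumes "32 \<le> d" "wf_exp d a" "represents X s" "code_at P p (compile_exp d a)"
  shows "\<exists>X'. leads P (length (compile_exp d a)) (Config p X xs ys)
      (Config (p + length (compile_exp d a)) X' xs ys) \<and> X' d = val a s \<and>
    (\<forall>b. b < d \<or> 64 \<le> b \<longrightarrow> X' b = X b) \<and> represents X' s"
proof -
  obtain X' where X': "fold exec_instr (compile_exp d a) (Config p X xs ys) =
      Config (p + length (compile_exp d a)) X' xs ys"
     "X' d = val a s" "\<forall>b. b < d \<or> 64 \<le> b \<longrightarrow> X' b = X b"
    using exec_compile_exp[OF assms(1-3)] by blast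
  have "leads P (length (compile_exp d a)) (Config p X xs ys)
      (Config (p + length (compile_exp d a)) X' xs ys)"
    using leads_straight[of P "Config p X xs ys" "compile_exp d a"] assms(4) X'(1) straight_code by simp
  moreover have "represents X' s" using assms X' by (auto intro: represents_frame)
  ultimately show ?thesis using X' by blast
qed

lemma leads_assign:
  assumes "wf_exp 32 a" "i < 32" "represents X s" "code_at P p (compile_exp 32 a @ [Const i 0, Add i i 32])"
  shows "\<exists>X'. leads P (length (compile_exp 32 a) + 2) (Config p X xs ys)
      (Config (p + length (compile_exp 32 a) + 2) X' xs ys) \<and> represents X' (set_reg i (val a s) s)"
proof -
  note code = assms(4)[unfolded code_at_append code_at_Cons]
  obtain X1 where X1: "leads P (length (compile_exp 32 a)) (Config p X xs ys)
      (Config (p + length (compile_exp 32 a)) X1 xs ys)" "X1 32 = val a s" "represents X1 s"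
    using leads_compile_exp[OF _ assms(1,3)] code by blast
  let ?q = "p + length (compile_exp 32 a)"
  have "leads P 2 (Config ?q X1 xs ys) (Config (?q + 2) (X1(i := val a s)) xs ys)"
    using leads_straight[of P "Config ?q X1 xs ys" "[Const i 0, Add i i 32]"] code X1(2) assms(2)
    by (simp add: code_at_Cons numeral_2_eq_2 fun_upd_def cong: if_cong)
  moreover have "represents (X1(i := val a s)) (set_reg i (val a s) s)"
    using X1(3) assms(2) by (rule represents_set_reg) auto
  ultimately show ?thesis using leads_trans[OF X1(1)] by blast
qed

abbreviation conf :: "nat \<Rightarrow> (nat \<Rightarrow> nat) \<Rightarrow> store \<Rightarrow> config" where
  "conf p X s \<equiv> Config p X (tape s) (printed s)"

text \<open>Statements contain no loops and compile to forward jumps only, so each instruction is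
  executed at most once and the code length bounds the time.\<close>

lemma leads_compile_stm:
  assumes "wf_stm l c" "represents X s" "code_at P p (compile_stm p c)"
  shows "\<exists>X'. leads P (length (compile_stm p c)) (conf p X s)
      (conf (p + length (compile_stm p c)) X' (exec c s)) \<and>
     represents X' (exec c s)"
  using assms
proof (induction c arbitrary: p X s)
  case (Assign i a)
  then show ?case using leads_assign[of a i X s P p "tape s" "printed s"] by auto
next
  case (Update k a b)
  let ?ca = "compile_exp 32 a" and ?cb = "compile_exp 33 b" and ?ci = "index_code 32 k"
  note code = Update(3)[unfolded compile_stm.simps code_at_append code_at_Cons]
  obtain X1 where X1: "leads P (length ?ca) (conf p X s)
      (conf (p + length ?ca) X1 s)" "X1 32 = val a s" "represents X1 s"
    using leads_compile_exp[of 32 a X s P p "tape s" "printed s"] Update(1,2) code by auto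
  let ?p2 = "p + length ?ca + length ?ci"
  obtain X2 where X2: "fold exec_instr ?ci (conf (p + length ?ca) X1 s) =
      conf ?p2 X2 s"
    "X2 32 = 64 * (X1 32 + 1) + k" "\<forall>a. a \<noteq> 32 \<and> a \<noteq> Suc 32 \<longrightarrow> X2 a = X1 a"
    using exec_index_code by blast
  have l2: "leads P (length ?ci) (conf (p + length ?ca) X1 s)
      (conf ?p2 X2 s)"
    using leads_straight[of P "conf (p + length ?ca) X1 s" ?ci] code X2(1)
      straight_code by simp
  have r2: "represents X2 s" using X1(3) by (rule represents_frame) (use X2(3) in auto)
  obtain X3 where X3: "leads P (length ?cb) (conf ?p2 X2 s)
      (conf (?p2 + length ?cb) X3 s)" "X3 33 = val b s"
    "\<forall>b. b < 33 \<or> 64 \<le> b \<longrightarrow> X3 b = X2 b" "represents X3 s"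
    using leads_compile_exp[of 33 b X2 s P ?p2 "tape s" "printed s"] Update(1) code r2
    by (auto simp: add.assoc)
  let ?X = "X3(X3 32 := X3 33)"
  have l4: "leads P 1 (conf (?p2 + length ?cb) X3 s)
      (conf (?p2 + length ?cb + 1) ?X s)"
    using code by (intro leads_step) (auto simp: add.assoc)
  have "X3 32 = 64 * (val a s + 1) + k" using X3(3) X2(2) X1(2) by simp
  then have "represents ?X (exec (Update k a b) s)"
    using represents_update[OF X3(4), of k ?X "val a s" "val b s"] Update(1) X3(2) by simp
  then show ?case
    using leads_trans[OF leads_trans[OF leads_trans[OF X1(1) l2] X3(1)] l4] by (auto simp: add.assoc)
next
  case (Input i)
  let ?v = "case tape s of [] \<Rightarrow> 0 | x # _ \<Rightarrow> x"
  have "leads P 1 (conf p X s) (Config (p + 1) (X(i := ?v)) (tl (tape s)) (printed s))"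
    using Input(3) by (intro leads_step) (auto simp: code_at_Cons)
  moreover have "represents (X(i := ?v)) (exec (Input i) s)"
    using Input(1,2) by (auto simp: represents_def)
  ultimately show ?case by auto
next
  case (Output a)
  let ?ca = "compile_exp 32 a"
  note code = Output(3)[unfolded compile_stm.simps code_at_append code_at_Cons]
  obtain X1 where X1: "leads P (length ?ca) (conf p X s)
      (conf (p + length ?ca) X1 s)" "X1 32 = val a s" "represents X1 s"
    using leads_compile_exp[of 32 a X s P p "tape s" "printed s"] Output(1,2) code by auto
  have "leads P 1 (conf (p + length ?ca) X1 s)
      (Config (p + length ?ca + 1) X1 (tape s) (printed s @ [val a s]))"
    using code X1(2) by (intro leads_step) auto
  moreover have "represents X1 (exec (Output a) s)" using X1(3) by (simp add: represents_def)
  ultimately show ?case using leads_trans[OF X1(1)] by fastforce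
next
  case (Seq c d)
  let ?x = "compile_stm p c"
  have code: "code_at P p ?x" "code_at P (p + length ?x) (compile_stm (p + length ?x) d)"
    using Seq(5) by (auto simp: Let_def code_at_append)
  obtain X1 where X1: "leads P (length ?x) (conf p X s)
      (conf (p + length ?x) X1 (exec c s))" "represents X1 (exec c s)"
    using Seq(1)[OF _ Seq(4) code(1)] Seq(3) by auto
  show ?case using Seq(2)[OF _ X1(2) code(2)] Seq(3) leads_trans[OF X1(1)]
    by (auto simp: Let_def add.assoc)
next
  case (If a c d)
  let ?x = "compile_exp 32 a"
  let ?q = "p + length ?x"
  let ?y = "compile_stm (?q + 1) d"
  let ?r = "?q + length ?y + 3"
  let ?z = "compile_stm ?r c"
  have len: "length (compile_stm p (If a c d)) = length ?x + length ?y + length ?z + 3"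
    by (simp add: Let_def)
  have code: "code_at P p ?x" "?q < length P" "P ! ?q = JumpPos ?r 32"
    "code_at P (?q + 1) ?y" "code_at P (?q + 1 + length ?y) [Const 32 1, JumpPos (?r + length ?z) 32]"
    "code_at P ?r ?z"
    using If(5) by (auto simp: Let_def code_at_append code_at_Cons code_at_Nil algebra_simps numeral_3_eq_3)
  obtain X1 where X1: "leads P (length ?x) (conf p X s)
      (conf ?q X1 s)" "X1 32 = val a s" "represents X1 s"
    using leads_compile_exp[of 32 a X s P p "tape s" "printed s"] If(3,4) code(1) by auto
  show ?case
  proof (cases "val a s > 0")
    case True
    have "leads P 1 (conf ?q X1 s) (conf ?r X1 s)"
      using code(2,3) X1(2) True by (intro leads_step) auto
    note l = leads_trans[OF X1(1) this]
    obtain X2 where X2: "leads P (length ?z) (conf ?r X1 s)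
      (conf (?r + length ?z) X2 (exec c s))" "represents X2 (exec c s)"
      using If(1)[OF _ X1(3) code(6)] If(3) by auto
    have "leads P (length (compile_stm p (If a c d))) (conf p X s)
      (conf (p + length (compile_stm p (If a c d))) X2 (exec c s))"
      using leads_mono[OF leads_trans[OF l X2(1)], of "length (compile_stm p (If a c d))"]
      unfolding len by (simp add: algebra_simps)
    then show ?thesis using True X2(2) by auto
  next
    case False
    have "leads P 1 (conf ?q X1 s) (conf (?q + 1) X1 s)"
      using code(2,3) X1(2) False by (intro leads_step) auto
    note l = leads_trans[OF X1(1) this]
    let ?s = "exec d s"
    let ?u = "?q + 1 + length ?y"
    obtain X2 where X2: "leads P (length ?y) (conf (?q + 1) X1 s)
      (conf ?u X2 ?s)" "represents X2 ?s"
      using If(2)[OF _ X1(3) code(4)] If(3) by auto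
    have "leads P 1 (conf ?u X2 ?s) (conf (Suc ?u) (X2(32 := 1)) ?s)"
      using code(5) by (intro leads_step) (auto simp: code_at_Cons)
    note l = leads_trans[OF leads_trans[OF l X2(1)] this]
    have "leads P 1 (conf (Suc ?u) (X2(32 := 1)) ?s)
      (conf (?r + length ?z) (X2(32 := 1)) ?s)"
      using code(5) by (intro leads_step) (auto simp: code_at_Cons)
    note l = leads_trans[OF l this]
    have "leads P (length (compile_stm p (If a c d))) (conf p X s)
      (conf (p + length (compile_stm p (If a c d))) (X2(32 := 1)) ?s)"
      using leads_mono[OF l, of "length (compile_stm p (If a c d))"]
      unfolding len by (simp add: algebra_simps)
    moreover have "represents (X2(32 := 1)) ?s" using X2(2) by (rule represents_frame) auto
    ultimately show ?thesis using False by auto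
  qed
next
  case Skip
  then show ?case by (auto intro: leads_refl)
qed

lemma exec_frame: "wf_stm l c \<Longrightarrow> reg (exec c s) l = reg s l"
  by (induction c arbitrary: s) auto

lemma leads_compile_loop:
  assumes wf: "wf_loop (For i a c)" and r: "represents X s"
    and code: "code_at P p (compile_loop p (For i a c))"
  defines "s' \<equiv> exec_loop (For i a c) s" and "n \<equiv> length (compile_loop p (For i a c))"
  shows "\<exists>X'. leads P (n * Suc (val a s)) (conf p X s)
      (conf (p + n) X' s') \<and> represents X' s'"
proof -
  define x where "x = compile_exp 32 a @ [Const i 0, Add i i 32]"
  let ?q = "p + length x"
  define y where "y = compile_stm (?q + 4) c"
  let ?t = "?q + 4 + length y"
  have eq: "compile_loop p (For i a c) =
      x @ [Const 32 1, JumpPos ?t 32] @ [Const 32 1, Sub i i 32] @ y @ [JumpPos (?q + 2) i]"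
    by (simp only: compile_loop.simps Let_def x_def y_def)
  have n: "n = length x + length y + 5" unfolding n_def eq by simp
  have code': "code_at P p x" "code_at P ?q [Const 32 1, JumpPos ?t 32]"
    "code_at P (?q + 2) [Const 32 1, Sub i i 32]" "code_at P (?q + 4) y"
    "?t < length P" "P ! ?t = JumpPos (?q + 2) i"
    using code unfolding eq by (auto simp: code_at_append code_at_Cons code_at_Nil numeral_eq_Suc)
  have wf': "wf_exp 32 a" "i < 32" "wf_stm i c" using wf by auto
  obtain X1 where X1: "leads P (length x) (conf p X s)
      (conf ?q X1 s)" "represents X1 (set_reg i (val a s) s)"
    using leads_assign[OF wf'(1,2) r code'(1)[unfolded x_def]] by (auto simp: x_def)
  have "leads P 1 (conf ?q X1 s) (conf (Suc ?q) (X1(32 := 1)) s)"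
    using code'(2) by (intro leads_step) (auto simp: code_at_Cons)
  note l = leads_trans[OF X1(1) this]
  have "leads P 1 (conf (Suc ?q) (X1(32 := 1)) s) (conf ?t (X1(32 := 1)) s)"
    using code'(2) by (intro leads_step) (auto simp: code_at_Cons)
  note l = leads_trans[OF l this]
  have r1: "represents (X1(32 := 1)) (set_reg i (val a s) s)" using X1(2) by (rule represents_frame) auto
  let ?f = "\<lambda>k s. exec c (set_reg i k s)"
  \<comment> \<open>Execution is followed from the test at \<open>?t\<close> on; besides the body,
    each round costs the test and the two decrement instructions.\<close>
  have loop: "\<exists>X'. leads P (Suc (k * (length y + 3))) (conf ?t Y u)
      (conf (Suc ?t) X' (fold ?f (rev [0..<k]) u)) \<and>
      represents X' (fold ?f (rev [0..<k]) u)"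
    if "represents Y u" "reg u i = k" for k Y u
    using that
  proof (induction k arbitrary: Y u)
    case 0
    then have "Y i = 0" using wf'(2) by (simp add: represents_def)
    then have "leads P 1 (conf ?t Y u) (conf (Suc ?t) Y u)"
      using code'(5,6) by (intro leads_step) auto
    then show ?case using 0 by auto
  next
    case (Suc k)
    then have Y: "Y i = Suc k" using wf'(2) by (simp add: represents_def)
    then have "leads P 1 (conf ?t Y u) (conf (?q + 2) Y u)"
      using code'(5,6) by (intro leads_step) auto
    moreover have "leads P 2 (conf (?q + 2) Y u)
       (conf (?q + 4) (Y(32 := 1, i := k)) u)"
      using leads_straight[of P "conf (?q + 2) Y u" "[Const 32 1, Sub i i 32]"]
        code'(3) Y wf'(2) by (simp add: numeral_eq_Suc)
    ultimately have l1: "leads P 3 (conf ?t Y u)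
       (conf (?q + 4) (Y(32 := 1, i := k)) u)"
      using leads_trans by fastforce
    have "represents (Y(32 := 1, i := k)) (set_reg i k u)"
      using Suc.prems(1) wf'(2) by (rule represents_set_reg) auto
    from leads_compile_stm[OF wf'(3) this code'(4)[unfolded y_def]]
    obtain Z where Z: "leads P (length y) (conf (?q + 4) (Y(32 := 1, i := k)) u)
       (conf ?t Z (?f k u))" "represents Z (?f k u)" by (auto simp: y_def)
    have "reg (?f k u) i = k" using exec_frame[OF wf'(3)] by simp
    from Suc.IH[OF Z(2) this] show ?case
      using leads_trans[OF leads_trans[OF l1 Z(1)]] by (fastforce simp: algebra_simps)
  qed
  have "reg (set_reg i (val a s) s) i = val a s" by simp
  from loop[OF r1 this] obtain X' where X':
    "leads P (Suc (val a s * (length y + 3))) (conf ?t (X1(32 := 1)) s)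
      (conf (Suc ?t) X' s')" "represents X' s'"
    unfolding s'_def by auto
  have "length x + 1 + 1 + Suc (val a s * (length y + 3)) \<le> n * Suc (val a s)"
    unfolding n by (simp add: algebra_simps)
  from leads_mono[OF leads_trans[OF l X'(1)] this]
  have "leads P (n * Suc (val a s)) (conf p X s) (conf (p + n) X' s')"
    by (simp add: n algebra_simps numeral_eq_Suc)
  then show ?thesis using X'(2) by blast
qed

text \<open>\<open>N\<close>, later the length of the whole program, bounds the code of every single
  loop, so one constant serves all of them.\<close>

lemma leads_compile:
  assumes "\<forall>l\<in>set ls. wf_loop l" "represents X s" "code_at P p (compile p ls)" "length (compile p ls) \<le> N"
  shows "\<exists>X'. leads P (N * iterations ls s) (conf p X s)
      (conf (p + length (compile p ls)) X' (fold exec_loop ls s))"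
  using assms
proof (induction ls arbitrary: p X s)
  case Nil
  then show ?case by (auto intro: leads_refl)
next
  case (Cons l ls)
  obtain i a c where l: "l = For i a c" by (cases l)
  let ?x = "compile_loop p l"
  have code: "code_at P p ?x" "code_at P (p + length ?x) (compile (p + length ?x) ls)"
    and N: "length ?x \<le> N" "length (compile (p + length ?x) ls) \<le> N"
    using Cons.prems(3,4) by (auto simp: Let_def code_at_append)
  obtain X1 where X1: "leads P (length ?x * Suc (val a s)) (conf p X s)
      (conf (p + length ?x) X1 (exec_loop l s))"
    "represents X1 (exec_loop l s)"
    using leads_compile_loop[of i a c X s P p] Cons.prems(1,2) code(1) unfolding l by auto
  have "leads P (N * Suc (val a s)) (conf p X s)
      (conf (p + length ?x) X1 (exec_loop l s))"
    using leads_mono[OF X1(1)] N(1) mult_le_mono1 by blast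
  moreover obtain X2 where "leads P (N * iterations ls (exec_loop l s))
      (conf (p + length ?x) X1 (exec_loop l s))
      (conf (p + length ?x + length (compile (p + length ?x) ls)) X2 (fold exec_loop ls (exec_loop l s)))"
    using Cons.IH[OF _ X1(2) code(2) N(2)] Cons.prems(1) by auto
  ultimately have "leads P (N * Suc (val a s) + N * iterations ls (exec_loop l s))
     (conf p X s)
      (conf (p + length ?x + length (compile (p + length ?x) ls)) X2 (fold exec_loop ls (exec_loop l s)))"
    by (rule leads_trans)
  moreover have "N * iterations (l # ls) s = N * Suc (val a s) + N * iterations ls (exec_loop l s)"
    by (simp add: l algebra_simps)
  ultimately show ?case by (auto simp: Let_def add.assoc)
qed

definition initial :: "nat list \<Rightarrow> store" where
  "initial xs = \<lparr>reg = (\<lambda>_. 0), arr = (\<lambda>_ _. 0), tape = xs, printed = []\<rparr>"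

theorem compile_computes:
  assumes "\<forall>l\<in>set ls. wf_loop l"
  shows "\<exists>t \<le> length (compile 0 ls) * iterations ls (initial xs).
    ram_computes_within (compile 0 ls) xs t (printed (fold exec_loop ls (initial xs)))"
proof -
  have "represents (\<lambda>_. 0) (initial xs)" by (simp add: represents_def initial_def)
  moreover have "code_at (compile 0 ls) 0 (compile 0 ls)" by (simp add: code_at_def)
  ultimately show ?thesis
    using leads_compile[OF assms, of "\<lambda>_. 0" "initial xs" "compile 0 ls" 0 "length (compile 0 ls)"]
    unfolding leads_def ram_computes_within_def by (auto simp: initial_def Let_def)
qed

section \<open>Frame properties read off from the syntax\<close>

fun arrays :: "stm \<Rightarrow> nat set" where
  "arrays (Update k a b) = {k}"
| "arrays (Seq c d) = arrays c \<union> arrays d"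
| "arrays (If a c d) = arrays c \<union> arrays d"
| "arrays _ = {}"

fun regs :: "stm \<Rightarrow> nat set" where
  "regs (Assign i a) = {i}"
| "regs (Input i) = {i}"
| "regs (Seq c d) = regs c \<union> regs d"
| "regs (If a c d) = regs c \<union> regs d"
| "regs _ = {}"

fun loop_arrays :: "loop \<Rightarrow> nat set" where
  "loop_arrays (For i a c) = arrays c"

fun loop_regs :: "loop \<Rightarrow> nat set" where
  "loop_regs (For i a c) = insert i (regs c)"

lemma arr_exec: "k \<notin> arrays c \<Longrightarrow> arr (exec c s) k = arr s k"
  by (induction c arbitrary: s) auto

lemma reg_exec: "i \<notin> regs c \<Longrightarrow> reg (exec c s) i = reg s i"
  by (induction c arbitrary: s) auto

lemma arr_exec_loop:
  assumes "k \<notin> loop_arrays l"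
  shows "arr (exec_loop l s) k = arr s k"
proof (cases l)
  case (For i a c)
  show ?thesis unfolding For
    by (rule exec_loop_invariant[where I = "\<lambda>_ s'. arr s' k = arr s k"]) (use assms For in \<open>auto simp: arr_exec\<close>)
qed

lemma reg_exec_loop:
  assumes "i \<notin> loop_regs l"
  shows "reg (exec_loop l s) i = reg s i"
proof (cases l)
  case (For j a c)
  show ?thesis unfolding For
    by (rule exec_loop_invariant[where I = "\<lambda>_ s'. reg s' i = reg s i"]) (use assms For in \<open>auto simp: reg_exec\<close>)
qed

section \<open>The program\<close>

abbreviation (input) "rN \<equiv> 2 :: nat"
abbreviation (input) "rM \<equiv> 3 :: nat"
abbreviation (input) "rK \<equiv> 4 :: nat"
abbreviation (input) "rU \<equiv> 5 :: nat"
abbreviation (input) "rV \<equiv> 6 :: nat"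
abbreviation (input) "rArc \<equiv> 7 :: nat"
abbreviation (input) "rCur \<equiv> 8 :: nat"
abbreviation (input) "rHead \<equiv> 9 :: nat"
abbreviation (input) "rTail \<equiv> 10 :: nat"
abbreviation (input) "rRoot \<equiv> 11 :: nat"
abbreviation (input) "rW \<equiv> 12 :: nat"
abbreviation (input) "rZ \<equiv> 13 :: nat"
abbreviation (input) "rUp \<equiv> 14 :: nat"

abbreviation (input) "aTarget \<equiv> 2 :: nat"
abbreviation (input) "aNext \<equiv> 3 :: nat"
abbreviation (input) "aFirst \<equiv> 4 :: nat"
abbreviation (input) "aMark \<equiv> 5 :: nat"
abbreviation (input) "aPar \<equiv> 6 :: nat"
abbreviation (input) "aQueue \<equiv> 7 :: nat"
abbreviation (input) "aRep \<equiv> 8 :: nat"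
abbreviation (input) "aInner \<equiv> 9 :: nat"
abbreviation (input) "aCount \<equiv> 10 :: nat"
abbreviation (input) "aB2 \<equiv> 11 :: nat"
abbreviation (input) "aB3 \<equiv> 12 :: nat"
abbreviation (input) "aDown \<equiv> 13 :: nat"

fun block_stm :: "stm list \<Rightarrow> stm" where
  "block_stm [] = Skip"
| "block_stm (c # cs) = Seq c (block_stm cs)"

text \<open>Subtraction is truncated, so the sum is positive exactly when the values differ.\<close>

definition neq_exp :: "aexp \<Rightarrow> aexp \<Rightarrow> aexp" where
  "neq_exp a b = Plus (Minus a b) (Minus b a)"

lemma val_neq_exp [simp]: "0 < val (neq_exp a b) s \<longleftrightarrow> val a s \<noteq> val b s"
  by (auto simp: neq_exp_def)


text \<open>Edge \<open>k\<close>, counted from the end of the input, gives rise to the arcs \<open>2 k + 1\<close> and \<open>2 k + 2\<close>;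
  the arcs leaving a vertex form a linked list, where arc \<open>0\<close> marks the end.\<close>

definition add_arc :: "nat \<Rightarrow> nat \<Rightarrow> nat \<Rightarrow> stm list" where
  "add_arc i u v =
    [Assign rW (Plus (Plus (Var rK) (Var rK)) (Num i)),
     Update aTarget (Var rW) (Var v), Update aNext (Var rW) (Arr aFirst (Var u)),
     Update aFirst (Var u) (Var rW)]"

text \<open>Programs are lists of loops, so code to be run once is a loop with one
  iteration.\<close>

definition read_size :: loop where
  "read_size = For rK (Num 1) (block_stm [Input rN, Input rM])"

definition read_edges :: loop where
  "read_edges = For rK (Var rM)
     (block_stm ([Input rU, Input rV] @ add_arc 1 rU rV @ add_arc 2 rV rU))"

definition visit :: stm where
  "visit = If (Arr aMark (Var rW)) Skip (block_stm
     [Update aMark (Var rW) (Num 1), Update aPar (Var rW) (Var rCur),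
      Update aQueue (Var rTail) (Var rW), Assign rTail (Plus (Var rTail) (Num 1))])"

text \<open>The nested loops of a breadth-first search are flattened into one step, since loop
  bodies are loop-free; \<open>rArc\<close> is 0 when the arcs of the current vertex are
  exhausted.\<close>

definition bfs_step :: stm where
  "bfs_step = If (Var rArc)
     (block_stm [Assign rW (Arr aTarget (Var rArc)), visit, Assign rArc (Arr aNext (Var rArc))])
     (If (Minus (Var rTail) (Var rHead))
       (block_stm [Assign rCur (Arr aQueue (Var rHead)), Assign rHead (Plus (Var rHead) (Num 1)),
          Assign rArc (Arr aFirst (Var rCur))])
       Skip)"

text \<open>The second search finds the marks of the first one still set.\<close>

definition bfs_clear :: loop where
  "bfs_clear = For rK (Var rN) (Update aMark (Var rK) (Num 0))"

text \<open>The parent of the root is \<open>n\<close>, which is not a vertex, so the root shares its parent with no vertex.\<close>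

definition bfs_init :: loop where
  "bfs_init = For rK (Num 1) (block_stm
      [Update aMark (Var rRoot) (Num 1), Update aPar (Var rRoot) (Var rN),
       Update aQueue (Num 0) (Var rRoot), Assign rHead (Num 0), Assign rTail (Num 1),
       Assign rArc (Num 0)])"

text \<open>Every iteration handles one of the \<open>2 m\<close> arcs or dequeues one of the \<open>n\<close> vertices until nothing is left.\<close>

definition bfs_main :: loop where
  "bfs_main = For rK (Plus (Var rN) (Plus (Var rM) (Var rM))) bfs_step"

definition bfs :: "loop list" where
  "bfs = [bfs_clear, bfs_init, bfs_main]"

section \<open>Reading the graph\<close>

fun chain :: "(nat \<Rightarrow> nat) \<Rightarrow> nat \<Rightarrow> nat list \<Rightarrow> bool" where
  "chain X a [] \<longleftrightarrow> a = 0"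
| "chain X a (x # xs) \<longleftrightarrow> a = x \<and> 0 < x \<and> chain X (X x) xs"

lemma chain_upd: "b \<notin> set xs \<Longrightarrow> chain (X(b := y)) a xs = chain X a xs"
  by (induction xs arbitrary: a) auto

lemma chain_0: "chain X 0 xs \<Longrightarrow> xs = []"
  by (cases xs) auto

lemma chain_pos: "chain X a xs \<Longrightarrow> 0 < a \<Longrightarrow> \<exists>ys. xs = a # ys \<and> chain X (X a) ys"
  by (cases xs) auto

text \<open>An element of \<open>A\<close> consists of the number, the source and the target of an arc.\<close>

definition arcs_stored :: "(nat \<times> nat \<times> nat) set \<Rightarrow> nat \<Rightarrow> (nat \<Rightarrow> nat \<Rightarrow> nat) \<Rightarrow> (nat \<Rightarrow> nat list) \<Rightarrow> bool" where
  "arcs_stored A n a L \<longleftrightarrow>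
     (\<forall>v<n. chain (a aNext) (a aFirst v) (L v) \<and> (\<forall>x. x \<in> set (L v) \<longleftrightarrow> (\<exists>w. (x, v, w) \<in> A))) \<and>
     (\<forall>(x, v, w)\<in>A. a aTarget x = w) \<and> (\<Sum>v<n. length (L v)) = card A \<and> finite A"

lemma arcs_stored_insert:
  assumes st: "arcs_stored A n a L" and x: "0 < x" "\<And>u w. (x, u, w) \<notin> A" and v: "v < n"
    and a': "a' aNext = (a aNext)(x := a aFirst v)" "a' aTarget = (a aTarget)(x := w)"
      "a' aFirst = (a aFirst)(v := x)"
  shows "arcs_stored (insert (x, v, w) A) n a' (L(v := x # L v))"
proof -
  have fresh: "x \<notin> set (L u)" if "u < n" for u using st x(2) that by (auto simp: arcs_stored_def)
  have "chain (a' aNext) (a' aFirst u) ((L(v := x # L v)) u)" if "u < n" for u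
    using st that fresh[OF that] x(1) by (auto simp: a' chain_upd arcs_stored_def)
  moreover have "(\<Sum>u<n. length ((L(v := x # L v)) u)) = Suc (\<Sum>u<n. length (L u))"
    using v by (simp add: sum.remove[of "{..<n}" v])
  moreover have "card (insert (x, v, w) A) = Suc (card A)" using x st by (simp add: arcs_stored_def)
  ultimately show ?thesis using st x(2) unfolding arcs_stored_def by (auto simp: a')
qed

definition arcs_of :: "nat \<Rightarrow> nat \<times> nat \<Rightarrow> (nat \<times> nat \<times> nat) set" where
  "arcs_of k e = {(k + k + 1, fst e, snd e), (k + k + 2, snd e, fst e)}"

text \<open>The arcs present when the counter is \<open>k\<close>: it runs down while the input is
  read forwards, hence \<open>rev\<close>.\<close>

definition arcs_from :: "(nat \<times> nat) list \<Rightarrow> nat \<Rightarrow> (nat \<times> nat \<times> nat) set" where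
  "arcs_from es k = (\<Union>j\<in>{k..<length es}. arcs_of j (rev es ! j))"

lemma arcs_from_Suc:
  assumes "k < length es"
  shows "arcs_from es k = arcs_of k (rev es ! k) \<union> arcs_from es (Suc k)"
proof -
  have "{k..<length es} = insert k {Suc k..<length es}" using assms by auto
  then show ?thesis by (simp add: arcs_from_def)
qed

lemma arcs_from_bound: "(x, u, w) \<in> arcs_from es k \<Longrightarrow> k + k < x"
  unfolding arcs_from_def arcs_of_def by fastforce

definition encode_edges :: "(nat \<times> nat) list \<Rightarrow> nat list" where
  "encode_edges es = concat (map (\<lambda>(u, v). [u, v]) es)"

lemma read_size:
  assumes "tape s = n # m # xs"
  defines "s' \<equiv> exec_loop read_size s"
  shows "reg s' = (reg s)(rN := n, rM := m, rK := 0)" "arr s' = arr s" "tape s' = xs"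
    "printed s' = printed s"
  using assms by (auto simp: read_size_def fun_upd_def)

lemma read_edges:
  assumes tape: "tape s = encode_edges es" and m: "reg s rM = length es"
    and zero: "arr s aFirst = (\<lambda>_. 0)" and bound: "\<forall>(u, v)\<in>set es. u < n \<and> v < n"
  defines "s' \<equiv> exec_loop read_edges s"
  shows "\<exists>L. arcs_stored (arcs_from es 0) n (arr s') L"
proof -
  let ?m = "length es"
  define I where "I k s' \<longleftrightarrow> tape s' = encode_edges (drop (?m - k) es) \<and>
    (\<exists>L. arcs_stored (arcs_from es k) n (arr s') L)" for k and s' :: store
  have "I 0 s'" unfolding s'_def read_edges_def
  proof (rule exec_loop_invariant)
    have "arcs_from es ?m = {}" by (simp add: arcs_from_def)
    then show "I (val (Var rM) s) (set_reg rK (val (Var rM) s) s)"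
      using tape m zero by (auto simp: I_def arcs_stored_def intro!: exI[of _ "\<lambda>_. []"])
  next
    fix k s1 assume k: "k < val (Var rM) s" and I: "I (Suc k) s1"
    then have k: "k < ?m" using m by simp
    obtain u v where uv: "rev es ! k = (u, v)" by (cases "rev es ! k")
    have d: "drop (?m - Suc k) es = (u, v) # drop (?m - k) es"
      using k uv by (simp add: Cons_nth_drop_Suc[symmetric] rev_nth Suc_diff_Suc)
    have "(u, v) \<in> set es" using uv k by (metis length_rev nth_mem set_rev)
    then have b: "u < n" "v < n" using bound by auto
    obtain L where L: "arcs_stored (arcs_from es (Suc k)) n (arr s1) L" using I by (auto simp: I_def)
    let ?c = "block_stm ([Input rU, Input rV] @ add_arc 1 rU rV @ add_arc 2 rV rU)"
    let ?s = "exec ?c (set_reg rK k s1)"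
    have t: "tape s1 = u # v # encode_edges (drop (?m - k) es)"
      using I d by (simp add: I_def encode_edges_def)
    define a1 where "a1 = (arr s1)(aTarget := (arr s1 aTarget)(k + k + 1 := v),
       aNext := (arr s1 aNext)(k + k + 1 := arr s1 aFirst u), aFirst := (arr s1 aFirst)(u := k + k + 1))"
    have "arr ?s = a1(aTarget := (a1 aTarget)(k + k + 2 := u),
       aNext := (a1 aNext)(k + k + 2 := a1 aFirst v), aFirst := (a1 aFirst)(v := k + k + 2))"
      by (simp add: add_arc_def t a1_def fun_eq_iff)
    moreover have "arcs_stored (insert (k + k + 1, u, v) (arcs_from es (Suc k))) n a1 (L(u := (k + k + 1) # L u))"
      by (rule arcs_stored_insert[OF L _ _ b(1)]) (auto simp: a1_def dest: arcs_from_bound)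
    ultimately have "arcs_stored (insert (k + k + 2, v, u) (insert (k + k + 1, u, v) (arcs_from es (Suc k)))) n
      (arr ?s) ((L(u := (k + k + 1) # L u))(v := (k + k + 2) # (L(u := (k + k + 1) # L u)) v))"
      by (intro arcs_stored_insert[OF _ _ _ b(2)]) (auto dest: arcs_from_bound)
    moreover have "insert (k + k + 2, v, u) (insert (k + k + 1, u, v) (arcs_from es (Suc k))) = arcs_from es k"
      unfolding arcs_from_Suc[OF k] arcs_of_def uv by auto
    moreover have "tape ?s = encode_edges (drop (?m - k) es)" by (simp add: add_arc_def t)
    ultimately show "I k ?s" unfolding I_def by auto
  qed
  then show ?thesis by (simp add: I_def)
qed

section \<open>Breadth-first search\<close>

locale stored_graph =
  fixes G :: "nat ugraph" and n m :: nat and T X F :: "nat \<Rightarrow> nat" and L :: "nat \<Rightarrow> nat list"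
  assumes block_graph: "block_graph G" and verts: "verts G = {..<n}"
    and chain: "v < n \<Longrightarrow> chain X (F v) (L v)"
    and targets: "v < n \<Longrightarrow> T ` set (L v) = {w. adj G v w}"
    and arc_count: "(\<Sum>v<n. length (L v)) = 2 * m"
begin

lemma adj_bound: "adj G u v \<Longrightarrow> u < n" "adj G u v \<Longrightarrow> v < n"
  using simple_graph_adjD[OF block_graph_simple[OF block_graph], of u v] verts by auto

text \<open>\<open>p j\<close> is the index of the parent of the vertex with index \<open>j\<close> in the queue \<open>q\<close>.\<close>

definition parent_index :: "(nat \<Rightarrow> nat) \<Rightarrow> (nat \<Rightarrow> nat) \<Rightarrow> nat \<Rightarrow> nat \<Rightarrow> (nat \<Rightarrow> nat) \<Rightarrow> bool" where
  "parent_index q pa t h p \<longleftrightarrow> (\<forall>j. 1 \<le> j \<and> j < t \<longrightarrow>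
     p j < j \<and> p j < h \<and> pa (q j) = q (p j) \<and> adj G (q (p j)) (q j) \<and>
     (\<forall>i<p j. \<not> adj G (q i) (q j)) \<and> (\<forall>j'. j \<le> j' \<and> j' < t \<longrightarrow> p j \<le> p j'))"

text \<open>\<open>t\<close> vertices have been queued and \<open>h\<close> of them dequeued, the
  last being \<open>c\<close>; \<open>pre\<close> and \<open>rest\<close> are its scanned and
  unscanned arcs. Every step dequeues a vertex or scans an arc, which the equation for
  \<open>steps\<close> expresses; the alternative to it is the idle state after the search is
  complete.\<close>

definition bfs_invariant :: "nat \<Rightarrow> nat \<Rightarrow> (nat \<Rightarrow> nat) \<Rightarrow> nat \<Rightarrow> nat \<Rightarrow> nat \<Rightarrow> nat \<Rightarrow> (nat \<Rightarrow> nat) \<Rightarrow>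
    (nat \<Rightarrow> nat) \<Rightarrow> nat list \<Rightarrow> nat list \<Rightarrow> (nat \<Rightarrow> nat) \<Rightarrow> bool" where
  "bfs_invariant r steps q t h c a mk pa pre rest p \<longleftrightarrow>
     1 \<le> t \<and> q 0 = r \<and> inj_on q {..<t} \<and> q ` {..<t} \<subseteq> {..<n} \<and> pa r = n \<and>
     (\<forall>w<n. 0 < mk w \<longleftrightarrow> w \<in> q ` {..<t}) \<and> h \<le> t \<and>
     chain X a rest \<and>
     (if h = 0 then pre = [] \<and> rest = [] else c = q (h - 1) \<and> L c = pre @ rest) \<and>
     T ` set pre \<subseteq> q ` {..<t} \<and>
     (rest = [] \<and> h = t \<or> steps + length rest = h + (\<Sum>j<h. length (L (q j)))) \<and>
     (\<forall>i w. Suc i < h \<longrightarrow> adj G (q i) w \<longrightarrow> w \<in> q ` {..<t}) \<and>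
     parent_index q pa t h p"

lemma bfs_arc:
  assumes J: "bfs_invariant r steps q t h c a mk pa pre rest p" and a: "0 < a"
  shows "\<exists>rest'. rest = a # rest' \<and> chain X (X a) rest' \<and> 0 < h \<and> c = q (h - 1) \<and> c < n \<and>
    adj G c (T a) \<and> T a < n \<and> L c = pre @ a # rest'"
proof -
  obtain rest' where r: "rest = a # rest'" "chain X (X a) rest'"
    using chain_pos[of X a rest] J a unfolding bfs_invariant_def by blast
  have h: "0 < h" using J r by (auto simp: bfs_invariant_def split: if_splits)
  then have c: "c = q (h - 1)" "L c = pre @ a # rest'" using J r by (auto simp: bfs_invariant_def)
  have "h - 1 < t" using J h by (auto simp: bfs_invariant_def)
  then have "c < n" using J c(1) by (auto simp: bfs_invariant_def)
  then have "adj G c (T a)" using targets[of c] c(2) by auto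
  then show ?thesis using r h c \<open>c < n\<close> adj_bound by blast
qed

lemma bfs_arc_old:
  assumes J: "bfs_invariant r steps q t h c a mk pa pre rest p" and a: "0 < a" and mk: "0 < mk (T a)"
  shows "\<exists>pre rest p. bfs_invariant r (Suc steps) q t h c (X a) mk pa pre rest p"
proof -
  obtain rest' where r: "rest = a # rest'" "chain X (X a) rest'" "0 < h" "c = q (h - 1)"
    "T a < n" "L c = pre @ a # rest'" using bfs_arc[OF J a] by blast
  then have "bfs_invariant r (Suc steps) q t h c (X a) mk pa (pre @ [a]) rest' p"
    using J mk unfolding bfs_invariant_def by auto
  then show ?thesis by blast
qed

text \<open>The new parent index \<open>h - 1\<close> is at least all previous ones. No earlier
  vertex is adjacent to the new one, because the neighbors of fully scanned vertices are already
  queued.\<close>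

lemma bfs_arc_new:
  assumes J: "bfs_invariant r steps q t h c a mk pa pre rest p" and a: "0 < a" and mk: "\<not> 0 < mk (T a)"
  shows "\<exists>pre rest p. bfs_invariant r (Suc steps) (q(t := T a)) (Suc t) h c (X a) (mk(T a := 1))
    (pa(T a := c)) pre rest p"
proof -
  obtain rest' where r: "rest = a # rest'" "chain X (X a) rest'" "0 < h" "c = q (h - 1)"
    "T a < n" "L c = pre @ a # rest'" "adj G c (T a)"
    using bfs_arc[OF J a] by blast
  let ?q = "q(t := T a)" and ?p = "p(t := h - 1)" and ?pa = "pa(T a := c)"
  have new: "T a \<notin> q ` {..<t}" using J mk r(5) by (auto simp: bfs_invariant_def)
  have ht: "h \<le> t" "1 \<le> t" using J by (auto simp: bfs_invariant_def)
  have img: "?q ` {..<Suc t} = insert (T a) (q ` {..<t})" by (auto simp: lessThan_Suc)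
  have "inj_on q {..<t}" using J by (simp add: bfs_invariant_def)
  then have inj: "inj_on ?q {..<Suc t}"
    using new unfolding lessThan_Suc inj_on_insert by (auto simp: inj_on_def image_iff)
  have q: "?q j = q j" if "j < t" for j using that by simp
  have pa: "?pa (q j) = pa (q j)" if "j < t" for j
  proof -
    have "q j \<in> q ` {..<t}" using that by simp
    then show ?thesis using new by (metis fun_upd_other)
  qed
  have scanned: "\<not> adj G (q i) (T a)" if "Suc i < h" for i
    using J that new unfolding bfs_invariant_def by blast
  have pidx: "parent_index q pa t h p" using J by (simp add: bfs_invariant_def)
  have "parent_index ?q ?pa (Suc t) h ?p"
    unfolding parent_index_def
  proof (intro allI impI)
    fix j assume j: "1 \<le> j \<and> j < Suc t"
    show "?p j < j \<and> ?p j < h \<and> ?pa (?q j) = ?q (?p j) \<and> adj G (?q (?p j)) (?q j) \<and>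
     (\<forall>i<?p j. \<not> adj G (?q i) (?q j)) \<and> (\<forall>j'. j \<le> j' \<and> j' < Suc t \<longrightarrow> ?p j \<le> ?p j')"
    proof (cases "j = t")
      case True
      then show ?thesis using r(3,4,7) ht scanned by auto
    next
      case False
      then have jt: "j < t" using j by simp
      then have "p j < j" "p j < h" using pidx j by (auto simp: parent_index_def)
      then have lt: "p j < t" "p j \<le> h - 1" using jt by auto
      then show ?thesis using pidx[unfolded parent_index_def, rule_format, of j] j jt pa[OF jt] by auto
    qed
  qed
  moreover have "(\<Sum>j<h. length (L (?q j))) = (\<Sum>j<h. length (L (q j)))"
    using ht by (intro sum.cong) auto
  moreover have "\<forall>w<n. 0 < (mk(T a := 1)) w \<longleftrightarrow> w \<in> ?q ` {..<Suc t}"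
    unfolding img using J by (auto simp: bfs_invariant_def)
  moreover have "\<forall>i w. Suc i < h \<longrightarrow> adj G (?q i) w \<longrightarrow> w \<in> ?q ` {..<Suc t}"
    unfolding img using J ht by (auto simp: bfs_invariant_def)
  moreover have "T a \<noteq> r" using new J by (auto simp: bfs_invariant_def)
  ultimately have "bfs_invariant r (Suc steps) ?q (Suc t) h c (X a) (mk(T a := 1)) ?pa (pre @ [a]) rest' ?p"
    using J r inj ht img unfolding bfs_invariant_def by auto
  then show ?thesis by blast
qed

lemma bfs_dequeue:
  assumes J: "bfs_invariant r steps q t h c 0 mk pa pre rest p" and h: "h < t"
  shows "\<exists>pre rest p. bfs_invariant r (Suc steps) q t (Suc h) (q h) (F (q h)) mk pa pre rest p"
proof -
  have r: "rest = []" using J chain_0 by (auto simp: bfs_invariant_def)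
  have qh: "q h < n" using J h by (auto simp: bfs_invariant_def)
  have "w \<in> q ` {..<t}" if i: "i < h" and w: "adj G (q i) w" for i w
  proof (cases "Suc i < h")
    case True
    then show ?thesis using J w by (auto simp: bfs_invariant_def)
  next
    case False
    then have "i = h - 1" using i by simp
    then have "q i = c" "L c = pre" using J i r by (auto simp: bfs_invariant_def)
    moreover have "q i < n" using adj_bound[OF w] by simp
    ultimately have "w \<in> T ` set pre" using targets[of c] w by auto
    then show ?thesis using J by (auto simp: bfs_invariant_def)
  qed
  moreover have "parent_index q pa t (Suc h) p"
    using J unfolding bfs_invariant_def parent_index_def by (auto intro: less_SucI)
  ultimately have "bfs_invariant r (Suc steps) q t (Suc h) (q h) (F (q h)) mk pa [] (L (q h)) p"
    using J r h chain[OF qh] unfolding bfs_invariant_def by auto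
  then show ?thesis by blast
qed

lemma bfs_idle:
  assumes "bfs_invariant r steps q t h c 0 mk pa pre rest p" "\<not> h < t"
  shows "bfs_invariant r (Suc steps) q t h c 0 mk pa pre rest p"
  using assms chain_0 by (auto simp: bfs_invariant_def)

definition search_result :: "nat \<Rightarrow> (nat \<Rightarrow> nat) \<Rightarrow> (nat \<Rightarrow> nat) \<Rightarrow> bool" where
  "search_result r q pa \<longleftrightarrow> bij_betw q {..<n} {..<n} \<and> q 0 = r \<and> r < n \<and> pa r = n \<and> (\<exists>p. parent_index q pa n n p)"

text \<open>If the search were not known to be complete, the step equation would give
  \<open>n + 2 * m + length rest\<close> as \<open>h\<close> plus scanned list lengths, which are at
  most \<open>n\<close> and \<open>2 * m\<close>. So \<open>rest\<close> is empty and
  \<open>h = t\<close> in any case, and by connectedness the queue holds all vertices.\<close>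

lemma bfs_finished:
  assumes J: "bfs_invariant r (n + 2 * m) q t h c a mk pa pre rest p"
  shows "search_result r q pa"
proof -
  have inj: "inj_on q {..<t}" and sub: "q ` {..<t} \<subseteq> {..<n}" and ht: "h \<le> t" and t: "1 \<le> t" "q 0 = r"
    using J by (auto simp: bfs_invariant_def)
  have tn: "t \<le> n" using card_inj_on_le[OF inj sub] by simp
  have "(\<Sum>j<h. length (L (q j))) = (\<Sum>v\<in>q ` {..<h}. length (L v))"
    using inj ht by (subst sum.reindex) (auto intro: inj_on_subset)
  also have "\<dots> \<le> (\<Sum>v<n. length (L v))"
  proof (rule sum_mono2)
    have "q ` {..<h} \<subseteq> q ` {..<t}" using ht by (intro image_mono) simp
    then show "q ` {..<h} \<subseteq> {..<n}" using sub by (rule subset_trans)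
  qed auto
  finally have "(\<Sum>j<h. length (L (q j))) \<le> 2 * m" using arc_count by simp
  moreover have "rest = [] \<and> h = t \<or> n + 2 * m + length rest = h + (\<Sum>j<h. length (L (q j)))"
    using J by (auto simp: bfs_invariant_def)
  ultimately have "rest = [] \<and> h = t" using tn ht by (cases rest) auto
  then have r: "rest = []" and h: "h = t" by auto
  have J': "bfs_invariant r (n + 2 * m) q t t c 0 mk pa pre rest p"
    using J r h by (auto simp: bfs_invariant_def)
  have closed: "w \<in> q ` {..<t}" if i: "i < t" and w: "adj G (q i) w" for i w
  proof (cases "Suc i < t")
    case True
    then show ?thesis using J' w by (auto simp: bfs_invariant_def)
  next
    case False
    then have "i = t - 1" using i by simp
    then have "q i = c" "L c = pre" using J' i r by (auto simp: bfs_invariant_def)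
    moreover have "q i < n" using adj_bound[OF w] by simp
    ultimately have "w \<in> T ` set pre" using targets[of c] w by auto
    then show ?thesis using J' by (auto simp: bfs_invariant_def)
  qed
  have "q 0 \<in> q ` {..<t}" using t(1) by simp
  then have rn: "r < n" using sub t(2) by blast
  have "v \<in> q ` {..<t}" if v: "v < n" for v
  proof -
    have "reachable G r v"
      using block_graph rn v verts unfolding block_graph_def connected_graph_def by auto
    then have "(adj G)\<^sup>*\<^sup>* r v" using reachable_iff[OF block_graph_simple[OF block_graph]] by blast
    then show ?thesis
    proof (induction rule: rtranclp_induct)
      case base
      then show ?case using t by force
    next
      case (step y z)
      then show ?case using closed by auto
    qed
  qed
  then have img: "q ` {..<t} = {..<n}" using sub by auto
  then have "t = n" using card_image[OF inj] by simp
  then show ?thesis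
    using inj img t rn J' unfolding search_result_def bij_betw_def bfs_invariant_def by auto
qed

definition stored :: "store \<Rightarrow> bool" where
  "stored s \<longleftrightarrow> reg s rN = n \<and> reg s rM = m \<and> arr s aTarget = T \<and> arr s aNext = X \<and> arr s aFirst = F"

lemma stored_exec_loop:
  assumes "stored s" "loop_regs l \<inter> {rN, rM} = {}" "loop_arrays l \<inter> {aTarget, aNext, aFirst} = {}"
  shows "stored (exec_loop l s)"
  using assms reg_exec_loop arr_exec_loop unfolding stored_def by auto

definition bfs_state :: "nat \<Rightarrow> nat \<Rightarrow> store \<Rightarrow> bool" where
  "bfs_state r steps s \<longleftrightarrow> stored s \<and> (\<exists>pre rest p. bfs_invariant r steps (arr s aQueue) (reg s rTail)
     (reg s rHead) (reg s rCur) (reg s rArc) (arr s aMark) (arr s aPar) pre rest p)"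

lemma bfs_step:
  assumes "bfs_state r steps s"
  shows "bfs_state r (Suc steps) (exec bfs_step (set_reg rK k s))"
proof -
  have st: "reg s rN = n" "reg s rM = m" "arr s aTarget = T" "arr s aNext = X" "arr s aFirst = F"
    using assms by (auto simp: bfs_state_def stored_def)
  obtain pre rest p where J: "bfs_invariant r steps (arr s aQueue) (reg s rTail)
     (reg s rHead) (reg s rCur) (reg s rArc) (arr s aMark) (arr s aPar) pre rest p"
    using assms by (auto simp: bfs_state_def)
  show ?thesis
  proof (cases "0 < reg s rArc")
    case True
    then show ?thesis
      using bfs_arc_old[OF J True] bfs_arc_new[OF J True] st
      by (cases "0 < arr s aMark (T (reg s rArc))")
        (simp_all add: bfs_state_def stored_def bfs_step_def visit_def)
  next
    case False
    then have a: "reg s rArc = 0" by simp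
    then show ?thesis
      using bfs_dequeue[OF J[unfolded a]] bfs_idle[OF J[unfolded a]] st
      by (cases "reg s rHead < reg s rTail") (auto simp: bfs_state_def stored_def bfs_step_def)
  qed
qed

lemma bfs:
  assumes st: "stored s" and r: "reg s rRoot = r" "r < n"
  defines "s' \<equiv> fold exec_loop bfs s"
  shows "stored s'" "search_result r (arr s' aQueue) (arr s' aPar)"
proof -
  let ?s1 = "exec_loop bfs_clear s"
  let ?s2 = "exec_loop bfs_init ?s1"
  have st1: "stored ?s1" using st by (rule stored_exec_loop) (auto simp: bfs_clear_def)
  have r1: "reg ?s1 rRoot = r" using r reg_exec_loop[of rRoot bfs_clear s] by (simp add: bfs_clear_def)
  have "\<forall>v. 0 \<le> v \<and> v < n \<longrightarrow> arr ?s1 aMark v = 0" unfolding bfs_clear_def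
  proof (rule exec_loop_invariant[where I = "\<lambda>k s. \<forall>v. k \<le> v \<and> v < n \<longrightarrow> arr s aMark v = 0"])
    show "\<forall>v. val (Var rN) s \<le> v \<and> v < n \<longrightarrow> arr (set_reg rK (val (Var rN) s) s) aMark v = 0"
      using st by (auto simp: stored_def)
  qed (auto simp: Suc_le_eq)
  then have mark: "arr ?s1 aMark v = 0" if "v < n" for v using that by simp
  have st2: "stored ?s2" using st1 by (rule stored_exec_loop) (auto simp: bfs_init_def)
  have "bfs_invariant r 0 (arr ?s2 aQueue) (reg ?s2 rTail) (reg ?s2 rHead) (reg ?s2 rCur)
     (reg ?s2 rArc) (arr ?s2 aMark) (arr ?s2 aPar) [] [] (\<lambda>_. 0)"
    using r1 r(2) mark st1
    by (auto simp: bfs_init_def bfs_invariant_def parent_index_def stored_def lessThan_Suc)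
  then have init: "bfs_state r 0 ?s2" using st2 unfolding bfs_state_def by blast
  let ?N = "n + 2 * m"
  have N: "val (Plus (Var rN) (Plus (Var rM) (Var rM))) ?s2 = ?N" using st2 by (simp add: stored_def)
  have "bfs_state r (?N - 0) (exec_loop bfs_main ?s2)" unfolding bfs_main_def
  proof (rule exec_loop_invariant[where I = "\<lambda>k. bfs_state r (?N - k)"], unfold N)
    show "bfs_state r (?N - ?N) (set_reg rK ?N ?s2)" using init by (simp add: bfs_state_def stored_def)
    fix k s assume "k < ?N" "bfs_state r (?N - Suc k) s"
    then show "bfs_state r (?N - k) (exec bfs_step (set_reg rK k s))"
      using bfs_step[of r "?N - Suc k" s k] by (simp add: Suc_diff_Suc)
  qed
  then have fin: "bfs_state r ?N s'" by (simp add: s'_def bfs_def)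
  then show "stored s'" by (simp add: bfs_state_def)
  show "search_result r (arr s' aQueue) (arr s' aPar)" using fin bfs_finished unfolding bfs_state_def by blast
qed

end

context stored_graph
begin

context
  fixes r q pa
  assumes res: "search_result r q pa"
begin

lemma queue: "bij_betw q {..<n} {..<n}" "q 0 = r" "r < n" "pa r = n"
  using res by (auto simp: search_result_def)

lemma queue_index: "j < n \<Longrightarrow> inv_into {..<n} q (q j) = j"
  using queue(1) by (auto simp: bij_betw_def intro: inv_into_f_f)

lemma queue_less: "j < n \<Longrightarrow> q j < n"
  using queue(1) by (auto simp: bij_betw_def)

lemma queue_obtain: "v < n \<Longrightarrow> \<exists>j<n. v = q j"
  using queue(1) unfolding bij_betw_def by (metis imageE lessThan_iff)

lemma queue_nonroot: "j < n \<Longrightarrow> q j \<noteq> r \<longleftrightarrow> 1 \<le> j"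
  using queue_index[of j] queue_index[of 0] queue(2,3) by (cases j) auto

lemma search_order: "search_order G r pa (inv_into {..<n} q)"
proof
  obtain p where p: "parent_index q pa n n p" using res by (auto simp: search_result_def)
  have P: "\<exists>j. v = q j \<and> j < n \<and> p j < j \<and> pa v = q (p j) \<and> adj G (q (p j)) v \<and> (\<forall>i<p j. \<not> adj G (q i) v)"
    if v: "v \<in> verts G" "v \<noteq> r" for v
  proof -
    obtain j where j: "j < n" "v = q j" using queue_obtain v(1) verts by auto
    then have "1 \<le> j" using queue_nonroot v(2) by simp
    then show ?thesis using p j unfolding parent_index_def by blast
  qed
  show "block_graph G" "r \<in> verts G" using block_graph queue verts by auto
  show "inj_on (inv_into {..<n} q) (verts G)"
    using queue(1) verts by (simp add: bij_betw_def inj_on_inv_into)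
  fix v assume v: "v \<in> verts G" "v \<noteq> r"
  obtain j where j: "v = q j" "j < n" "p j < j" "pa v = q (p j)" "adj G (q (p j)) v"
    "\<forall>i<p j. \<not> adj G (q i) v" using P[OF v] by blast
  show "adj G (pa v) v" using j by simp
  show "inv_into {..<n} q (pa v) < inv_into {..<n} q v"
    using j queue_index[of j] queue_index[of "p j"] by simp
  fix u assume u: "adj G u v" "u \<noteq> pa v"
  obtain i where i: "i < n" "u = q i" using queue_obtain adj_bound(1)[OF u(1)] by auto
  have "\<not> i < p j" "i \<noteq> p j" using u i j by auto
  then show "inv_into {..<n} q (pa v) < inv_into {..<n} q u"
    using j i queue_index[of i] queue_index[of "p j"] by simp
qed

text \<open>Parent indices do not decrease along the queue. A sibling \<open>c\<close> of the last
  vertex that had a child would therefore stand no later than the parent of the last vertex, which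
  is the parent of \<open>c\<close> itself.\<close>

lemma last_leaf_vertex: "leaf_vertex G (q (n - 1))"
proof (cases "n = 1")
  case True
  have "\<not> adj G x y" for x y using adj_bound[of x y] simple_graph_adjD(1)[OF block_graph_simple[OF block_graph], of x y]
    True by auto
  then show ?thesis unfolding leaf_vertex_def nbhd_def by auto
next
  case False
  then have n: "1 \<le> n - 1" "n - 1 < n" using queue(3) by auto
  interpret search_order G r pa "inv_into {..<n} q" by (rule search_order)
  obtain p where p: "\<And>j. 1 \<le> j \<Longrightarrow> j < n \<Longrightarrow> pa (q j) = q (p j) \<and> p j < j \<and> (\<forall>j'. j \<le> j' \<and> j' < n \<longrightarrow> p j \<le> p j')"
    using res unfolding search_result_def parent_index_def by blast
  have z: "q (n - 1) \<in> nonroot" using queue_less n queue_nonroot by (simp add: nonroot_def verts)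
  show ?thesis
  proof (rule childless_leaf_vertex[OF z])
    fix c assume c: "c \<in> siblings (q (n - 1))"
    show "\<not> inner c"
    proof
      assume "inner c"
      then obtain d where d: "d \<in> nonroot" "pa d = c" by (auto simp: inner_def)
      then obtain j where j: "j < n" "d = q j" using queue_obtain by (auto simp: nonroot_def verts)
      then have j1: "1 \<le> j" using d queue_nonroot by (auto simp: nonroot_def)
      have "c = q (p j)" "p j < j" "p j \<le> p (n - 1)" using p[OF j1 j(1)] d j n by auto
      moreover have p1: "pa c = q (p (n - 1))" "p (n - 1) < n - 1" using siblingsD(2)[OF c] p[OF n] by auto
      moreover have "p (n - 1) < n" using p1(2) n by linarith
      ultimately show False
        using par(2)[OF siblingsD(1)[OF c]] queue_index[of "p j"] queue_index[of "p (n - 1)"] j by simp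
    qed
  qed
qed

end

end

section \<open>The tables\<close>

text \<open>The endpoints are not stored separately; they are the targets of the two opposite arcs
  of the edge.\<close>

definition load_edge :: "stm list" where
  "load_edge = [Assign rU (Arr aTarget (Plus (Plus (Var rK) (Var rK)) (Num 2))),
     Assign rV (Arr aTarget (Plus (Plus (Var rK) (Var rK)) (Num 1)))]"

definition different_parents :: aexp where
  "different_parents = neq_exp (Arr aPar (Var rU)) (Arr aPar (Var rV))"

definition lower_rep :: "nat \<Rightarrow> nat \<Rightarrow> stm" where
  "lower_rep u v = If (Minus (Arr aRep (Var u)) (Var v)) (Update aRep (Var u) (Var v)) Skip"

definition rep_init :: loop where
  "rep_init = For rK (Var rN) (Update aRep (Var rK) (Var rK))"

text \<open>A sibling class is a clique, so the least adjacent sibling, or the vertex itself, is the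
  least member of the class. One pass over the edges replaces a union-find structure.\<close>

definition rep_step :: stm where
  "rep_step = block_stm (load_edge @
     [If different_parents Skip (block_stm [lower_rep rU rV, lower_rep rV rU])])"

definition rep_edges :: loop where
  "rep_edges = For rK (Var rM) rep_step"

text \<open>For the root this writes to index \<open>n\<close>, which belongs to no vertex.\<close>

definition mark_inner :: loop where
  "mark_inner = For rK (Var rN) (Update aInner (Arr aPar (Var rK)) (Num 1))"

text \<open>\<open>aB2\<close> and \<open>aB3\<close> hold the two inner siblings found most
  recently, so they differ once the count reaches 2.\<close>

definition collect_step :: stm where
  "collect_step = If (Arr aInner (Var rK)) (block_stm
     [Assign rW (Arr aRep (Var rK)), Update aCount (Var rW) (Plus (Arr aCount (Var rW)) (Num 1)),
      Update aB3 (Var rW) (Arr aB2 (Var rW)), Update aB2 (Var rW) (Var rK)]) Skip"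

definition collect_inner :: loop where
  "collect_inner = For rK (Var rN) collect_step"

definition is_small :: "nat \<Rightarrow> aexp" where
  "is_small z = Minus (Num 2) (Arr aCount (Var z))"

text \<open>The loop variable decreases, so the children of a vertex are handled before the vertex itself.\<close>

definition down_step :: stm where
  "down_step = block_stm
     [Assign rW (Arr aQueue (Var rK)), Assign rZ (Arr aRep (Var rW)),
      If (is_small rZ) (Update aDown (Arr aPar (Var rW)) (Var rZ))
       (If (Arr aInner (Var rW)) (Update aDown (Arr aPar (Var rW)) (Arr aDown (Var rW))) Skip)]"

definition find_down :: loop where
  "find_down = For rK (Var rN) down_step"

text \<open>The second vertex of the queue is a child of the root. If there is only one vertex, the
  value is meaningless, but then no color is printed.\<close>

definition find_up :: loop where
  "find_up = For rK (Num 1) (Assign rUp (Arr aRep (Arr aQueue (Num 1))))"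

definition print_step :: stm where
  "print_step = block_stm (load_edge @
     [If different_parents
       (block_stm [If (neq_exp (Arr aPar (Var rU)) (Var rV)) (Assign rW (Var rV)) (Assign rW (Var rU)),
          Assign rZ (Arr aRep (Var rW)),
          If (is_small rZ) (Output (Var rZ))
            (If (neq_exp (Var rW) (Arr aB2 (Var rZ))) (Output (Arr aDown (Arr aB2 (Var rZ))))
              (Output (Arr aDown (Arr aB3 (Var rZ)))))])
       (block_stm [Assign rZ (Arr aRep (Var rU)),
          If (is_small rZ) (Output (Var rZ)) (Output (Var rUp))])])"

definition print_colors :: loop where
  "print_colors = For rK (Var rM) print_step"

lemma val_different_parents [simp]:
  "0 < val different_parents s \<longleftrightarrow> arr s aPar (reg s rU) \<noteq> arr s aPar (reg s rV)"
  by (simp add: different_parents_def)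

lemma val_is_small [simp]: "0 < val (is_small z) s \<longleftrightarrow> arr s aCount (reg s z) < 2"
  by (auto simp: is_small_def)

locale table_loops = leaf_search_order G root par pos
  for G :: "nat ugraph" and root :: nat and par :: "nat \<Rightarrow> nat" and pos :: "nat \<Rightarrow> nat" +
  fixes n :: nat and es :: "(nat \<times> nat) list" and q T :: "nat \<Rightarrow> nat"
  assumes verts: "verts G = {..<n}"
    and edges: "edges G = set (edge_list_of es)"
    and par_root: "par root = n"
    and q: "bij_betw q {..<n} {..<n}" "q 0 = root" "\<And>j. j < n \<Longrightarrow> pos (q j) = j"
    and T: "\<And>k. k < length es \<Longrightarrow> T (k + k + 2) = fst (rev es ! k) \<and> T (k + k + 1) = snd (rev es ! k)"
begin

definition tables :: "store \<Rightarrow> bool" where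
  "tables s \<longleftrightarrow> reg s rN = n \<and> reg s rM = length es \<and> arr s aTarget = T \<and>
     arr s aPar = par \<and> arr s aQueue = q"

lemma tables_exec_loop:
  assumes "tables s" "loop_regs l \<inter> {rN, rM} = {}" "loop_arrays l \<inter> {aTarget, aPar, aQueue} = {}"
  shows "tables (exec_loop l s)"
  using assms reg_exec_loop arr_exec_loop unfolding tables_def by auto

lemma load_edge:
  assumes "tables s" "k < length es"
  defines "s' \<equiv> exec (block_stm load_edge) (set_reg rK k s)"
  shows "reg s' = (reg s)(rK := k, rU := fst (rev es ! k), rV := snd (rev es ! k))" "arr s' = arr s"
    "printed s' = printed s"
  using assms T[of k] by (simp_all add: load_edge_def tables_def)

lemma exec_block_append: "exec (block_stm (xs @ ys)) s = exec (block_stm ys) (exec (block_stm xs) s)"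
  by (induction xs arbitrary: s) auto

lemma adj_es: "adj G u v \<longleftrightarrow> (u, v) \<in> set es \<or> (v, u) \<in> set es"
  unfolding adj_def edges edge_list_of_def by (auto simp: doubleton_eq_iff)

lemma es_adj: "k < length es \<Longrightarrow> adj G (fst (rev es ! k)) (snd (rev es ! k))"
  unfolding adj_es by (metis length_rev nth_mem prod.collapse set_rev)

lemma nonroot_less: "v \<in> nonroot \<longleftrightarrow> v < n \<and> v \<noteq> root"
  by (auto simp: nonroot_def verts)

lemma par_less_n: "v \<in> nonroot \<Longrightarrow> par v < n"
  using par(4) verts by auto

definition seen :: "nat \<Rightarrow> nat \<Rightarrow> nat set" where
  "seen k v = insert v {w. \<exists>j. k \<le> j \<and> j < length es \<and> par w = par v \<and>
     (rev es ! j = (v, w) \<or> rev es ! j = (w, v))}"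

lemma finite_seen: "finite (seen k v)"
proof (rule finite_subset)
  show "seen k v \<subseteq> insert v (fst ` set es \<union> snd ` set es)"
  proof
    fix w assume "w \<in> seen k v"
    then consider "w = v" | j where "j < length es" "rev es ! j = (v, w) \<or> rev es ! j = (w, v)"
      by (auto simp: seen_def)
    then show "w \<in> insert v (fst ` set es \<union> snd ` set es)"
    proof cases
      case 2
      then have "rev es ! j \<in> set es" by (metis length_rev nth_mem set_rev)
      then show ?thesis using 2 by force
    qed simp
  qed
qed simp

lemma seen_Suc:
  assumes "k < length es" "rev es ! k = (u, v)" "u \<noteq> v"
  shows "seen k x = (if par u \<noteq> par v then seen (Suc k) x
     else if x = u then insert v (seen (Suc k) u) else if x = v then insert u (seen (Suc k) v)
     else seen (Suc k) x)"
proof -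
  have "k \<le> j \<longleftrightarrow> j = k \<or> Suc k \<le> j" for j by auto
  then have "seen k x = seen (Suc k) x \<union> {w. par w = par x \<and> (rev es ! k = (x, w) \<or> rev es ! k = (w, x))}"
    using assms(1) by (auto simp: seen_def)
  then show ?thesis using assms(2,3) by auto
qed

lemma seen_0:
  assumes "v < n"
  shows "seen 0 v = (if v = root then {root} else siblings v)"
proof -
  have "(\<exists>j. j < length es \<and> rev es ! j = e) \<longleftrightarrow> e \<in> set es" for e by (metis in_set_conv_nth length_rev set_rev)
  then have "seen 0 v = insert v {w. adj G w v \<and> par w = par v}" unfolding seen_def adj_es by auto
  moreover have "w \<noteq> v \<and> w \<in> nonroot \<and> v \<noteq> root" if w: "adj G w v" "par w = par v" for w
  proof -
    have "w \<noteq> v" "w < n" using adjD[OF w(1)] verts by auto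
    moreover have "w = root \<longleftrightarrow> v = root"
      using \<open>w < n\<close> w(2) assms par_root par_less_n[of v] par_less_n[of w] nonroot_less by (metis less_irrefl)
    ultimately show ?thesis by (auto simp: nonroot_less)
  qed
  ultimately have *: "seen 0 v = insert v {w. adj G w v \<and> par w = par v}"
    "\<And>w. adj G w v \<Longrightarrow> par w = par v \<Longrightarrow> w < n \<and> w \<noteq> root \<and> v \<noteq> root"
    unfolding nonroot_less by blast+
  show ?thesis
  proof (cases "v = root")
    case True
    then have "{w. adj G w v \<and> par w = par v} = {}" using *(2) by blast
    then show ?thesis using True *(1) by (simp only: if_True refl)
  next
    case False
    then show ?thesis using assms *(2) unfolding *(1) siblings_def nonroot_less by auto
  qed
qed

text \<open>The value at the root is what the loops leave there; it is the representative of no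
  sibling class.\<close>

definition rep :: "nat \<Rightarrow> nat" where
  "rep v = (if v = root then root else Min (siblings v))"

lemma rep_props:
  assumes v: "v \<in> nonroot"
  shows "rep v \<in> siblings v" "w \<in> siblings v \<Longrightarrow> rep w = rep v"
proof -
  have r: "rep v = Min (siblings v)" using v by (simp add: rep_def nonroot_less)
  show "rep v \<in> siblings v" unfolding r using finite_siblings self_sibling[OF v] by (intro Min_in) auto
  show "rep w = rep v" if w: "w \<in> siblings v"
    using r siblings_eq[OF v w] siblingsD(1)[OF w] by (simp add: rep_def nonroot_less)
qed

lemma rep_loops:
  assumes "tables s"
  shows "v < n \<Longrightarrow> arr (exec_loop rep_edges (exec_loop rep_init s)) aRep v = rep v"
proof -
  let ?s1 = "exec_loop rep_init s"
  have t1: "tables ?s1" using assms by (rule tables_exec_loop) (auto simp: rep_init_def)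
  have "\<forall>v. 0 \<le> v \<and> v < n \<longrightarrow> arr ?s1 aRep v = v" unfolding rep_init_def
  proof (rule exec_loop_invariant[where I = "\<lambda>k s. \<forall>v. k \<le> v \<and> v < n \<longrightarrow> arr s aRep v = v"])
    show "\<forall>v. val (Var rN) s \<le> v \<and> v < n \<longrightarrow> arr (set_reg rK (val (Var rN) s) s) aRep v = v"
      using assms by (auto simp: tables_def)
  qed (auto simp: Suc_le_eq)
  then have r1: "arr ?s1 aRep v = v" if "v < n" for v using that by simp
  let ?I = "\<lambda>k s. tables s \<and> (\<forall>v<n. arr s aRep v = Min (seen k v))"
  have "?I 0 (exec_loop rep_edges ?s1)" unfolding rep_edges_def
  proof (rule exec_loop_invariant[where I = ?I])
    have m: "val (Var rM) ?s1 = length es" using t1 by (simp add: tables_def)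
    have "seen (length es) v = {v}" for v by (auto simp: seen_def)
    then show "?I (val (Var rM) ?s1) (set_reg rK (val (Var rM) ?s1) ?s1)"
      unfolding m using t1 r1 by (simp add: tables_def)
    fix k s' assume k: "k < val (Var rM) ?s1" and I: "?I (Suc k) s'"
    have k: "k < length es" using k m by simp
    obtain u v where uv: "rev es ! k = (u, v)" by (cases "rev es ! k")
    have "adj G u v" using es_adj[OF k] uv by simp
    then have ne: "u \<noteq> v" and b: "u < n" "v < n" using adjD[of u v] verts by auto
    let ?s2 = "exec (block_stm load_edge) (set_reg rK k s')"
    note load = load_edge[OF conjunct1[OF I] k, unfolded uv fst_conv snd_conv]
    let ?s3 = "exec rep_step (set_reg rK k s')"
    have t: "arr s' aPar = par" using I by (simp add: tables_def)
    have "tables ?s3"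
      using I load unfolding rep_step_def exec_block_append by (simp add: tables_def lower_rep_def)
    moreover have "arr ?s3 aRep x = Min (seen k x)" if x: "x < n" for x
    proof -
      have "arr ?s3 aRep x = (if par u \<noteq> par v then arr s' aRep x
         else if x = u then min v (arr s' aRep u) else if x = v then min u (arr s' aRep v) else arr s' aRep x)"
        using load t ne unfolding rep_step_def exec_block_append by (auto simp: lower_rep_def min_def)
      moreover have "seen j y \<noteq> {}" for j y by (simp add: seen_def)
      ultimately show ?thesis
        unfolding seen_Suc[OF k uv ne] using I x b by (simp add: Min_insert finite_seen)
    qed
    ultimately show "?I k ?s3" by blast
  qed
  then show "arr (exec_loop rep_edges ?s1) aRep v = rep v" if "v < n"
    using seen_0[OF that] that by (simp add: rep_def)
qed

lemma mark_inner_loop: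
  assumes t: "tables s" and zero: "arr s aInner = (\<lambda>_. 0)"
  shows "v < n \<Longrightarrow> 0 < arr (exec_loop mark_inner s) aInner v \<longleftrightarrow> inner v"
proof -
  let ?I = "\<lambda>k s. tables s \<and> (\<forall>v. 0 < arr s aInner v \<longleftrightarrow> (\<exists>j. k \<le> j \<and> j < n \<and> par j = v))"
  have "?I 0 (exec_loop mark_inner s)" unfolding mark_inner_def
  proof (rule exec_loop_invariant[where I = ?I])
    have n: "val (Var rN) s = n" using t by (simp add: tables_def)
    show "?I (val (Var rN) s) (set_reg rK (val (Var rN) s) s)"
      unfolding n using t zero by (auto simp: tables_def)
    fix k s' assume k: "k < val (Var rN) s" and I: "?I (Suc k) s'"
    have "(\<exists>j. k \<le> j \<and> j < n \<and> par j = v) \<longleftrightarrow> v = par k \<or> (\<exists>j. Suc k \<le> j \<and> j < n \<and> par j = v)" for v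
      using k n by (metis le_antisym not_less_eq_eq order_refl Suc_leD)
    then show "?I k (exec (Update aInner (Arr aPar (Var rK)) (Num 1)) (set_reg rK k s'))"
      using I by (auto simp: tables_def)
  qed
  then show "0 < arr (exec_loop mark_inner s) aInner v \<longleftrightarrow> inner v" if "v < n"
    using that par_root by (auto simp: inner_def nonroot_less)
qed

definition collected :: "nat \<Rightarrow> nat \<Rightarrow> nat set" where
  "collected k x = {v. k \<le> v \<and> v < n \<and> inner v \<and> rep v = x}"

text \<open>An inner root is entered under \<open>rep root = root\<close> and so does not disturb
  the count of any class.\<close>

lemma collected_0:
  assumes v: "v \<in> nonroot"
  shows "collected 0 (rep v) = inner_siblings v"
proof -
  have "w \<in> siblings v" if "w < n" "rep w = rep v" for w
  proof -
    have r: "rep v \<in> siblings v" using rep_props(1)[OF v] .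
    then have "rep v \<noteq> root" using siblingsD(1) nonroot_less by blast
    then have w: "w \<in> nonroot" using that by (auto simp: nonroot_less rep_def)
    then have "siblings w = siblings v"
      using rep_props(1)[OF w] r siblings_eq[OF w] siblings_eq[OF v] that by metis
    then show ?thesis using self_sibling[OF w] by simp
  qed
  then show ?thesis
    using rep_props(2)[OF v] siblingsD(1)[of _ v] by (auto simp: collected_def inner_siblings_def nonroot_less)
qed

lemma collect_inner_loop:
  assumes t: "tables s" and zero: "arr s aCount = (\<lambda>_. 0)"
    and rep: "\<And>v. v < n \<Longrightarrow> arr s aRep v = rep v"
    and inn: "\<And>v. v < n \<Longrightarrow> 0 < arr s aInner v \<longleftrightarrow> inner v"
    and v: "v \<in> nonroot"
  defines "s' \<equiv> exec_loop collect_inner s"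
  shows "arr s' aCount (rep v) = card (inner_siblings v)"
    "\<not> card (inner_siblings v) < 2 \<Longrightarrow> arr s' aB2 (rep v) \<in> inner_siblings v \<and>
      arr s' aB3 (rep v) \<in> inner_siblings v \<and> arr s' aB2 (rep v) \<noteq> arr s' aB3 (rep v)"
proof -
  let ?J = "\<lambda>k s. tables s \<and> (\<forall>v<n. arr s aRep v = rep v) \<and> (\<forall>v<n. 0 < arr s aInner v \<longleftrightarrow> inner v)"
  let ?I = "\<lambda>k s. ?J k s \<and> (\<forall>x. arr s aCount x = card (collected k x) \<and>
     (1 \<le> card (collected k x) \<longrightarrow> arr s aB2 x \<in> collected k x) \<and>
     (2 \<le> card (collected k x) \<longrightarrow> arr s aB3 x \<in> collected k x \<and> arr s aB2 x \<noteq> arr s aB3 x))"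
  have "?I 0 s'" unfolding s'_def collect_inner_def
  proof (rule exec_loop_invariant[where I = ?I])
    have n: "val (Var rN) s = n" using t by (simp add: tables_def)
    have "collected n x = {}" for x by (auto simp: collected_def)
    then show "?I (val (Var rN) s) (set_reg rK (val (Var rN) s) s)"
      unfolding n using t zero rep inn by (simp add: tables_def)
    fix k s1 assume k: "k < val (Var rN) s" and I: "?I (Suc k) s1"
    have k: "k < n" using k n by simp
    have coll: "collected k x = (if inner k \<and> rep k = x then insert k (collected (Suc k) x) else collected (Suc k) x)" for x
      using k by (auto simp: collected_def Suc_le_eq order.order_iff_strict)
    have fin: "finite (collected (Suc k) x)" for x
      by (rule finite_subset[of _ "{..<n}"]) (auto simp: collected_def)
    have kn: "k \<notin> collected (Suc k) x" for x by (auto simp: collected_def)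
    let ?s2 = "exec collect_step (set_reg rK k s1)"
    have J: "?J k ?s2" using I by (simp add: tables_def collect_step_def)
    have "arr ?s2 aCount x = card (collected k x) \<and>
      (1 \<le> card (collected k x) \<longrightarrow> arr ?s2 aB2 x \<in> collected k x) \<and>
      (2 \<le> card (collected k x) \<longrightarrow> arr ?s2 aB3 x \<in> collected k x \<and> arr ?s2 aB2 x \<noteq> arr ?s2 aB3 x)" for x
    proof (cases "inner k \<and> rep k = x")
      case True
      have c: "collected k x = insert k (collected (Suc k) x)" using coll True by simp
      have card: "card (collected k x) = Suc (card (collected (Suc k) x))" using c fin kn by simp
      have up: "arr ?s2 aCount x = Suc (arr s1 aCount x)" "arr ?s2 aB2 x = k" "arr ?s2 aB3 x = arr s1 aB2 x"
        using True I k by (auto simp: tables_def collect_step_def)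
      show ?thesis using I kn unfolding up card by (auto simp: c)
    next
      case False
      then have c: "collected k x = collected (Suc k) x" using coll by auto
      have up: "arr ?s2 aCount x = arr s1 aCount x" "arr ?s2 aB2 x = arr s1 aB2 x" "arr ?s2 aB3 x = arr s1 aB3 x"
        using False I k by (auto simp: tables_def collect_step_def)
      show ?thesis using I unfolding up c by blast
    qed
    then show "?I k ?s2" using J by blast
  qed
  then have "arr s' aCount x = card (collected 0 x) \<and>
     (1 \<le> card (collected 0 x) \<longrightarrow> arr s' aB2 x \<in> collected 0 x) \<and>
     (2 \<le> card (collected 0 x) \<longrightarrow> arr s' aB3 x \<in> collected 0 x \<and> arr s' aB2 x \<noteq> arr s' aB3 x)" for x by blast
  from this[of "rep v"] show "arr s' aCount (rep v) = card (inner_siblings v)"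
    "\<not> card (inner_siblings v) < 2 \<Longrightarrow> arr s' aB2 (rep v) \<in> inner_siblings v \<and>
      arr s' aB3 (rep v) \<in> inner_siblings v \<and> arr s' aB2 (rep v) \<noteq> arr s' aB3 (rep v)"
    unfolding collected_0[OF v] by auto
qed

definition small_below :: "nat \<Rightarrow> nat \<Rightarrow> bool" where
  "small_below v x \<longleftrightarrow> (\<exists>w\<in>nonroot. below (par w) v \<and> card (inner_siblings w) < 2 \<and> x = rep w)"

text \<open>Some child of \<open>v\<close> at position \<open>k\<close> or later of the queue passes a small block on to \<open>v\<close>.\<close>

definition supplied :: "nat \<Rightarrow> nat \<Rightarrow> bool" where
  "supplied k v \<longleftrightarrow> (\<exists>w\<in>nonroot. k \<le> pos w \<and> par w = v \<and> (card (inner_siblings w) < 2 \<or> inner w))"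

text \<open>Take any child of \<open>v\<close>. If its block is not small, the block has two inner
  siblings, and these are children of \<open>v\<close> too. All children come after
  \<open>v\<close>, whence the bound on \<open>k\<close>.\<close>

lemma supplied_inner:
  assumes v: "inner v" and k: "k \<le> Suc (pos v)"
  shows "supplied k v"
proof -
  obtain w where w: "w \<in> nonroot" "par w = v" using v by (auto simp: inner_def)
  show ?thesis
  proof (cases "card (inner_siblings w) < 2")
    case True
    moreover have "k \<le> pos w" using par(2)[OF w(1)] w(2) k by simp
    ultimately show ?thesis using w unfolding supplied_def by blast
  next
    case False
    then obtain x where "x \<in> inner_siblings w" by (metis card.empty ex_in_conv zero_less_numeral)
    then have x: "x \<in> nonroot" "par x = v" "inner x" using siblingsD[of x w] w by (auto simp: inner_siblings_def)
    moreover have "k \<le> pos x" using par(2)[OF x(1)] x(2) k by simp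
    ultimately show ?thesis unfolding supplied_def by blast
  qed
qed

lemma supplied_Suc:
  assumes s: "supplied k v" and k: "k < n"
    and other: "\<not> (q k \<in> nonroot \<and> par (q k) = v \<and> (card (inner_siblings (q k)) < 2 \<or> inner (q k)))"
  shows "supplied (Suc k) v"
proof -
  obtain w where w: "w \<in> nonroot" "k \<le> pos w" "par w = v" "card (inner_siblings w) < 2 \<or> inner w"
    using s unfolding supplied_def by blast
  have "pos w \<noteq> k"
  proof
    assume "pos w = k"
    moreover have "q k \<in> verts G" using q(1) k verts by (auto simp: bij_betw_def)
    ultimately have "w = q k" using pos_inj q(3)[OF k] nonrootD(1)[OF w(1)] by (metis inj_onD)
    then show False using other w by blast
  qed
  then have "Suc k \<le> pos w" using w(2) by simp
  then show ?thesis using w unfolding supplied_def by blast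
qed

lemma find_down_loop:
  assumes t: "tables s" and rep: "\<And>v. v < n \<Longrightarrow> arr s aRep v = rep v"
    and inn: "\<And>v. v < n \<Longrightarrow> 0 < arr s aInner v \<longleftrightarrow> inner v"
    and cnt: "\<And>v. v \<in> nonroot \<Longrightarrow> arr s aCount (rep v) = card (inner_siblings v)"
    and v: "v \<in> nonroot" "inner v"
  shows "small_below v (arr (exec_loop find_down s) aDown v)"
proof -
  let ?J = "\<lambda>s. tables s \<and> (\<forall>v<n. arr s aRep v = rep v) \<and> (\<forall>v<n. 0 < arr s aInner v \<longleftrightarrow> inner v) \<and>
     (\<forall>v\<in>nonroot. arr s aCount (rep v) = card (inner_siblings v))"
  let ?I = "\<lambda>k s. ?J s \<and> (\<forall>v<n. supplied k v \<longrightarrow> small_below v (arr s aDown v))"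
  have "?I 0 (exec_loop find_down s)" unfolding find_down_def
  proof (rule exec_loop_invariant[where I = ?I])
    have n: "val (Var rN) s = n" using t by (simp add: tables_def)
    have "pos w < n" if "w \<in> nonroot" for w
      using that q(1) q(3) unfolding nonroot_less bij_betw_def by (metis imageE lessThan_iff)
    then have "\<not> supplied n v" for v unfolding supplied_def by (meson not_le)
    then show "?I (val (Var rN) s) (set_reg rK (val (Var rN) s) s)"
      unfolding n using t rep inn cnt by (simp add: tables_def)
    fix k s1 assume k: "k < val (Var rN) s" and I: "?I (Suc k) s1"
    have k: "k < n" using k n by simp
    let ?s2 = "exec down_step (set_reg rK k s1)"
    let ?w = "q k"
    have w: "?w < n" "pos ?w = k" using q(1,3) k by (auto simp: bij_betw_def)
    have J: "?J ?s2" using I by (simp add: tables_def down_step_def)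
    have st: "arr s1 aQueue = q" "arr s1 aPar = par" using I by (auto simp: tables_def)
    have down: "arr ?s2 aDown = (if arr s1 aCount (rep ?w) < 2 then (arr s1 aDown)(par ?w := rep ?w)
      else if inner ?w then (arr s1 aDown)(par ?w := arr s1 aDown ?w) else arr s1 aDown)"
      using I w st by (simp add: down_step_def)
    have "small_below v (arr ?s2 aDown v)" if v: "v < n" "supplied k v" for v
    proof (cases "?w \<in> nonroot \<and> v = par ?w")
      case False
      \<comment> \<open>The root writes its entry at \<open>par root = n\<close>, which differs from
        the vertex \<open>v\<close>.\<close>
      have "par ?w \<noteq> v" if "?w \<notin> nonroot" using that par_root w v by (auto simp: nonroot_less)
      then have ne: "v \<noteq> par ?w" using False by auto
      then have "supplied (Suc k) v" using supplied_Suc[OF v(2) k] by blast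
      then show ?thesis using I v ne unfolding down by auto
    next
      case True
      then have cw: "arr s1 aCount (rep ?w) = card (inner_siblings ?w)" using I by blast
      consider "card (inner_siblings ?w) < 2" | "\<not> card (inner_siblings ?w) < 2" "inner ?w"
        | "\<not> card (inner_siblings ?w) < 2" "\<not> inner ?w" by blast
      then show ?thesis
      proof cases
        case 1
        then have "small_below v (rep ?w)" unfolding small_below_def using True below_refl by blast
        then show ?thesis using 1 cw True unfolding down by simp
      next
        case 2
        \<comment> \<open>The children of the vertex at position \<open>k\<close> stand later in the
          queue and have been handled, so its own entry can be passed on.\<close>
        have "supplied (Suc k) ?w" using supplied_inner[OF 2(2)] w by simp
        then have "small_below ?w (arr s1 aDown ?w)" using I w by blast
        then have "small_below v (arr s1 aDown ?w)"
          using True below_par[of ?w] below_trans unfolding small_below_def by blast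
        then show ?thesis using 2 cw True unfolding down by simp
      next
        case 3
        then have "supplied (Suc k) v" using supplied_Suc[OF v(2) k] by blast
        then show ?thesis using I v(1) 3 cw unfolding down by simp
      qed
    qed
    then show "?I k ?s2" using J by blast
  qed
  then show ?thesis using supplied_inner[OF v(2), of 0] v(1) by (simp add: nonroot_less)
qed

definition edge_color :: "store \<Rightarrow> nat \<times> nat \<Rightarrow> nat" where
  "edge_color s e = (let u = fst e; v = snd e in
     if par u \<noteq> par v then
       let w = (if par u \<noteq> v then v else u); z = rep w in
       if arr s aCount z < 2 then z
       else if w \<noteq> arr s aB2 z then arr s aDown (arr s aB2 z) else arr s aDown (arr s aB3 z)
     else let z = rep u in if arr s aCount z < 2 then z else reg s rUp)"

text \<open>Edges are numbered from the end and the counter runs down, so the output follows the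
  order of the input.\<close>

lemma print_colors_loop:
  assumes t: "tables s" and rep: "\<And>v. v < n \<Longrightarrow> arr s aRep v = rep v"
  shows "printed (exec_loop print_colors s) = printed s @ map (edge_color s) es"
proof -
  let ?f = "edge_color s" and ?m = "length es"
  let ?I = "\<lambda>k s'. tables s' \<and> arr s' = arr s \<and> reg s' rUp = reg s rUp \<and>
     printed s' = printed s @ map ?f (take (?m - k) es)"
  have "?I 0 (exec_loop print_colors s)" unfolding print_colors_def
  proof (rule exec_loop_invariant[where I = ?I])
    have m: "val (Var rM) s = ?m" using t by (simp add: tables_def)
    show "?I (val (Var rM) s) (set_reg rK (val (Var rM) s) s)"
      unfolding m using t by (simp add: tables_def)
    fix k s1 assume k: "k < val (Var rM) s" and I: "?I (Suc k) s1"
    have k: "k < ?m" using k m by simp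
    obtain u v where uv: "rev es ! k = (u, v)" by (cases "rev es ! k")
    have "adj G u v" using es_adj[OF k] uv by simp
    then have b: "u < n" "v < n" using adjD[of u v] verts by auto
    have tk: "take (?m - k) es = take (?m - Suc k) es @ [(u, v)]"
      using k uv by (simp add: rev_nth Suc_diff_Suc[symmetric] take_Suc_conv_app_nth)
    note load = load_edge[OF conjunct1[OF I] k, unfolded uv fst_conv snd_conv]
    have st: "arr s1 aPar = par" "arr s1 = arr s" "arr s aPar = par" "reg s1 rUp = reg s rUp"
      using I t by (simp_all add: tables_def)
    let ?s3 = "exec print_step (set_reg rK k s1)"
    have "tables ?s3" "arr ?s3 = arr s" "reg ?s3 rUp = reg s rUp"
      using I load st unfolding print_step_def exec_block_append by (auto simp: tables_def)
    moreover have "printed ?s3 = printed s1 @ [?f (u, v)]"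
      using load st rep[OF b(1)] rep[OF b(2)] unfolding print_step_def exec_block_append
      by (auto simp: edge_color_def Let_def)
    ultimately show "?I k ?s3" using I unfolding tk by simp
  qed
  then show ?thesis by simp
qed

end

section \<open>Correctness and running time of the program\<close>

definition next_root :: loop where
  "next_root = For rK (Num 1) (Assign rRoot (Arr aQueue (Minus (Var rN) (Num 1))))"

definition table_program :: "loop list" where
  "table_program = [rep_init, rep_edges, mark_inner, collect_inner, find_down, find_up]"

definition program :: "loop list" where
  "program = read_size # read_edges # bfs @ next_root # bfs @ table_program @ [print_colors]"

lemmas loop_defs = read_size_def read_edges_def add_arc_def bfs_def bfs_clear_def bfs_init_def
  bfs_main_def bfs_step_def visit_def next_root_def table_program_def rep_init_def rep_edges_def
  mark_inner_def collect_inner_def find_down_def find_up_def print_colors_def rep_step_def collect_step_def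
  down_step_def print_step_def load_edge_def
  lower_rep_def different_parents_def is_small_def neq_exp_def

lemma wf_program: "\<forall>l\<in>set program. wf_loop l"
  by (simp add: program_def loop_defs)

lemma arr_fold: "\<forall>l\<in>set ls. k \<notin> loop_arrays l \<Longrightarrow> arr (fold exec_loop ls s) k = arr s k"
  by (induction ls arbitrary: s) (auto simp: arr_exec_loop)

fun silent :: "stm \<Rightarrow> bool" where
  "silent (Output a) = False"
| "silent (Seq c d) \<longleftrightarrow> silent c \<and> silent d"
| "silent (If a c d) \<longleftrightarrow> silent c \<and> silent d"
| "silent _ = True"

fun silent_loop :: "loop \<Rightarrow> bool" where
  "silent_loop (For i a c) = silent c"

lemma printed_exec: "silent c \<Longrightarrow> printed (exec c s) = printed s"
  by (induction c arbitrary: s) auto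

lemma printed_exec_loop:
  assumes "silent_loop l"
  shows "printed (exec_loop l s) = printed s"
proof (cases l)
  case (For i a c)
  show ?thesis unfolding For
    by (rule exec_loop_invariant[where I = "\<lambda>_ s'. printed s' = printed s"])
      (use assms For in \<open>auto simp: printed_exec\<close>)
qed

lemma printed_fold: "\<forall>l\<in>set ls. silent_loop l \<Longrightarrow> printed (fold exec_loop ls s) = printed s"
  by (induction ls arbitrary: s) (auto simp: printed_exec_loop)

text \<open>The registers for \<open>n\<close> and \<open>m\<close> are never overwritten, so all
  loop bounds keep their values. The summand 2 covers the loops with one iteration and the overhead
  counted by \<open>iterations\<close>.\<close>

lemma iterations_bound:
  assumes "\<forall>l\<in>set ls. \<exists>i a c. l = For i a c \<and> rN \<notin> insert i (regs c) \<and> rM \<notin> insert i (regs c) \<and>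
      a \<in> {Num 1, Var rN, Var rM, Plus (Var rN) (Plus (Var rM) (Var rM))}"
    and "reg s rN = n" "reg s rM = m"
  shows "iterations ls s \<le> length ls * (n + 2 * m + 2)"
  using assms
proof (induction ls arbitrary: s)
  case (Cons l ls)
  obtain i a c where l: "l = For i a c" "rN \<notin> insert i (regs c)" "rM \<notin> insert i (regs c)"
    "a \<in> {Num 1, Var rN, Var rM, Plus (Var rN) (Plus (Var rM) (Var rM))}" using Cons.prems(1) by fastforce
  have "reg (exec_loop l s) rN = n" "reg (exec_loop l s) rM = m"
    using l Cons.prems(2,3) reg_exec_loop[of _ l s] by auto
  then have "iterations ls (exec_loop l s) \<le> length ls * (n + 2 * m + 2)"
    using Cons.IH Cons.prems(1) by simp
  moreover have "Suc (val a s) \<le> n + 2 * m + 2" using l(4) Cons.prems(2,3) by auto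
  ultimately show ?case using l(1) by simp
qed simp

lemma card_arcs_from: "k \<le> length es \<Longrightarrow> card (arcs_from es k) = 2 * (length es - k) \<and> finite (arcs_from es k)"
proof (induction k rule: inc_induct)
  case base
  then show ?case by (simp add: arcs_from_def)
next
  case (step k)
  have b: "k + k + 2 < x" if "(x, e) \<in> arcs_from es (Suc k)" for x e
    using that arcs_from_bound[of x "fst e" "snd e" es "Suc k"] by simp
  have "arcs_of k e \<inter> arcs_from es (Suc k) = {}" "card (arcs_of k e) = 2" "finite (arcs_of k e)" for e
    by (auto simp: arcs_of_def dest: b)
  then show ?case using step arcs_from_Suc[of k es] by (simp add: card_Un_disjoint)
qed

lemma arcs_from_iff:
  "(x, u, w) \<in> arcs_from es 0 \<longleftrightarrow> (\<exists>k<length es. (x, u, w) \<in> arcs_of k (rev es ! k))"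
  unfolding arcs_from_def by auto

lemma ex_arc: "(\<exists>x. (x, u, w) \<in> arcs_from es 0) \<longleftrightarrow> (u, w) \<in> set es \<or> (w, u) \<in> set es"
proof -
  have mem: "(\<exists>k<length es. rev es ! k = e) \<longleftrightarrow> e \<in> set es" for e by (metis in_set_conv_nth length_rev set_rev)
  have "(\<exists>x. (x, u, w) \<in> arcs_of k e) \<longleftrightarrow> e = (u, w) \<or> e = (w, u)" for k e
    by (cases e) (auto simp: arcs_of_def)
  then have "(\<exists>x. (x, u, w) \<in> arcs_from es 0) \<longleftrightarrow> (\<exists>k<length es. rev es ! k = (u, w) \<or> rev es ! k = (w, u))"
    unfolding arcs_from_iff by blast
  then show ?thesis using mem by blast
qed

locale machine_input =
  fixes G :: "nat ugraph" and es :: "(nat \<times> nat) list"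
  assumes block_graph: "block_graph G" and enum: "enumerates_graph es G"
begin

definition n where "n = card (verts G)"

lemma verts: "verts G = {..<n}"
  using enum by (auto simp: enumerates_graph_def n_def)

lemma n_pos: "0 < n"
  using block_graph verts by (auto simp: block_graph_def connected_graph_def)

lemma edges: "edges G = set (edge_list_of es)"
  using enum by (simp add: enumerates_graph_def)

lemma distinct_edges: "distinct (edge_list_of es)"
  using enum by (simp add: enumerates_graph_def)

lemma card_edges: "card (edges G) = length es"
  using distinct_card[OF distinct_edges] edges by (simp add: edge_list_of_def)

lemma adj_es: "adj G u v \<longleftrightarrow> (u, v) \<in> set es \<or> (v, u) \<in> set es"
  unfolding adj_def edges edge_list_of_def by (auto simp: doubleton_eq_iff)

lemma stored_graph:
  assumes st: "arcs_stored (arcs_from es 0) n a L"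
  shows "stored_graph G n (length es) (a aTarget) (a aNext) (a aFirst) L"
proof
  show "block_graph G" "verts G = {..<n}" by (rule block_graph, rule verts)
  show "(\<Sum>v<n. length (L v)) = 2 * length es"
    using st card_arcs_from[of 0 es] by (simp add: arcs_stored_def)
  fix v assume v: "v < n"
  show "chain (a aNext) (a aFirst v) (L v)" using st v by (simp add: arcs_stored_def)
  have "a aTarget ` set (L v) = {w. \<exists>x. (x, v, w) \<in> arcs_from es 0}"
    using st v unfolding arcs_stored_def by (fastforce simp: image_iff)
  then show "a aTarget ` set (L v) = {w. adj G v w}" unfolding ex_arc adj_es .
qed

lemma arc_targets:
  assumes st: "arcs_stored (arcs_from es 0) n a L" and k: "k < length es"
  shows "a aTarget (k + k + 2) = fst (rev es ! k) \<and> a aTarget (k + k + 1) = snd (rev es ! k)"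
proof -
  have "(k + k + 1, fst (rev es ! k), snd (rev es ! k)) \<in> arcs_from es 0"
    "(k + k + 2, snd (rev es ! k), fst (rev es ! k)) \<in> arcs_from es 0"
    unfolding arcs_from_iff using k by (auto simp: arcs_of_def)
  then show ?thesis using st unfolding arcs_stored_def by fastforce
qed

definition after_read :: store where
  "after_read = exec_loop read_edges (exec_loop read_size (initial (encode_graph G es)))"

lemma tape_initial: "tape (initial (encode_graph G es)) = n # length es # encode_edges es"
  by (simp add: initial_def encode_graph_def card_edges n_def encode_edges_def)

text \<open>The first search starts at vertex 0, simply because the register for the root has its
  initial value.\<close>

lemma after_read:
  "reg after_read rN = n" "reg after_read rM = length es" "reg after_read rRoot = 0"
  "\<exists>L. arcs_stored (arcs_from es 0) n (arr after_read) L"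
proof -
  let ?s = "exec_loop read_size (initial (encode_graph G es))"
  note size = read_size[OF tape_initial]
  show "reg after_read rN = n" "reg after_read rM = length es" "reg after_read rRoot = 0"
    using reg_exec_loop[of rN read_edges ?s] reg_exec_loop[of rM read_edges ?s]
      reg_exec_loop[of rRoot read_edges ?s] size(1)
    unfolding after_read_def by (simp_all add: read_edges_def add_arc_def initial_def)
  have "u < n \<and> v < n" if "(u, v) \<in> set es" for u v
    using simple_graph_adjD[OF block_graph_simple[OF block_graph], of u v] that adj_es verts by auto
  then show "\<exists>L. arcs_stored (arcs_from es 0) n (arr after_read) L"
    unfolding after_read_def using size by (intro read_edges) (auto simp: initial_def)
qed

definition after_bfs :: store where
  "after_bfs = fold exec_loop (bfs @ next_root # bfs) after_read"

definition target :: "nat \<Rightarrow> nat" where "target = arr after_read aTarget"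
definition queue :: "nat \<Rightarrow> nat" where "queue = arr after_bfs aQueue"
definition par :: "nat \<Rightarrow> nat" where "par = arr after_bfs aPar"
definition root :: nat where "root = queue 0"

lemma after_bfs:
  "table_loops G root par (inv_into {..<n} queue) n es queue target"
  "reg after_bfs rN = n" "reg after_bfs rM = length es" "arr after_bfs aTarget = target"
proof -
  obtain L where L: "arcs_stored (arcs_from es 0) n (arr after_read) L" using after_read(4) by blast
  interpret stored_graph G n "length es" target "arr after_read aNext" "arr after_read aFirst" L
    unfolding target_def by (rule stored_graph[OF L])
  have "stored after_read" unfolding stored_def using after_read(1,2) by (simp add: target_def)
  note b1 = bfs[OF this after_read(3) n_pos]
  let ?s1 = "fold exec_loop bfs after_read"
  let ?z = "arr ?s1 aQueue (n - 1)"
  have z: "?z < n" using queue_less[OF b1(2)] n_pos by simp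
  have leaf: "leaf_vertex G ?z" using last_leaf_vertex[OF b1(2)] .
  have "stored (exec_loop next_root ?s1)"
    using b1(1) by (rule stored_exec_loop) (auto simp: next_root_def)
  moreover have "reg (exec_loop next_root ?s1) rRoot = ?z"
    using b1(1) by (simp add: next_root_def stored_def)
  ultimately have b2: "stored after_bfs" "search_result ?z queue par"
    using bfs[of "exec_loop next_root ?s1" ?z] z by (simp_all add: after_bfs_def queue_def par_def)
  have z_root: "?z = root" using b2(2) by (simp add: search_result_def root_def)
  note r = b2(2)[unfolded z_root]
  interpret search_order G root par "inv_into {..<n} queue" by (rule search_order[OF r])
  show "table_loops G root par (inv_into {..<n} queue) n es queue target"
  proof unfold_locales
    show "leaf_vertex G root" using leaf z_root by simp
    show "verts G = {..<n}" by (rule verts)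
    show "edges G = set (edge_list_of es)" by (rule edges)
    show "par root = n" "bij_betw queue {..<n} {..<n}" "queue 0 = root" using queue[OF r] by auto
    show "inv_into {..<n} queue (queue j) = j" if "j < n" for j using queue_index[OF r that] .
    show "target (k + k + 2) = fst (rev es ! k) \<and> target (k + k + 1) = snd (rev es ! k)"
      if "k < length es" for k using arc_targets[OF L that] by (simp add: target_def)
  qed
  show "reg after_bfs rN = n" "reg after_bfs rM = length es" "arr after_bfs aTarget = target"
    using b2(1) by (simp_all add: stored_def)
qed

sublocale table_loops G root par "inv_into {..<n} queue" n es queue target
  by (rule after_bfs)

definition final :: store where "final = fold exec_loop table_program after_bfs"

text \<open>No earlier phase writes these arrays, so the zeros of the initial memory serve as their
  initialization.\<close>

lemma zero_after_bfs: "k \<in> {aInner, aCount} \<Longrightarrow> arr after_bfs k = (\<lambda>_. 0)"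
proof -
  assume k: "k \<in> {aInner, aCount}"
  have eq: "after_bfs = fold exec_loop (read_size # read_edges # bfs @ next_root # bfs) (initial (encode_graph G es))"
    by (simp add: after_bfs_def after_read_def)
  have "arr after_bfs k = arr (initial (encode_graph G es)) k"
    unfolding eq by (rule arr_fold) (use k in \<open>auto simp: loop_defs\<close>)
  then show ?thesis by (simp add: initial_def)
qed

lemma final:
  "tables final"
  "\<And>v. v < n \<Longrightarrow> arr final aRep v = rep v"
  "\<And>v. v \<in> nonroot \<Longrightarrow> arr final aCount (rep v) = card (inner_siblings v)"
  "\<And>v. v \<in> nonroot \<Longrightarrow> \<not> card (inner_siblings v) < 2 \<Longrightarrow> arr final aB2 (rep v) \<in> inner_siblings v \<and>
      arr final aB3 (rep v) \<in> inner_siblings v \<and> arr final aB2 (rep v) \<noteq> arr final aB3 (rep v)"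
  "\<And>v. v \<in> nonroot \<Longrightarrow> inner v \<Longrightarrow> small_below v (arr final aDown v)"
  "1 < n \<Longrightarrow> reg final rUp = rep (queue 1)"
proof -
  let ?s1 = "exec_loop rep_edges (exec_loop rep_init after_bfs)"
  let ?s2 = "exec_loop mark_inner ?s1"
  let ?s3 = "exec_loop collect_inner ?s2"
  let ?s4 = "exec_loop find_down ?s3"
  have t0: "tables after_bfs" unfolding tables_def using after_bfs(2-4) by (simp add: queue_def par_def)
  have t1: "tables ?s1"
    by (intro tables_exec_loop t0) (auto simp: loop_defs)
  have t2: "tables ?s2" using t1 by (rule tables_exec_loop) (auto simp: loop_defs)
  have t3: "tables ?s3" using t2 by (rule tables_exec_loop) (auto simp: loop_defs)
  have t4: "tables ?s4" using t3 by (rule tables_exec_loop) (auto simp: loop_defs)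
  have fin: "final = exec_loop find_up ?s4" by (simp add: final_def table_program_def)
  have "arr ?s1 aInner = arr after_bfs aInner" "arr ?s2 aCount = arr after_bfs aCount"
    by (simp_all add: arr_exec_loop loop_defs del: exec_loop.simps)
  then have zero: "arr ?s1 aInner = (\<lambda>_. 0)" "arr ?s2 aCount = (\<lambda>_. 0)" using zero_after_bfs by simp_all
  have r1: "arr ?s1 aRep v = rep v" if "v < n" for v using rep_loops[OF t0 that] .
  have i2: "0 < arr ?s2 aInner v \<longleftrightarrow> inner v" if "v < n" for v using mark_inner_loop[OF t1 zero(1) that] .
  have r2: "arr ?s2 aRep v = rep v" if "v < n" for v
    using r1[OF that] arr_exec_loop[of aRep mark_inner ?s1] by (simp add: loop_defs del: exec_loop.simps)
  note c3 = collect_inner_loop[OF t2 zero(2) r2 i2]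
  have r3: "arr ?s3 aRep v = rep v" "0 < arr ?s3 aInner v \<longleftrightarrow> inner v" if "v < n" for v
    using r2[OF that] i2[OF that] arr_exec_loop[of aRep collect_inner ?s2] arr_exec_loop[of aInner collect_inner ?s2]
    by (simp_all add: loop_defs del: exec_loop.simps)
  note d4 = find_down_loop[OF t3 r3 c3(1)]
  have same: "arr final k = arr ?s4 k" for k
    unfolding fin by (rule arr_exec_loop) (simp add: loop_defs)
  have same3: "arr final k = arr ?s3 k" if "k \<noteq> aDown" for k
    unfolding same by (rule arr_exec_loop) (use that in \<open>simp add: loop_defs\<close>)
  show "tables final" unfolding fin using t4 by (rule tables_exec_loop) (auto simp: loop_defs)
  show rf: "arr final aRep v = rep v" if "v < n" for v using r3(1)[OF that] same3 by simp
  show "arr final aCount (rep v) = card (inner_siblings v)" if "v \<in> nonroot" for v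
    using c3(1)[OF _ _ that] same3 by simp
  show "arr final aB2 (rep v) \<in> inner_siblings v \<and>
      arr final aB3 (rep v) \<in> inner_siblings v \<and> arr final aB2 (rep v) \<noteq> arr final aB3 (rep v)"
    if "v \<in> nonroot" "\<not> card (inner_siblings v) < 2" for v
    using c3(2)[OF _ _ that] same3 by simp
  show "small_below v (arr final aDown v)" if "v \<in> nonroot" "inner v" for v
    using d4[OF _ _ _ _ _ that] same by simp
  have "reg final rUp = arr ?s4 aRep (arr ?s4 aQueue 1)" by (simp add: fin find_up_def)
  moreover have "arr ?s4 aQueue = queue" using t4 by (simp add: tables_def)
  moreover have "queue 1 < n" if "1 < n" using q(1) that by (auto simp: bij_betw_def)
  ultimately show "reg final rUp = rep (queue 1)" if "1 < n" using rf same that by simp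
qed

lemma printed_program:
  "printed (fold exec_loop program (initial (encode_graph G es))) = map (edge_color final) es"
proof -
  have "fold exec_loop program (initial (encode_graph G es)) = exec_loop print_colors final"
    by (simp add: program_def final_def after_bfs_def after_read_def)
  moreover have eq: "final = fold exec_loop (read_size # read_edges # bfs @ next_root # bfs @ table_program)
     (initial (encode_graph G es))"
    by (simp add: final_def after_bfs_def after_read_def)
  have "printed final = printed (initial (encode_graph G es))"
    unfolding eq by (rule printed_fold) (simp add: loop_defs)
  ultimately show ?thesis using print_colors_loop[OF final(1,2)] by (simp add: initial_def)
qed

lemma decode:
  "(u, v) \<in> set es \<Longrightarrow> decode_coloring es (map f es) {u, v} = Some (f (u, v))"
  "dom (decode_coloring es (map f es)) = edges G"
proof -
  let ?g = "\<lambda>(u, v). {u, v}"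
  have z: "zip (edge_list_of es) (map f es) = map (\<lambda>e. (?g e, f e)) es"
    unfolding edge_list_of_def by (induction es) auto
  have "map fst (map (\<lambda>e. (?g e, f e)) es) = edge_list_of es" by (simp add: edge_list_of_def)
  then have d: "distinct (map fst (map (\<lambda>e. (?g e, f e)) es))" using distinct_edges by simp
  show "dom (decode_coloring es (map f es)) = edges G"
    unfolding decode_coloring_def z dom_map_of_conv_image_fst by (force simp: edges edge_list_of_def)
  show "decode_coloring es (map f es) {u, v} = Some (f (u, v))" if "(u, v) \<in> set es"
    unfolding decode_coloring_def z map_of_eq_Some_iff[OF d] using that by force
qed

lemma program_algA_output: "algA_output G (decode_coloring es (map (edge_color final) es))"
proof (cases "n = 1")
  case True
  \<comment> \<open>A single vertex has no child to serve as \<open>c0\<close>. There are no edges,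
    so any output is the empty coloring and equals the decoded one.\<close>
  obtain col where col: "algA_output G col" using algA_output_exists[OF block_graph] by blast
  have "edges G = {}"
    using simple_graph_edgeE[OF simple] True verts by (metis lessThan_iff less_one equals0I)
  moreover have "dom col = edges G"
    using algA_output_strong_rainbow[OF block_graph col] by (simp add: strong_rainbow_coloring_def)
  ultimately have "col = decode_coloring es (map (edge_color final) es)" using decode(2) by simp
  then show ?thesis using col by simp
next
  case False
  then have n1: "1 < n" using n_pos by simp
  let ?c = "queue 1"
  have c: "?c \<in> nonroot" "par ?c = root"
  proof -
    have "?c < n" using q(1) n1 by (auto simp: bij_betw_def)
    moreover have "?c \<noteq> queue 0"
      using q(1) n1 inj_onD[of queue "{..<n}" 1 0] unfolding bij_betw_def by auto
    ultimately
    show nr: "?c \<in> nonroot" by (simp add: nonroot_less q(2))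
    show "par ?c = root"
    proof (rule ccontr)
      assume "par ?c \<noteq> root"
      then have "par ?c \<in> nonroot" using par_less_n[OF nr] by (simp add: nonroot_less)
      then show False using root_least par(2)[OF nr] q(3)[OF n1] by fastforce
    qed
  qed
  interpret coloring_tables G root par "inv_into {..<n} queue" rep "arr final aB2" "arr final aB3"
    "arr final aDown" ?c
  proof
    show "\<exists>w\<in>nonroot. below (par w) v \<and> card (inner_siblings w) < 2 \<and> arr final aDown v = rep w"
      if "v \<in> nonroot" "inner v" for v using final(5)[OF that] by (auto simp: small_below_def)
  qed (use rep_props final(4) c in auto)
  show ?thesis
  proof (rule tables_algA_output)
    let ?col = "decode_coloring es (map (edge_color final) es)"
    show "dom ?col = edges G" by (rule decode(2))
    fix v assume v: "v \<in> nonroot"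
    \<comment> \<open>An edge is classified by comparing the parents of its ends, so parent and
      child must not look like siblings, and the child must be recognized in either orientation. At
      the root the fictitious parent \<open>n\<close> ensures this.\<close>
    have pp: "par (par v) \<noteq> par v" "par (par v) \<noteq> v"
    proof -
      have "par (par v) = n" if "par v = root" using that par_root by simp
      moreover have "par v < n" "v < n" using par_less_n[OF v] v by (auto simp: nonroot_less)
      moreover have "par (par v) \<noteq> par v \<and> par (par v) \<noteq> v" if "par v \<noteq> root"
      proof -
        have "par v \<in> nonroot" using that par_less_n[OF v] by (simp add: nonroot_less)
        from par(2)[OF this] show ?thesis using par(2)[OF v] by auto
      qed
      ultimately show "par (par v) \<noteq> par v" "par (par v) \<noteq> v" by (cases "par v = root"; force)+
    qed
    have col: "edge_color final (par v, v) = parent_color v" "edge_color final (v, par v) = parent_color v"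
      using pp pp[symmetric] final(3)[OF v] by (auto simp: edge_color_def parent_color_def Let_def)
    consider "(par v, v) \<in> set es" | "(v, par v) \<in> set es" using par(1)[OF v] adj_es by blast
    then show "?col {par v, v} = Some (parent_color v)"
      using decode(1)[of "par v" v] decode(1)[of v "par v"] col by cases (auto simp: insert_commute)
    fix w assume w: "w \<in> siblings v" "w \<noteq> v"
    have pw: "par w = par v" "rep w = rep v" using siblingsD(2)[OF w(1)] rep_props(2)[OF v w(1)] by auto
    have "edge_color final (w, v) = sibling_color v" "edge_color final (v, w) = sibling_color v"
      unfolding edge_color_def sibling_color_def Let_def using pw final(3)[OF v] final(6)[OF n1] by auto
    moreover have "(w, v) \<in> set es \<or> (v, w) \<in> set es" using w adj_es by (auto simp: siblings_def)
    ultimately show "?col {w, v} = Some (sibling_color v)"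
      using decode(1)[of w v] decode(1)[of v w] by (auto simp: insert_commute)
  qed
qed

lemma iterations_program:
  "iterations program (initial (encode_graph G es)) \<le> 64 * (card (verts G) + card (edges G))"
proof -
  let ?s = "exec_loop read_size (initial (encode_graph G es))"
  let ?ls = "read_edges # bfs @ next_root # bfs @ table_program @ [print_colors]"
  have "reg ?s rN = n" "reg ?s rM = length es" using read_size[OF tape_initial] by simp_all
  then have "iterations ?ls ?s \<le> length ?ls * (n + 2 * length es + 2)"
    by (intro iterations_bound) (simp_all add: loop_defs)
  moreover have "length ?ls = 15" by (simp add: bfs_def table_program_def)
  moreover have "iterations program (initial (encode_graph G es)) = 2 + iterations ?ls ?s"
    by (simp add: program_def read_size_def)
  ultimately have "iterations program (initial (encode_graph G es)) \<le> 2 + 15 * (n + 2 * length es + 2)"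
    by simp
  \<comment> \<open>The left side is \<open>15 * n + 30 * m + 32\<close> with \<open>m\<close> the
    number of edges; the constant 32 is absorbed because \<open>n\<close> is positive.\<close>
  also have "\<dots> \<le> 64 * (n + length es)" using n_pos by simp
  finally show ?thesis by (simp add: n_def card_edges)
qed

lemma program_correct:
  "\<exists>t cs. t \<le> length (compile 0 program) * 64 * (card (verts G) + card (edges G)) \<and>
    ram_computes_within (compile 0 program) (encode_graph G es) t cs \<and>
    length cs = length es \<and> algA_output G (decode_coloring es cs)"
proof -
  obtain t where t: "t \<le> length (compile 0 program) * iterations program (initial (encode_graph G es))"
    "ram_computes_within (compile 0 program) (encode_graph G es) t (map (edge_color final) es)"
    using compile_computes[OF wf_program, of "encode_graph G es"] printed_program by auto
  have "t \<le> length (compile 0 program) * (64 * (card (verts G) + card (edges G)))"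
    using t(1) mult_le_mono2[OF iterations_program, of "length (compile 0 program)"] by linarith
  then have "t \<le> length (compile 0 program) * 64 * (card (verts G) + card (edges G))"
    by (simp only: mult.assoc)
  then show ?thesis using t(2) program_algA_output length_map by blast
qed

end

theorem theorem6:
  "(\<forall>G :: 'a ugraph. block_graph G \<longrightarrow>
      algA_never_stuck G \<and>
      (\<exists>col. algA_output G col) \<and>
      (\<forall>col. algA_output G col \<longrightarrow> strong_rainbow_coloring G col)) \<and>
   (\<exists>P c. \<forall>G es. block_graph G \<and> enumerates_graph es G \<longrightarrow>
      (\<exists>t cs. t \<le> c * (card (verts G) + card (edges G)) \<and>
         ram_computes_within P (encode_graph G es) t cs \<and>
         length cs = length es \<and>
         algA_output G (decode_coloring es cs)))"
proof (intro conjI)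
  show "\<forall>G :: 'a ugraph. block_graph G \<longrightarrow>
      algA_never_stuck G \<and>
      (\<exists>col. algA_output G col) \<and>
      (\<forall>col. algA_output G col \<longrightarrow> strong_rainbow_coloring G col)"
    using algA_never_stuck algA_output_exists algA_output_strong_rainbow by blast
  have "machine_input G es" if "block_graph G \<and> enumerates_graph es G" for G es
    using that by unfold_locales auto
  then show "\<exists>P c. \<forall>G es. block_graph G \<and> enumerates_graph es G \<longrightarrow>
      (\<exists>t cs. t \<le> c * (card (verts G) + card (edges G)) \<and>
         ram_computes_within P (encode_graph G es) t cs \<and>
         length cs = length es \<and>
         algA_output G (decode_coloring es cs))"
    using machine_input.program_correct by blast
qed

end
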